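(* Let $n\ge 2$ and $k\in\{1,\dots,n\}$ be integers, let $g\in C^1(\mathbb{R})$ be nonnegative and nonincreasing, and let $w\in C^1(\mathbb{R}^n\setminus\{0\})$ be a radial function satisfying the assumptions on $w$ given in the context, with $\gamma=\lim_{r\to+\infty} r w'(r)/w(r)$. Let $u$ be a semi-stable nonconstant bounded radial solution of $S_k(D^2u)=w(|x|)g(u)$ in $\mathbb{R}^n$. Then: (i) $n>2\left(k+\frac{2\gamma}{k}+4\right)$. (ii) The limit $u_\infty=\lim_{r\to+\infty}u(r)\in\mathbb{R}$ exists, and there exists $M>0$, depending on $u$ and $w$, such that for all $r\ge 1$, $$|u(r)-u_\infty|\ \ge\ M r^{\delta(r)},$$ where $\delta(r)$ is the exponent defined in the context.
   Context: Radial functions are identified with functions of $r=|x|$, and $'$ denotes the derivative with respect to $r$. $k$-Hessian: $S_k(D^2u)$ is the sum of all $k$-th principal minors of the Hessian matrix $D^2u$, equivalently the $k$-th elementary symmetric polynomial of the eigenvalues of $D^2u$. Set $c_{n,k}=\binom{n}{k}/n$. Solutions: solutions are always taken in the class of $k$-admissible ($k$-convex) functions $\Phi^k=\{u\in C^2(\mathbb{R}^n): S_l(D^2u)\ge 0,\ l=1,\dots,k\}$. A radial solution is a radially symmetric $u\in\Phi^k$ satisfying the equation in $\mathbb{R}^n$. Semi-stability: a radial solution $u\in\Phi^k$ is semi-stable if $$\mathcal{Q}_u(\xi):=\int_{\mathbb{R}^n}\Big\{k c_{n,k}|x|^{1-k}|\nabla u|^{k-1}|\nabla \xi|^2+w(|x|)g'(u)\xi^2\Big\}\,dx\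 \ge 0$$ for every radially symmetric $\xi\in C_c^1(\mathbb{R}^n)$. Assumptions on $w$: $w$ is a nonnegative radial function; put $W(r)=\frac{r w'(r)}{w(r)}$. The functions $w$ and $W$ belong to $C^1(\mathbb{R}^n\setminus\{0\})$, $W$ is nonincreasing on $(0,\infty)$, and the limits $\Gamma=\lim_{r\to0}W(r)$ and $\gamma=\lim_{r\to+\infty}W(r)$ are finite. Exponents: for $s>0$ let $v(s)=\frac{k-1+W(s)}{k+1}$. For $r\ge 1$ let $$\alpha(r)=\frac{1}{\log r}\int_1^r \frac{v(s)+\sqrt{v(s)^2+\frac{n}{k}v(s)+\frac{n}{k}-1-s v'(s)}}{s}\,ds,\qquad \delta(r)=\frac{-n+2\alpha(r)+2k+2}{k+1},$$ the value at $r=1$ being understood as the limit $r\to1^+$.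
   Formalization: The estimate in (ii) is stated at those r ≥ 1 for which the expression under the square root in α is nonnegative on [1,r]; otherwise δ(r) is not a real number (e.g. k=1, n=3, g=1, w=(1+r)^(-5/2), r large). *)

theory Defs
  imports "HOL-Analysis.Analysis"
begin

definition radial :: "(real \<Rightarrow> real) \<Rightarrow> real ^ 'n \<Rightarrow> real" where
  "radial f = (\<lambda>x. f (norm x))"

definition gradient :: "(real ^ 'n \<Rightarrow> real) \<Rightarrow> real ^ 'n \<Rightarrow> real ^ 'n" where
  "gradient f x = (\<chi> i. frechet_derivative f (at x) (axis i 1))"

definition hessian :: "(real ^ 'n \<Rightarrow> real) \<Rightarrow> real ^ 'n \<Rightarrow> real ^ 'n ^ 'n" where
  "hessian f x = (\<chi> i j. gradient (\<lambda>y. gradient f y $ i) x $ j)"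

text \<open>Only meant for open sets \<open>S\<close>: derivatives are full (two-sided) ones.\<close>

definition C1_on :: "(real ^ 'n) set \<Rightarrow> (real ^ 'n \<Rightarrow> real) \<Rightarrow> bool" where
  "C1_on S f \<longleftrightarrow> (\<forall>x\<in>S. f differentiable (at x)) \<and> continuous_on S (gradient f)"

definition C2 :: "(real ^ 'n \<Rightarrow> real) \<Rightarrow> bool" where
  "C2 f \<longleftrightarrow> C1_on UNIV f \<and> (\<forall>i. C1_on UNIV (\<lambda>x. gradient f x $ i))"

text \<open>The determinant of the submatrix of \<open>A\<close> with rows and columns in \<open>I\<close>, by the
  Leibniz formula; for \<open>I = UNIV\<close> this is literally the definition of \<open>det A\<close>.\<close>

definition principal_minor :: "'n set \<Rightarrow> real ^ 'n ^ 'n \<Rightarrow> real" where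
  "principal_minor I A = (\<Sum>p | p permutes I. of_int (sign p) * (\<Prod>i\<in>I. A $ i $ p i))"

definition S_hess :: "nat \<Rightarrow> real ^ 'n ^ 'n \<Rightarrow> real" where
  "S_hess k A = (\<Sum>I | card I = k. principal_minor I A)"

definition k_admissible :: "nat \<Rightarrow> (real ^ 'n \<Rightarrow> real) \<Rightarrow> bool" where
  "k_admissible k u \<longleftrightarrow> C2 u \<and> (\<forall>l\<in>{1..k}. \<forall>x. S_hess l (hessian u x) \<ge> 0)"

text \<open>The weight \<open>w\<close> is only defined away from the origin, so the equation is imposed at
  \<open>x \<noteq> 0\<close>; the value \<open>w 0\<close> is never used.\<close>

definition radial_solution ::
  "nat \<Rightarrow> (real \<Rightarrow> real) \<Rightarrow> (real \<Rightarrow> real) \<Rightarrow> (real ^ 'n \<Rightarrow> real) \<Rightarrow> bool" where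
  "radial_solution k w g u \<longleftrightarrow> u \<in> range radial \<and> k_admissible k u \<and>
     (\<forall>x. x \<noteq> 0 \<longrightarrow> S_hess k (hessian u x) = w (norm x) * g (u x))"

definition c_nk :: "nat \<Rightarrow> nat \<Rightarrow> real" where
  "c_nk n k = real (n choose k) / real n"

definition Q_integrand ::
  "nat \<Rightarrow> (real \<Rightarrow> real) \<Rightarrow> (real \<Rightarrow> real) \<Rightarrow> (real ^ 'n \<Rightarrow> real) \<Rightarrow> (real ^ 'n \<Rightarrow> real) \<Rightarrow> real ^ 'n \<Rightarrow> real"
where
  "Q_integrand k w g u \<xi> x =
     real k * c_nk CARD('n) k * norm x powi (1 - int k) * norm (gradient u x) ^ (k - 1)
       * (norm (gradient \<xi> x))\<^sup>2
     + w (norm x) * deriv g (u x) * (\<xi> x)\<^sup>2"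

text \<open>For nonincreasing \<open>g\<close> the second term of the integrand is nonpositive, and \<open>w\<close> may be
  singular at the origin, so the integral can be \<open>-\<infinity>\<close>. The integrability requirement excludes
  this case, in which the Bochner integral would be 0 by convention.\<close>

definition semi_stable ::
  "nat \<Rightarrow> (real \<Rightarrow> real) \<Rightarrow> (real \<Rightarrow> real) \<Rightarrow> (real ^ 'n \<Rightarrow> real) \<Rightarrow> bool" where
  "semi_stable k w g u \<longleftrightarrow>
     (\<forall>\<xi> \<in> range radial. C1_on UNIV \<xi> \<and> compact (closure {x. \<xi> x \<noteq> 0}) \<longrightarrow>
        integrable lborel (Q_integrand k w g u \<xi>) \<and>
        integral\<^sup>L lborel (Q_integrand k w g u \<xi>) \<ge> 0)"

definition W_fun :: "(real \<Rightarrow> real) \<Rightarrow> real \<Rightarrow> real" where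
  "W_fun w r = r * deriv w r / w r"

definition v_fun :: "nat \<Rightarrow> (real \<Rightarrow> real) \<Rightarrow> real \<Rightarrow> real" where
  "v_fun k w s = (real k - 1 + W_fun w s) / (real k + 1)"

definition radicand :: "nat \<Rightarrow> nat \<Rightarrow> (real \<Rightarrow> real) \<Rightarrow> real \<Rightarrow> real" where
  "radicand n k w s =
     (v_fun k w s)\<^sup>2 + real n / real k * v_fun k w s + real n / real k - 1
       - s * deriv (v_fun k w) s"

definition alpha_quotient :: "nat \<Rightarrow> nat \<Rightarrow> (real \<Rightarrow> real) \<Rightarrow> real \<Rightarrow> real" where
  "alpha_quotient n k w r =
     1 / ln r * integral {1..r} (\<lambda>s. (v_fun k w s + sqrt (radicand n k w s)) / s)"

definition alpha :: "nat \<Rightarrow> nat \<Rightarrow> (real \<Rightarrow> real) \<Rightarrow> real \<Rightarrow> real" where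
  "alpha n k w r =
     (if r = 1 then Lim (at_right 1) (alpha_quotient n k w) else alpha_quotient n k w r)"

text \<open>The library's \<open>sqrt\<close> is odd, with negative values on negative arguments. The real
  exponent \<open>alpha n k w r\<close> is meaningful only if the radicand is nonnegative on \<open>[1,r]\<close>.\<close>

definition alpha_defined :: "nat \<Rightarrow> nat \<Rightarrow> (real \<Rightarrow> real) \<Rightarrow> real \<Rightarrow> bool" where
  "alpha_defined n k w r \<longleftrightarrow> (\<forall>s\<in>{1..r}. radicand n k w s \<ge> 0)"

definition delta :: "nat \<Rightarrow> nat \<Rightarrow> (real \<Rightarrow> real) \<Rightarrow> real \<Rightarrow> real" where
  "delta n k w r = (- real n + 2 * alpha n k w r + 2 * real k + 2) / (real k + 1)"

end

theory Submission
  imports Defs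
begin

text \<open>
  With \<open>F = r ^ (n - k) u' ^ k\<close> the equation reads \<open>c F' = r ^ (n - 1) w g(u)\<close>. Testing semi-stability
  with \<open>\<eta> \<rho> u'\<close>, where \<open>\<rho> = (r ^ (k - 1) w) powr (- 1 / (k + 1))\<close>, the derivatives of \<open>F\<close> cancel
  and one obtains \<open>\<integral> m (\<eta>'\<^sup>2 - D \<eta>\<^sup>2 / r\<^sup>2) dr \<ge> 0\<close> with \<open>m = \<rho>\<^sup>2 F u'\<close> and \<open>D\<close> the radicand in the
  definition of \<open>\<alpha>\<close>. Near the origin \<open>D > 0\<close> and \<open>m = o(r)\<close>, so a cut-off that equals \<open>1\<close> on \<open>[t, 1]\<close>
  has negative energy on \<open>(0, 1]\<close>. Continue it by \<open>exp (- \<integral> q / r)\<close> with \<open>q\<^sup>2 \<le> D\<close> on \<open>[1, R]\<close>, which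
  costs nothing, and linearly to \<open>0\<close> on \<open>[R, 2 R]\<close>: this bounds \<open>m\<close> from below on \<open>[R, 2 R]\<close>, and
  since \<open>F\<close> is nondecreasing, \<open>m\<close> is controlled there by \<open>(u\<^sub>\<infinity> - u(R)) ^ (k + 1)\<close>. Constant \<open>q\<close> gives
  the dimension bound, because \<open>u\<^sub>\<infinity> - u(R) \<longrightarrow> 0\<close>, and \<open>q = sqrt D\<close> gives the decay rate.
  Boundedness and monotonicity of \<open>F\<close> force \<open>n > 2 k\<close>, which settles the cases in which \<open>\<gamma>\<close> is so
  negative that \<open>D\<close> may change sign.
\<close>

section \<open>Radial functions\<close>

text \<open>Admissible tests are \<open>C^1\<close>, and \<open>w\<close> may be singular at the
  origin, so every test function here vanishes near 0. The head therefore needs an inner ramp. Its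
  cost goes to 0 because \<open>m = o(r)\<close>, which rests on a lower bound for the order of
  \<open>w\<close> at 0, namely \<Gamma> \<ge> 0. The sign of the radicand is governed by
  \<open>D = (v + 1) (v + n / k - 1) - r v'\<close> with \<open>v' \<le> 0\<close>. The second
  factor exceeds the first by \<open>n / k - 2 > 0\<close>, so \<open>D\<close> can be negative only
  where \<open>v < -1\<close>; hence the threshold \<open>v_inf = -1\<close> in both conclusions.
  The constants of the dimension bound come from a quadratic inequality. Put
  \<open>x = v_inf + 1\<close> and \<open>N = n - 2 k\<close>. The constant rate \<open>s\<close>
  with \<open>s\<^sup>2 = x (x + N / k)\<close> is allowed, and a gap that tends to 0 forces
  \<open>2 s + 2 x < N\<close>. Squaring cancels the terms in \<open>x\<^sup>2\<close> and leaves
  \<open>N > 4 x (1 + 1 / k) = 8 + 4 \<gamma> / k\<close>.\<close>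

lemma gradient_has_derivative:
  fixes f :: "real ^ 'n::finite \<Rightarrow> real"
  assumes "(f has_derivative f') (at x)"
  shows "gradient f x = (\<chi> i. f' (axis i 1))"
  using frechet_derivative_at[OF assms] by (simp add: gradient_def)

lemma gradient_cong_open:
  fixes f h :: "real ^ 'n::finite \<Rightarrow> real"
  assumes "open S" "x \<in> S" "\<And>y. y \<in> S \<Longrightarrow> f y = h y" "h differentiable (at x)"
  shows "gradient f x = gradient h x"
proof -
  from assms(4) obtain h' where h': "(h has_derivative h') (at x)"
    by (auto simp: differentiable_def)
  then have "(f has_derivative h') (at x)"
    by (rule has_derivative_transform_within_open[OF _ assms(1,2)]) (use assms(3) in auto)
  with h' show ?thesis by (simp add: gradient_has_derivative)
qed

text \<open>Radial functions are studied on one coordinate axis, where a gradient component is an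
  ordinary derivative. The axis passes through the origin, so it also captures the behaviour of the
  profile at 0.\<close>

lemma differentiable_gradient_along_axis:
  fixes f :: "real ^ 'n::finite \<Rightarrow> real"
  assumes "f differentiable (at (t *\<^sub>R axis i 1))"
  shows "((\<lambda>t. f (t *\<^sub>R axis i 1)) has_real_derivative gradient f (t *\<^sub>R axis i 1) $ i) (at t)"
proof -
  let ?e = "axis i 1 :: real ^ 'n"
  from assms obtain f' where f': "(f has_derivative f') (at (t *\<^sub>R ?e))"
    by (auto simp: differentiable_def)
  interpret f': bounded_linear f' using f' by (rule has_derivative_bounded_linear)
  have "((\<lambda>t. f (t *\<^sub>R ?e)) has_derivative (\<lambda>h. f' (h *\<^sub>R ?e))) (at t)"
    by (rule has_derivative_compose[where f="\<lambda>t. t *\<^sub>R ?e" and g=f, OF _ f'])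
      (auto intro!: derivative_eq_intros)
  moreover have "(\<lambda>h. f' (h *\<^sub>R ?e)) = (*) (gradient f (t *\<^sub>R ?e) $ i)"
    using f' by (auto simp: gradient_has_derivative f'.scaleR)
  ultimately show ?thesis by (simp add: has_field_derivative_def)
qed

lemma continuous_on_gradient_along_axis:
  fixes f :: "real ^ 'n::finite \<Rightarrow> real"
  assumes "C1_on S f" "\<And>t. t \<in> T \<Longrightarrow> t *\<^sub>R axis i 1 \<in> S"
  shows "continuous_on T (\<lambda>t. gradient f (t *\<^sub>R axis i 1) $ i)"
proof -
  have "continuous_on S (gradient f)" using assms(1) by (simp add: C1_on_def)
  then have "continuous_on T (\<lambda>t. gradient f (t *\<^sub>R axis i 1))"
    by (rule continuous_on_compose2) (use assms(2) in \<open>auto intro!: continuous_intros\<close>)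
  then show ?thesis by (intro continuous_intros)
qed

lemma radial_along_axis [simp]:
  "radial f (t *\<^sub>R axis (i::'n::finite) 1) = f \<bar>t\<bar>"
  by (simp add: radial_def)

lemma DERIV_radial_along_axis:
  assumes "(radial f :: real ^ 'n::finite \<Rightarrow> real) differentiable (at (t *\<^sub>R axis i 1))" "t > 0"
  shows "(f has_real_derivative gradient (radial f) (t *\<^sub>R axis (i::'n) 1) $ i) (at t)"
proof -
  have "((\<lambda>t. f \<bar>t\<bar>) has_real_derivative gradient (radial f) (t *\<^sub>R axis i 1) $ i) (at t)"
    using differentiable_gradient_along_axis[OF assms(1)] by simp
  then show ?thesis
    by (rule has_field_derivative_transform_within_open[where S="{0<..}"]) (use assms(2) in auto)
qed

lemma C1_on_radial_imp_DERIV: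
  fixes f :: "real \<Rightarrow> real"
  assumes "C1_on S (radial f :: real ^ 'n::finite \<Rightarrow> real)" "- {0} \<subseteq> S"
  shows "\<And>r. r > 0 \<Longrightarrow> (f has_real_derivative deriv f r) (at r)"
    and "\<And>r. r > 0 \<Longrightarrow> deriv f r = gradient (radial f :: real ^ 'n \<Rightarrow> real) (r *\<^sub>R axis i 1) $ i"
    and "continuous_on {0<..} (deriv f)"
proof -
  have S: "r *\<^sub>R axis i 1 \<in> S" if "r > 0" for r and i :: 'n
    using that assms(2) by (auto simp: axis_eq_0_iff)
  have D: "(f has_real_derivative gradient (radial f :: real ^ 'n \<Rightarrow> real) (r *\<^sub>R axis i 1) $ i) (at r)" if "r > 0" for r i
    using assms(1) S that by (intro DERIV_radial_along_axis) (auto simp: C1_on_def)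
  from D show *: "deriv f r = gradient (radial f :: real ^ 'n \<Rightarrow> real) (r *\<^sub>R axis i 1) $ i" if "r > 0" for r i
    using that by (auto intro!: DERIV_imp_deriv)
  with D show "(f has_real_derivative deriv f r) (at r)" if "r > 0" for r
    using that by metis
  fix i :: 'n
  have "continuous_on {0<..} (\<lambda>r. gradient (radial f :: real ^ 'n \<Rightarrow> real) (r *\<^sub>R axis i 1) $ i)"
    by (rule continuous_on_gradient_along_axis[OF assms(1)]) (use S in auto)
  then show "continuous_on {0<..} (deriv f)"
    by (rule continuous_on_eq) (use * in auto)
qed

section \<open>Gradient, Hessian and k-Hessian of a radial function\<close>

lemma has_derivative_radial:
  fixes x :: "real ^ 'n::finite"
  assumes "(f has_real_derivative d) (at (norm x))" "x \<noteq> 0"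
  shows "(radial f has_derivative (\<lambda>y. d * (x \<bullet> y) / norm x)) (at x)"
proof -
  have "((\<lambda>x. f (norm x)) has_derivative (\<lambda>y. (y \<bullet> sgn x) * d)) (at x)"
    using DERIV_compose_FDERIV[OF assms(1) has_derivative_norm[OF assms(2)]] by simp
  then show ?thesis unfolding radial_def
    by (rule has_derivative_eq_rhs)
      (auto simp: sgn_div_norm inner_commute field_simps)
qed

lemma gradient_radial:
  fixes x :: "real ^ 'n::finite"
  assumes "(f has_real_derivative d) (at (norm x))" "x \<noteq> 0"
  shows "gradient (radial f) x = (d / norm x) *\<^sub>R x"
  unfolding gradient_has_derivative[OF has_derivative_radial[OF assms]]
  by (auto simp: vec_eq_iff inner_axis)

text \<open>At a point of the axis the Hessian is already diagonal, with \<open>f''\<close> in the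
  radial direction and \<open>f' / r\<close> in the others. One point per sphere is enough to
  extract the radial equation, so rotations never enter.\<close>

lemma hessian_radial_axis:
  fixes i0 :: "'n::finite"
  assumes f: "\<And>r. r > 0 \<Longrightarrow> (f has_real_derivative f' r) (at r)"
    and f': "(f' has_real_derivative d2) (at r)" and r: "r > 0"
  shows "hessian (radial f) (r *\<^sub>R axis i0 1) $ i $ j =
    (if i = j then (if i = i0 then d2 else f' r / r) else 0)"
proof -
  let ?x = "r *\<^sub>R axis i0 1 :: real ^ 'n"
  let ?h = "\<lambda>t. f' t / t"
  have x0: "?x \<noteq> 0" and nx: "norm ?x = r" using r by (auto simp: axis_eq_0_iff)
  have h: "(?h has_real_derivative (d2 * r - f' r) / (r * r)) (at (norm ?x))"
    unfolding nx using r f' by (auto intro!: derivative_eq_intros)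
  have *: "((\<lambda>y. radial ?h y * y $ i) has_derivative
      (\<lambda>y. radial ?h ?x * y $ i + ((d2 * r - f' r) / (r * r) * (?x \<bullet> y) / norm ?x) * ?x $ i)) (at ?x)"
    by (rule has_derivative_mult[OF has_derivative_radial[OF h x0]])
      (rule bounded_linear_imp_has_derivative, rule bounded_linear_vec_nth)
  have "gradient (\<lambda>y. gradient (radial f) y $ i) ?x = gradient (\<lambda>y. radial ?h y * y $ i) ?x"
  proof (rule gradient_cong_open[where S="-{0}"])
    show "gradient (radial f) y $ i = radial ?h y * y $ i" if "y \<in> - {0}" for y
      using that gradient_radial[OF f, of y] by (simp add: radial_def)
  qed (use x0 * in \<open>auto simp: differentiable_def\<close>)
  also have "\<dots> $ j = (if i = j then (if i = i0 then d2 else f' r / r) else 0)"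
  proof -
    have ax: "axis a (1::real) $ b = (if b = a then 1 else 0)" for a b :: 'n
      by (simp add: axis_def)
    show ?thesis
      unfolding gradient_has_derivative[OF *] using r
      by (auto simp: inner_axis ax field_simps)
  qed
  finally show ?thesis by (simp add: hessian_def)
qed

text \<open>A permutation of \<open>I\<close> other than the identity moves an index of
  \<open>I\<close> and so picks up a vanishing off-diagonal factor.\<close>

lemma principal_minor_diagonal:
  fixes A :: "real ^ 'n::finite ^ 'n"
  assumes "\<And>i j. i \<noteq> j \<Longrightarrow> A $ i $ j = 0"
  shows "principal_minor I A = (\<Prod>i\<in>I. A $ i $ i)"
proof -
  have "principal_minor I A = (\<Sum>p\<in>{id}. of_int (sign p) * (\<Prod>i\<in>I. A $ i $ p i))"
    unfolding principal_minor_def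
  proof (rule sum.mono_neutral_right)
    show "\<forall>p\<in>{p. p permutes I} - {id}. of_int (sign p) * (\<Prod>i\<in>I. A $ i $ p i) = 0"
    proof
      fix p assume p: "p \<in> {p. p permutes I} - {id}"
      then obtain i where i: "p i \<noteq> i" by fastforce
      then have "i \<in> I" using p by (auto simp: permutes_def)
      moreover have "A $ i $ p i = 0" using assms i by metis
      ultimately show "of_int (sign p) * (\<Prod>i\<in>I. A $ i $ p i) = 0" by (auto intro!: prod_zero)
    qed
  qed (auto simp: permutes_id finite_permutations)
  then show ?thesis by (simp add: sign_id)
qed

text \<open>Index sets of size \<open>k\<close> are sorted by whether they contain
  \<open>i0\<close>. Those that do correspond to the subsets of size \<open>k - 1\<close> of the
  other indices, which explains the two binomial coefficients.\<close>

lemma S_hess_diagonal: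
  fixes A :: "real ^ 'n::finite ^ 'n"
  assumes A: "\<And>i j. A $ i $ j = (if i = j then (if i = i0 then a else b) else 0)"
    and k: "k \<ge> 1"
  shows "S_hess k A = real (CARD('n) - 1 choose (k - 1)) * a * b ^ (k - 1)
    + real (CARD('n) - 1 choose k) * b ^ k"
proof -
  let ?U = "UNIV - {i0}"
  have cU: "card ?U = CARD('n) - 1" by simp
  have PM: "principal_minor I A = (\<Prod>i\<in>I. if i = i0 then a else b)" for I
    using A by (subst principal_minor_diagonal) auto
  define X where "X = {J. J \<subseteq> ?U \<and> card J = k - 1}"
  define Y where "Y = {J. J \<subseteq> ?U \<and> card J = k}"
  have eq: "{I :: 'n set. card I = k} = insert i0 ` X \<union> Y"
  proof (intro equalityI subsetI)
    fix I assume I: "I \<in> {I :: 'n set. card I = k}"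
    show "I \<in> insert i0 ` X \<union> Y"
    proof (cases "i0 \<in> I")
      case True
      then have "I = insert i0 (I - {i0})" "I - {i0} \<in> X"
        using I k by (auto simp: X_def)
      then show ?thesis by blast
    qed (use I in \<open>auto simp: Y_def\<close>)
  next
    fix I assume "I \<in> insert i0 ` X \<union> Y"
    moreover have "card (insert i0 J) = k" if "J \<in> X" for J
    proof -
      have "i0 \<notin> J" "card J = k - 1" using that by (auto simp: X_def)
      then show ?thesis using k by simp
    qed
    ultimately show "I \<in> {I. card I = k}" by (auto simp: Y_def)
  qed
  have inj: "inj_on (insert i0) X" by (auto simp: inj_on_def X_def)
  have 1: "(\<Prod>i\<in>insert i0 J. if i = i0 then a else b) = a * b ^ (k - 1)" if "J \<in> X" for J
  proof -
    have J: "i0 \<notin> J" "card J = k - 1" using that by (auto simp: X_def)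
    have "(\<Prod>i\<in>J. if i = i0 then a else b) = (\<Prod>i\<in>J. b)"
      by (rule prod.cong) (use J in auto)
    then show ?thesis using J by simp
  qed
  have 2: "(\<Prod>i\<in>J. if i = i0 then a else b) = b ^ k" if "J \<in> Y" for J
  proof -
    have J: "i0 \<notin> J" "card J = k" using that by (auto simp: Y_def)
    have "(\<Prod>i\<in>J. if i = i0 then a else b) = (\<Prod>i\<in>J. b)"
      by (rule prod.cong) (use J in auto)
    then show ?thesis using J by simp
  qed
  have "S_hess k A = (\<Sum>I\<in>insert i0 ` X. \<Prod>i\<in>I. if i = i0 then a else b)
      + (\<Sum>I\<in>Y. \<Prod>i\<in>I. if i = i0 then a else b)"
    unfolding S_hess_def PM eq
    by (rule sum.union_disjoint) (auto simp: X_def Y_def)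
  also have "\<dots> = real (card X) * (a * b ^ (k - 1)) + real (card Y) * b ^ k"
    using 1 2 by (simp add: sum.reindex[OF inj])
  also have "card X = CARD('n) - 1 choose (k - 1)"
    unfolding X_def cU[symmetric] by (rule n_subsets) simp
  also have "card Y = CARD('n) - 1 choose k"
    unfolding Y_def cU[symmetric] by (rule n_subsets) simp
  finally show ?thesis by simp
qed

lemma S_hess_radial_axis:
  fixes i0 :: "'n::finite"
  assumes f: "\<And>r. r > 0 \<Longrightarrow> (f has_real_derivative f' r) (at r)"
    and f': "(f' has_real_derivative d2) (at r)" and r: "r > 0" and k: "k \<ge> 1"
  shows "S_hess k (hessian (radial f) (r *\<^sub>R axis i0 1)) =
    real (CARD('n) - 1 choose (k - 1)) * d2 * (f' r / r) ^ (k - 1)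
    + real (CARD('n) - 1 choose k) * (f' r / r) ^ k"
  by (rule S_hess_diagonal[OF hessian_radial_axis[OF f f' r] k])

text \<open>Together with \<open>nk_times_c_nk\<close> this turns both binomial coefficients of the
  radial k-Hessian into multiples of the same constant. That makes \<open>r ^ (n - 1)\<close> times
  the k-Hessian an exact derivative.\<close>

lemma k_times_c_nk:
  assumes "k \<ge> 1" "n \<ge> 1"
  shows "real k * c_nk n k = real (n - 1 choose (k - 1))"
proof -
  have "real k * real (n choose k) = real n * real (n - 1 choose (k - 1))"
    using times_binomial_minus1_eq[of k n] assms by (metis of_nat_mult less_eq_Suc_le One_nat_def)
  then show ?thesis using assms by (simp add: c_nk_def field_simps)
qed

lemma nk_times_c_nk:
  assumes "n \<ge> 1"
  shows "real (n - k) * c_nk n k = real (n - 1 choose k)"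
proof -
  have "real (n - k) * real (n choose k) = real n * real (n - 1 choose k)"
    using binomial_absorb_comp[of n k] by (metis of_nat_mult)
  then show ?thesis using assms by (simp add: c_nk_def field_simps)
qed

lemma radial_C2_profile:
  fixes u :: "real \<Rightarrow> real"
  assumes C2: "C2 (radial u :: real ^ 'n::finite \<Rightarrow> real)"
  shows "\<And>r. r > 0 \<Longrightarrow> (u has_real_derivative deriv u r) (at r)"
    and "\<And>r. r > 0 \<Longrightarrow> (deriv u has_real_derivative deriv (deriv u) r) (at r)"
    and "continuous_on {0<..} (deriv (deriv u))"
    and "\<exists>C. \<forall>\<^sub>F r in at_right 0. \<bar>deriv u r\<bar> \<le> C * r"
    and "(u \<longlongrightarrow> u 0) (at_right 0)"
proof -
  fix i :: 'n
  define e where "e = (axis i 1 :: real ^ 'n)"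
  define G where "G = (\<lambda>x. gradient (radial u :: real ^ 'n \<Rightarrow> real) x $ i)"
  define \<phi> where "\<phi> = (\<lambda>t. G (t *\<^sub>R e))"
  define \<phi>' where "\<phi>' = (\<lambda>t. gradient G (t *\<^sub>R e) $ i)"
  have C1: "C1_on UNIV (radial u :: real ^ 'n \<Rightarrow> real)" and C1G: "C1_on UNIV G"
    using C2 by (auto simp: C2_def G_def)
  note u = C1_on_radial_imp_DERIV[OF C1 subset_UNIV]
  show "(u has_real_derivative deriv u r) (at r)" if "r > 0" for r using u(1) that .
  have du: "deriv u r = \<phi> r" if "r > 0" for r
    unfolding \<phi>_def G_def e_def by (rule u(2)[OF that])
  have \<phi>: "(\<phi> has_real_derivative \<phi>' t) (at t)" for t
    unfolding \<phi>_def \<phi>'_def e_def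
    using C1G by (intro differentiable_gradient_along_axis) (auto simp: C1_on_def)
  have \<phi>'_cont: "continuous_on UNIV \<phi>'"
    unfolding \<phi>'_def e_def by (rule continuous_on_gradient_along_axis[OF C1G]) auto
  have ddu: "(deriv u has_real_derivative \<phi>' r) (at r)" if "r > 0" for r
    using \<phi>[of r] by (rule has_field_derivative_transform_within_open[where S="{0<..}"])
      (use du that in auto)
  then have ddu': "deriv (deriv u) r = \<phi>' r" if "r > 0" for r
    using that by (intro DERIV_imp_deriv)
  show "(deriv u has_real_derivative deriv (deriv u) r) (at r)" if "r > 0" for r
    using ddu[OF that] ddu'[OF that] by simp
  show "continuous_on {0<..} (deriv (deriv u))"
    by (rule continuous_on_eq[OF continuous_on_subset[OF \<phi>'_cont subset_UNIV]]) (simp add: ddu')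
  have abs0: "((\<lambda>t. u \<bar>t\<bar>) has_real_derivative \<phi> t) (at t)" for t
  proof -
    have "(radial u :: real ^ 'n \<Rightarrow> real) differentiable (at (t *\<^sub>R axis i 1))"
      using C1 by (simp add: C1_on_def)
    from differentiable_gradient_along_axis[OF this] show ?thesis
      unfolding \<phi>_def G_def e_def radial_along_axis .
  qed
  \<comment> \<open>On the axis the function is the even extension of \<open>u\<close>, so its
    derivative at 0 equals its own negative and vanishes. Differentiability of the gradient at 0
    then gives \<open>deriv u r = O(r)\<close>.\<close>
  have "((\<lambda>t. u \<bar>- t\<bar>) has_real_derivative - \<phi> 0) (at 0)"
    using abs0[of "- 0"] unfolding DERIV_mirror by simp
  then have "((\<lambda>t. u \<bar>t\<bar>) has_real_derivative - \<phi> 0) (at 0)" by simp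
  from DERIV_unique[OF this abs0] have \<phi>0: "\<phi> 0 = 0" by simp
  have "((\<lambda>r. \<phi> r / r) \<longlongrightarrow> \<phi>' 0) (at 0)"
    using \<phi>[of 0] by (simp add: DERIV_def \<phi>0)
  from tendsto_rabs[OF filterlim_at_split[THEN iffD1, THEN conjunct2, OF this]]
  have "((\<lambda>r. \<bar>\<phi> r / r\<bar>) \<longlongrightarrow> \<bar>\<phi>' 0\<bar>) (at_right 0)" .
  then have "\<forall>\<^sub>F r in at_right 0. \<bar>\<phi> r / r\<bar> < \<bar>\<phi>' 0\<bar> + 1"
    by (rule order_tendstoD) simp
  then have "\<forall>\<^sub>F r in at_right 0. \<bar>deriv u r\<bar> \<le> (\<bar>\<phi>' 0\<bar> + 1) * r"
    using eventually_at_right_less[of 0]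
  proof eventually_elim
    case (elim r)
    then have "\<bar>\<phi> r\<bar> / r \<le> \<bar>\<phi>' 0\<bar> + 1" by simp
    then show ?case using elim by (simp add: du pos_divide_le_eq)
  qed
  then show "\<exists>C. \<forall>\<^sub>F r in at_right 0. \<bar>deriv u r\<bar> \<le> C * r" by blast
  have "((\<lambda>t. u \<bar>t\<bar>) \<longlongrightarrow> u \<bar>0\<bar>) (at 0)"
    using DERIV_isCont[OF abs0[of 0]] by (simp add: isCont_def)
  from filterlim_at_split[THEN iffD1, THEN conjunct2, OF this]
  have "((\<lambda>t. u \<bar>t\<bar>) \<longlongrightarrow> u 0) (at_right 0)" by simp
  then show "(u \<longlongrightarrow> u 0) (at_right 0)"
    by (rule Lim_transform_eventually)
      (use eventually_at_right_less[of "0::real"] in \<open>eventually_elim, auto\<close>)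
qed

section \<open>Integration of radial functions\<close>

text \<open>The area of the sphere of radius \<open>r\<close>, as the derivative of the volume of
  the ball.\<close>

definition radial_density :: "nat \<Rightarrow> real \<Rightarrow> real" where
  "radial_density n r = (if r < 0 then 0 else unit_ball_vol (real n) * real n * r ^ (n - 1))"

lemma radial_density_measurable [measurable]: "radial_density n \<in> borel_measurable borel"
  unfolding radial_density_def by measurable

lemma radial_density_nonneg: "radial_density n r \<ge> 0"
  by (simp add: radial_density_def)

text \<open>Polar coordinates without a measure on the sphere. The half-lines \<open>{..r}\<close>
  form an intersection-stable generator, and on them the two measures are the volume of a ball and
  the integral of its derivative.\<close>

lemma distr_norm_lborel:
  assumes "CARD('n::finite) \<ge> 1"
  shows "distr lborel borel (norm :: real ^ 'n \<Rightarrow> real) = density lborel (\<lambda>r. ennreal (radial_density CARD('n) r))"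
    (is "?M = ?N")
proof (rule measure_eqI_generator_eq[where E="range (atMost :: real \<Rightarrow> real set)" and \<Omega>=UNIV and A="\<lambda>i. {..real i}"])
  let ?n = "CARD('n)"
  have N: "emeasure ?M X = emeasure ?N X" "emeasure ?M X \<noteq> \<infinity>" if X: "X = {..r}" for X and r :: real
  proof -
    have "emeasure ?M X = emeasure lborel (norm -` {..r} \<inter> space (lborel :: (real ^ 'n) measure))"
      unfolding X by (rule emeasure_distr) auto
    also have "norm -` {..r} \<inter> space (lborel :: (real ^ 'n) measure) = cball 0 r"
      by (auto simp: cball_def)
    finally have *: "emeasure ?M X = emeasure lborel (cball (0::real^'n) r)" .
    have **: "emeasure ?N X = (\<integral>\<^sup>+ x. ennreal (radial_density ?n x) * indicator {..r} x \<partial>lborel)"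
      unfolding X by (subst emeasure_density) auto
    have "emeasure ?M X = emeasure ?N X \<and> emeasure ?M X \<noteq> \<infinity>"
    proof (cases "r < 0")
      case True
      have "emeasure ?N X = (\<integral>\<^sup>+ x. 0 \<partial>(lborel :: real measure))"
        unfolding ** by (rule nn_integral_cong) (use True in \<open>auto simp: radial_density_def indicator_def\<close>)
      then show ?thesis using True by (simp add: *)
    next
      case False
      let ?c = "unit_ball_vol (real ?n)"
      have "emeasure ?N X = (\<integral>\<^sup>+ x. ennreal (?c * real ?n * x ^ (?n - 1)) * indicator {0..r} x \<partial>lborel)"
        unfolding ** by (rule nn_integral_cong) (auto simp: radial_density_def indicator_def)
      also have "\<dots> = ennreal (?c * r ^ ?n - ?c * 0 ^ ?n)"
        by (rule nn_integral_FTC_Icc[where F="\<lambda>x. ?c * x ^ ?n"])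
          (use False in \<open>auto intro!: derivative_eq_intros\<close>)
      also have "\<dots> = emeasure ?M X"
        using False by (simp add: * emeasure_cball)
      finally show ?thesis using False by (simp add: * emeasure_cball)
    qed
    then show "emeasure ?M X = emeasure ?N X" "emeasure ?M X \<noteq> \<infinity>" by auto
  qed
  show "emeasure ?M X = emeasure ?N X" if "X \<in> range atMost" for X using that N by auto
  show "emeasure ?M {..real i} \<noteq> \<infinity>" for i using N by blast
  show "Int_stable (range (atMost :: real \<Rightarrow> real set))"
    by (auto simp: Int_stable_def)
  show "sets ?M = sigma_sets UNIV (range atMost)" "sets ?N = sigma_sets UNIV (range atMost)"
    by (auto simp: borel_eq_atMost)
  show "(\<Union>i. {..real i}) = UNIV" using real_arch_simple by auto
qed auto

lemma integral_radial:
  fixes f :: "real \<Rightarrow> real"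
  assumes "f \<in> borel_measurable borel" "CARD('n::finite) \<ge> 1"
  shows "(\<integral>x. f (norm x) \<partial>(lborel :: (real ^ 'n) measure)) = (\<integral>r. radial_density CARD('n) r * f r \<partial>lborel)"
proof -
  have "(\<integral>x. f (norm x) \<partial>(lborel :: (real ^ 'n) measure)) =
      integral\<^sup>L (distr lborel borel (norm :: real ^ 'n \<Rightarrow> real)) f"
    using assms(1) by (subst integral_distr) auto
  also have "\<dots> = (\<integral>r. radial_density CARD('n) r *\<^sub>R f r \<partial>lborel)"
    unfolding distr_norm_lborel[OF assms(2)]
    by (rule integral_density) (use assms(1) radial_density_nonneg in auto)
  finally show ?thesis by simp
qed

section \<open>The equation and semi-stability in one dimension\<close>

lemma radial_solution_profile:
  fixes u :: "real \<Rightarrow> real"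
  assumes n: "CARD('n::finite) \<ge> 2" and k: "k \<in> {1..CARD('n)}"
    and sol: "radial_solution k w g (radial u :: real ^ 'n \<Rightarrow> real)" and r: "r > 0"
  shows "deriv u r \<ge> 0"
    and "((\<lambda>r. r ^ (CARD('n) - k) * deriv u r ^ k) has_real_derivative
      r ^ (CARD('n) - 1) * w r * g (u r) / c_nk CARD('n) k) (at r)"
proof -
  let ?n = "CARD('n)"
  let ?u = "radial u :: real ^ 'n \<Rightarrow> real"
  fix i0 :: 'n
  have adm: "C2 ?u" and S: "\<And>l x. l \<in> {1..k} \<Longrightarrow> S_hess l (hessian ?u x) \<ge> 0"
    and eq: "\<And>x. x \<noteq> 0 \<Longrightarrow> S_hess k (hessian ?u x) = w (norm x) * g (?u x)"
    using sol by (auto simp: radial_solution_def k_admissible_def)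
  note u = radial_C2_profile[OF adm]
  have H: "S_hess l (hessian ?u (r *\<^sub>R axis i0 1)) =
      real (?n - 1 choose (l - 1)) * deriv (deriv u) r * (deriv u r / r) ^ (l - 1)
      + real (?n - 1 choose l) * (deriv u r / r) ^ l" if "r > 0" "l \<ge> 1" for r l
    by (rule S_hess_radial_axis[OF u(1) u(2)]) (use that in auto)
  \<comment> \<open>The case \<open>l = 1\<close> of admissibility says that the Laplacian is
    nonnegative. So \<open>r ^ (n - 1) * deriv u r\<close> is nondecreasing, and it starts from the
    limit 0 at the origin.\<close>
  show "deriv u r \<ge> 0"
  proof -
    let ?f = "\<lambda>s. s ^ (?n - 1) * deriv u s"
    have f': "(?f has_real_derivative s ^ (?n - 1) * deriv (deriv u) s + real (?n - 1) * s ^ (?n - 1 - 1) * deriv u s) (at s)"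
      if "s > 0" for s
      using u(2)[OF that] by (auto intro!: derivative_eq_intros)
    have f'0: "s ^ (?n - 1) * deriv (deriv u) s + real (?n - 1) * s ^ (?n - 1 - 1) * deriv u s \<ge> 0"
      if s: "s > 0" for s
    proof -
      have "deriv (deriv u) s + real (?n - 1) * (deriv u s / s) \<ge> 0"
        using S[of 1 "s *\<^sub>R axis i0 1"] k H[OF s, of 1] by simp
      then have "0 \<le> s ^ (?n - 1) * (deriv (deriv u) s + real (?n - 1) * (deriv u s / s))"
        using s by simp
      also have "\<dots> = s ^ (?n - 1) * deriv (deriv u) s + real (?n - 1) * (s ^ (?n - 1) / s) * deriv u s"
        by (simp add: algebra_simps)
      also have "s ^ (?n - 1) / s = s ^ (?n - 1 - 1)"
        using s n by (cases "?n - 1") auto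
      finally show ?thesis .
    qed
    obtain C where C: "\<forall>\<^sub>F r in at_right 0. \<bar>deriv u r\<bar> \<le> C * r" using u(4) by blast
    have lim: "(?f \<longlongrightarrow> 0) (at_right 0)"
    proof (rule Lim_null_comparison)
      show "\<forall>\<^sub>F s in at_right 0. norm (?f s) \<le> s ^ (?n - 1) * (C * s)"
        using C eventually_at_right_less[of "0::real"]
        by eventually_elim (auto simp: abs_mult intro!: mult_left_mono)
      have "((\<lambda>s. s ^ (?n - 1) * (C * s)) \<longlongrightarrow> 0 ^ (?n - 1) * (C * 0)) (at_right (0::real))"
        by (intro tendsto_intros)
      then show "((\<lambda>s. s ^ (?n - 1) * (C * s)) \<longlongrightarrow> 0) (at_right (0::real))" by simp
    qed
    have "?f s \<le> ?f r" if "s > 0" "s < r" for s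
    proof (rule DERIV_nonneg_imp_nondecreasing[where f="?f"])
      show "s \<le> r" using that by simp
      fix x assume "s \<le> x" "x \<le> r"
      then have "x > 0" using that by simp
      then show "\<exists>y. (?f has_real_derivative y) (at x) \<and> 0 \<le> y" using f' f'0 by blast
    qed
    then have "\<forall>\<^sub>F s in at_right 0. ?f s \<le> ?f r"
      using r by (auto simp: eventually_at_right_field)
    then have "0 \<le> ?f r"
      using tendsto_upperbound[OF lim] by (simp add: trivial_limit_at_right_real)
    then show ?thesis using zero_less_power[OF r, of "?n - 1"] by (auto simp: zero_le_mult_iff)
  qed
  let ?c = "c_nk ?n k"
  have c: "?c > 0" using k by (auto simp: c_nk_def)
  have "real k * ?c * deriv (deriv u) r * (deriv u r / r) ^ (k - 1) + real (?n - k) * ?c * (deriv u r / r) ^ k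
      = w r * g (u r)"
    using eq[of "r *\<^sub>R axis i0 1"] H[OF r, of k] k r n
    by (simp add: axis_eq_0_iff k_times_c_nk nk_times_c_nk del: of_nat_diff)
  then have "w r * g (u r) = ?c * (real k * deriv (deriv u) r * (deriv u r / r) ^ (k - 1)
      + real (?n - k) * (deriv u r / r) ^ k)"
    by (simp only: distrib_left mult.assoc mult.left_commute)
  then have "w r * g (u r) / ?c = real k * deriv (deriv u) r * (deriv u r / r) ^ (k - 1)
      + real (?n - k) * (deriv u r / r) ^ k"
    using c by simp
  then have "r ^ (?n - 1) * w r * g (u r) / ?c = r ^ (?n - 1) * (real k * deriv (deriv u) r * (deriv u r / r) ^ (k - 1))
      + r ^ (?n - 1) * (real (?n - k) * (deriv u r / r) ^ k)"
    by (simp only: distrib_left times_divide_eq_right[symmetric] mult.assoc)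
  also have "r ^ (?n - 1) * (real k * deriv (deriv u) r * (deriv u r / r) ^ (k - 1))
      = r ^ (?n - k) * (real k * deriv u r ^ (k - 1) * deriv (deriv u) r)"
  proof -
    have "r ^ (?n - 1) = r ^ (?n - k) * r ^ (k - 1)" using k by (simp flip: power_add)
    then show ?thesis using r by (simp add: power_divide)
  qed
  also have "r ^ (?n - 1) * (real (?n - k) * (deriv u r / r) ^ k)
      = real (?n - k) * r ^ (?n - k - 1) * deriv u r ^ k"
  \<comment> \<open>For \<open>k = ?n\<close> the truncated exponent \<open>?n - k - 1\<close> does
    no harm, since its coefficient \<open>real (?n - k)\<close> is 0.\<close>
  proof (cases "k = ?n")
    case False
    then have "r ^ (?n - 1) = r ^ (?n - k - 1) * r ^ k" using k by (simp flip: power_add)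
    then show ?thesis using r by (simp add: power_divide)
  qed simp
  finally have *: "r ^ (?n - 1) * w r * g (u r) / ?c =
    r ^ (?n - k) * (real k * deriv u r ^ (k - 1) * deriv (deriv u) r)
    + real (?n - k) * r ^ (?n - k - 1) * deriv u r ^ k" .
  show "((\<lambda>r. r ^ (?n - k) * deriv u r ^ k) has_real_derivative
      r ^ (?n - 1) * w r * g (u r) / ?c) (at r)"
    unfolding * using u(2)[OF r] r by (auto intro!: derivative_eq_intros)
qed

text \<open>The support lies in an annulus, so the test function is \<open>C^1\<close> across the
  origin and the integrand is continuous on \<open>{a..b}\<close> even if \<open>w\<close> is
  singular at 0.\<close>

lemma semi_stable_radial_test:
  fixes u :: "real \<Rightarrow> real"
  assumes n: "CARD('n::finite) \<ge> 2" and k: "k \<in> {1..CARD('n)}"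
    and stable: "semi_stable k w g (radial u :: real ^ 'n \<Rightarrow> real)"
    and u: "\<And>r. r > 0 \<Longrightarrow> (u has_real_derivative deriv u r) (at r)"
    and du: "continuous_on {0<..} (deriv u)" "\<And>r. r > 0 \<Longrightarrow> deriv u r \<ge> 0"
    and w: "continuous_on {0<..} w" and g: "continuous_on UNIV (deriv g)"
    and \<phi>: "\<And>r. r > 0 \<Longrightarrow> (\<phi> has_real_derivative \<phi>' r) (at r)" "continuous_on {0<..} \<phi>'"
    and ab: "0 < a" "a < b" and supp: "\<And>r. r \<notin> {a..b} \<Longrightarrow> \<phi> r = 0"
  shows "integral {a..b} (\<lambda>r. real k * r ^ (CARD('n) - k) * deriv u r ^ (k - 1) * (\<phi>' r)\<^sup>2
    + r ^ (CARD('n) - 1) * w r * deriv g (u r) / c_nk CARD('n) k * (\<phi> r)\<^sup>2) \<ge> 0"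
    (is "integral _ ?I \<ge> 0")
proof -
  let ?n = "CARD('n)"
  let ?c = "c_nk ?n k"
  have c: "?c > 0" using k by (auto simp: c_nk_def)
  have supp': "\<phi>' r = 0" if r: "r \<notin> {a..b}" and r0: "r > 0" for r
  proof -
    have "((\<lambda>_. 0) has_real_derivative 0) (at r)" by simp
    then have "(\<phi> has_real_derivative 0) (at r)"
      by (rule has_field_derivative_transform_within_open[where S="- {a..b}"]) (use r supp in auto)
    then show ?thesis using \<phi>(1)[OF r0] DERIV_unique by blast
  qed
  \<comment> \<open>Replacing \<open>norm x\<close> by \<open>max (a / 2) (norm x)\<close> changes
    nothing, because \<phi>' vanishes below \<open>a\<close>. It yields a single formula for the
    gradient that is continuous also at the origin.\<close>
  have grad_\<phi>: "(radial \<phi> has_derivative (\<lambda>y. (\<phi>' (max (a / 2) (norm x)) / max (a / 2) (norm x)) * (x \<bullet> y))) (at x)" for x :: "real ^ 'n"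
  proof (cases "x = 0")
    case True
    have "((\<lambda>_. 0) has_derivative (\<lambda>_. 0)) (at x)" by simp
    then have "(radial \<phi> has_derivative (\<lambda>_. 0)) (at x)"
      by (rule has_derivative_transform_within_open[OF _ open_ball[of 0 a]])
        (use ab True supp in \<open>auto simp: radial_def\<close>)
    then show ?thesis using True by simp
  next
    case False
    then have nx: "norm x > 0" by simp
    have "\<phi>' (norm x) / norm x = \<phi>' (max (a / 2) (norm x)) / max (a / 2) (norm x)"
      using supp'[of "norm x"] supp'[of "a / 2"] nx ab by (cases "norm x < a / 2") (auto simp: max_def)
    then show ?thesis
      using has_derivative_radial[OF \<phi>(1)[OF nx] False] by (simp flip: times_divide_eq_left)
  qed
  have gradient_\<phi>: "gradient (radial \<phi>) x = (\<phi>' (max (a / 2) (norm x)) / max (a / 2) (norm x)) *\<^sub>R x" for x :: "real ^ 'n"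
    unfolding gradient_has_derivative[OF grad_\<phi>] by (simp add: vec_eq_iff inner_axis)
  have C1: "C1_on UNIV (radial \<phi> :: real ^ 'n \<Rightarrow> real)"
    unfolding C1_on_def
  proof (intro conjI ballI)
    show "radial \<phi> differentiable (at x)" for x :: "real ^ 'n"
      using grad_\<phi> by (auto simp: differentiable_def)
    have "continuous_on UNIV (\<lambda>x :: real ^ 'n. (\<phi>' (max (a / 2) (norm x)) / max (a / 2) (norm x)) *\<^sub>R x)"
      using ab by (intro continuous_intros continuous_on_compose2[OF \<phi>(2)]) (auto simp: max_def)
    moreover have "gradient (radial \<phi>) = (\<lambda>x :: real ^ 'n. (\<phi>' (max (a / 2) (norm x)) / max (a / 2) (norm x)) *\<^sub>R x)"
      using gradient_\<phi> by blast
    ultimately show "continuous_on UNIV (gradient (radial \<phi> :: real ^ 'n \<Rightarrow> real))" by simp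
  qed
  have "{x :: real ^ 'n. radial \<phi> x \<noteq> 0} \<subseteq> cball 0 b"
    using supp by (force simp: radial_def)
  then have cpt: "compact (closure {x :: real ^ 'n. radial \<phi> x \<noteq> 0})"
    by (meson bounded_cball bounded_subset compact_closure)
  define h where "h r = real k * ?c * r powi (1 - int k) * deriv u r ^ (k - 1) * (\<phi>' r)\<^sup>2
    + w r * deriv g (u r) * (\<phi> r)\<^sup>2" for r
  \<comment> \<open>The cut-off makes the profile Borel on the whole line, although nothing is known
    about \<open>w\<close> at and to the left of 0.\<close>
  define q where "q r = indicator {a..b} r * h r" for r
  have ab0: "{a..b} \<subseteq> {0<..}" using ab by auto
  have conts: "continuous_on {a..b} (deriv u)" "continuous_on {a..b} w" "continuous_on {a..b} u"
    "continuous_on {a..b} \<phi>'" "continuous_on {a..b} \<phi>"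
    using continuous_on_subset[OF du(1) ab0] continuous_on_subset[OF w ab0]
      continuous_on_subset[OF \<phi>(2) ab0] u ab0 \<phi>(1)
    by (auto intro!: continuous_at_imp_continuous_on DERIV_isCont)
  have contg: "continuous_on {a..b} (\<lambda>r. deriv g (u r))"
    by (rule continuous_on_compose2[OF g conts(3)]) simp
  have cont_h: "continuous_on {a..b} h"
    unfolding h_def using ab by (intro continuous_intros conts contg) auto
  have q_meas: "q \<in> borel_measurable borel"
  proof -
    have "(\<lambda>r. indicator {a..b} r *\<^sub>R h r) \<in> borel_measurable borel"
      by (rule borel_measurable_continuous_on_indicator) (use cont_h in auto)
    then show ?thesis by (simp add: q_def[abs_def])
  qed
  have Q: "Q_integrand k w g (radial u) (radial \<phi>) x = q (norm x)" for x :: "real ^ 'n"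
  proof (cases "norm x \<in> {a..b}")
    case True
    then have x: "x \<noteq> 0" "norm x > 0" "max (a / 2) (norm x) = norm x" using ab by auto
    have "norm (gradient (radial u) x) = deriv u (norm x)"
      using x du(2)[of "norm x"] by (simp add: gradient_radial[OF u])
    moreover have "(norm (gradient (radial \<phi>) x))\<^sup>2 = (\<phi>' (norm x))\<^sup>2"
      using x unfolding gradient_\<phi> by (simp add: power_mult_distrib)
    ultimately show ?thesis
      using True by (simp add: Q_integrand_def q_def h_def radial_def)
  next
    case False
    then show ?thesis
      using supp supp'[of "max (a / 2) (norm x)"] ab
      by (auto simp: Q_integrand_def q_def radial_def gradient_\<phi>[unfolded radial_def] max_def)
  qed
  \<comment> \<open>The area of the unit sphere times \<open>c_nk\<close>; dividing by it leaves the
    one-dimensional form.\<close>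
  let ?C = "unit_ball_vol (real ?n) * real ?n * ?c"
  have "0 \<le> integral\<^sup>L lborel (Q_integrand k w g (radial u) (radial \<phi>) :: real ^ 'n \<Rightarrow> real)"
    using stable C1 cpt unfolding semi_stable_def by blast
  also have "\<dots> = (\<integral>x. q (norm x) \<partial>(lborel :: (real ^ 'n) measure))"
    by (simp add: Q[abs_def])
  also have "\<dots> = (\<integral>r. radial_density ?n r * q r \<partial>lborel)"
    using q_meas n by (intro integral_radial) auto
  also have "\<dots> = (\<integral>r. ?C * (indicator {a..b} r *\<^sub>R ?I r) \<partial>lborel)"
  proof (rule Bochner_Integration.integral_cong[OF refl])
    fix r
    show "radial_density ?n r * q r = ?C * (indicator {a..b} r *\<^sub>R ?I r)"
    proof (cases "r \<in> {a..b}")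
      case True
      then have r: "r > 0" using ab by auto
      have "r powi (int (?n - 1) + (1 - int k)) = r powi int (?n - 1) * r powi (1 - int k)"
        by (rule power_int_add) (use r in simp)
      then have "r ^ (?n - 1) * r powi (1 - int k) = r powi (int (?n - 1) + (1 - int k))"
        unfolding power_int_of_nat by (rule sym)
      also have "int (?n - 1) + (1 - int k) = int (?n - k)" using k by auto
      finally have p: "r ^ (?n - 1) * r powi (1 - int k) = r ^ (?n - k)" by simp
      have "r ^ (?n - 1) * h r = real k * ?c * (r ^ (?n - 1) * r powi (1 - int k)) * deriv u r ^ (k - 1) * (\<phi>' r)\<^sup>2
          + r ^ (?n - 1) * (w r * deriv g (u r) * (\<phi> r)\<^sup>2)"
        by (simp add: h_def algebra_simps)
      also have "\<dots> = ?c * ?I r" unfolding p using c by (simp add: field_simps)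
      finally show ?thesis using True r by (simp add: radial_density_def q_def)
    qed (simp add: q_def)
  qed
  also have "\<dots> = ?C * (\<integral>r. indicator {a..b} r *\<^sub>R ?I r \<partial>lborel)"
    by (rule integral_mult_right_zero)
  also have "(\<integral>r. indicator {a..b} r *\<^sub>R ?I r \<partial>lborel) = integral {a..b} ?I"
  proof -
    have "continuous_on {a..b} ?I"
      using c by (intro continuous_intros conts contg) auto
    then have "set_integrable lborel {a..b} ?I" by (rule borel_integrable_atLeastAtMost')
    from set_borel_integral_eq_integral(2)[OF this] show ?thesis
      by (simp add: set_lebesgue_integral_def)
  qed
  finally have "0 \<le> ?C * integral {a..b} ?I" .
  moreover have "?C > 0" using c n by simp
  ultimately show ?thesis by (simp add: zero_le_mult_iff)
qed

section \<open>Lipschitz test functions on the half-line\<close>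

text \<open>At its breakpoints a piecewise test function has only one-sided derivatives. Difference
  quotients to the right of a point are eventually below any number larger than \<open>K\<close>,
  which is why the constant is \<open>K + 1\<close>.\<close>

lemma right_derivative_imp_lipschitz:
  fixes f f' :: "real \<Rightarrow> real"
  assumes cont: "continuous_on UNIV f"
    and right: "\<And>t. (f has_real_derivative f' t) (at t within {t<..})"
    and bound: "\<And>t. \<bar>f' t\<bar> \<le> K"
  shows "\<bar>f x - f y\<bar> \<le> (K + 1) * \<bar>x - y\<bar>"
proof -
  have lip: "(K + 1)-lipschitz_on {p..q} f" for p q
  proof (rule locally_lipschitz_imp_lipschitz)
    show "continuous_on {p..q} f" using cont continuous_on_subset by blast
    show "K + 1 \<ge> 0" using bound[of 0] by linarith
    fix x y assume xy: "x \<in> {p..<q}" "x < y"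
    have "((\<lambda>z. (f z - f x) / (z - x)) \<longlongrightarrow> f' x) (at x within {x<..})"
      using right[of x] by (simp add: has_field_derivative_iff)
    then have "((\<lambda>z. \<bar>(f z - f x) / (z - x)\<bar>) \<longlongrightarrow> \<bar>f' x\<bar>) (at_right x)"
      by (rule tendsto_rabs)
    then have "\<forall>\<^sub>F z in at_right x. \<bar>(f z - f x) / (z - x)\<bar> < K + 1"
      using bound[of x] by (intro order_tendstoD) auto
    then obtain b where b: "b > x" "\<And>z. z > x \<Longrightarrow> z < b \<Longrightarrow> \<bar>(f z - f x) / (z - x)\<bar> < K + 1"
      by (auto simp: eventually_at_right_field)
    obtain z where z: "x < z" "z < b" "z < y" using dense[of x "min b y"] b(1) xy by auto
    then have "\<bar>f z - f x\<bar> / (z - x) < K + 1" using b(2)[of z] by simp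
    then have "\<bar>f z - f x\<bar> \<le> (K + 1) * (z - x)" using z by (simp add: pos_divide_less_eq)
    then show "\<exists>z\<in>{x<..y}. dist (f z) (f x) \<le> (K + 1) * (z - x)"
      using z by (intro bexI[of _ z]) (auto simp: dist_real_def)
  qed
  show ?thesis
    using lipschitz_onD[OF lip[of "min x y" "max x y"], of x y] by (simp add: dist_real_def)
qed

text \<open>Steklov averages \<open>\<integral>\<^bsub>[t, t + h]\<^esub> \<eta> / h\<close> of a Lipschitz function are \<open>C\<^sup>1\<close>, and their
  derivatives are forward difference quotients, which converge to the right derivative.\<close>

lemma steklov_approximation:
  fixes \<eta> \<eta>' :: "real \<Rightarrow> real"
  assumes ab: "0 < a" "a < b" and supp: "\<And>r. r \<notin> {a..b} \<Longrightarrow> \<eta> r = 0"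
    and lip: "\<And>x y. \<bar>\<eta> x - \<eta> y\<bar> \<le> K * \<bar>x - y\<bar>"
    and right: "\<And>t. (\<eta> has_real_derivative \<eta>' t) (at t within {t<..})"
  obtains S S' :: "nat \<Rightarrow> real \<Rightarrow> real" and B where
    "\<And>j r. r > 0 \<Longrightarrow> (S j has_real_derivative S' j r) (at r)"
    "\<And>j. continuous_on UNIV (S' j)"
    "\<And>j r. r \<notin> {a / 2..b} \<Longrightarrow> S j r = 0"
    "\<And>j r. r > 0 \<Longrightarrow> \<bar>S j r\<bar> \<le> B"
    "\<And>j r. \<bar>S' j r\<bar> \<le> K"
    "\<And>r. r > 0 \<Longrightarrow> (\<lambda>j. S j r) \<longlonglongrightarrow> \<eta> r"
    "\<And>r. (\<lambda>j. S' j r) \<longlonglongrightarrow> \<eta>' r"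
proof -
  define H where "H r = integral {0..r} \<eta>" for r
  \<comment> \<open>The averaging length is at most \<open>a / 2\<close>, so for
    \<open>r < a / 2\<close> the average only sees points below \<open>a\<close>, and the supports
    stay away from the origin.\<close>
  define h where "h j = a / 2 * inverse (real (Suc j))" for j
  define S where "S j r = (H (r + h j) - H r) / h j" for j r
  define S' where "S' j r = (\<eta> (r + h j) - \<eta> r) / h j" for j r
  have K: "K \<ge> 0" using lip[of 0 1] by simp
  have "K-lipschitz_on UNIV \<eta>" by (rule lipschitz_onI) (use lip K in \<open>auto simp: dist_real_def\<close>)
  then have cont: "continuous_on UNIV \<eta>" by (rule lipschitz_on_continuous_on)
  have h: "h j > 0" "h j \<le> a / 2" for j
    using ab by (auto simp: h_def field_simps)
  have h0: "h \<longlonglongrightarrow> 0" unfolding h_def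
    using tendsto_mult_right_zero[OF LIMSEQ_inverse_real_of_nat] .
  have H: "(H has_real_derivative \<eta> r) (at r)" if "r > 0" for r
  proof -
    have "(H has_real_derivative \<eta> r) (at r within {0..r + 1})"
      unfolding H_def using that
      by (intro integral_has_real_derivative continuous_on_subset[OF cont]) auto
    then show ?thesis using that by (simp add: at_within_Icc_at)
  qed
  have H0: "H r = 0" if "r \<le> a" for r
  proof -
    have "integral {0..r} \<eta> = integral {0..r} (\<lambda>_. 0)"
      by (rule integral_spike[of "{a}"]) (use that supp in auto)
    then show ?thesis by (simp add: H_def)
  qed
  \<comment> \<open>An average is a value of \<eta> at an intermediate point. This gives the uniform
    bound and the vanishing to the right of \<open>b\<close>.\<close>
  have mvt: "\<exists>z>0. r < z \<and> z < r + h j \<and> S j r = \<eta> z" if "r > 0" for r j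
  proof -
    have "\<exists>z. r < z \<and> z < r + h j \<and> H (r + h j) - H r = (r + h j - r) * \<eta> z"
      by (rule MVT2) (use h that H in auto)
    then obtain z where "r < z" "z < r + h j" "H (r + h j) - H r = h j * \<eta> z" by auto
    then show ?thesis using that h(1)[of j] by (intro exI[of _ z]) (auto simp: S_def)
  qed
  obtain B where B: "\<And>r. \<bar>\<eta> r\<bar> \<le> B"
  proof
    fix r show "\<bar>\<eta> r\<bar> \<le> K * (\<bar>b\<bar> + 1)"
    proof (cases "r \<in> {a..b}")
      case True
      then have "\<bar>\<eta> r - \<eta> 0\<bar> \<le> K * \<bar>r - 0\<bar>" by (intro lip)
      also have "\<dots> \<le> K * (\<bar>b\<bar> + 1)" using True ab K by (intro mult_left_mono) auto
      finally show ?thesis using supp[of 0] ab by simp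
    qed (use supp K in auto)
  qed
  have step: "filterlim (\<lambda>j. r + h j) (at_right r) sequentially" for r
    unfolding filterlim_at
    using h(1) tendsto_add[OF tendsto_const[of r] h0]
    by (auto intro!: always_eventually simp: less_imp_neq[THEN not_sym])
  show ?thesis
  proof
    show "(S j has_real_derivative S' j r) (at r)" if "r > 0" for j r
      unfolding S_def S'_def
    proof (intro derivative_intros DERIV_cdivide)
      have "((\<lambda>r. H (r + h j)) has_real_derivative \<eta> (r + h j) * 1) (at r)"
        by (rule DERIV_chain2[where f=H]) (use h[of j] that H in \<open>auto intro!: derivative_eq_intros\<close>)
      then show "((\<lambda>r. H (r + h j)) has_real_derivative \<eta> (r + h j)) (at r)" by simp
    qed (use that H in auto)
    show "continuous_on UNIV (S' j)" for j
      unfolding S'_def using h(1)[of j]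
      by (intro continuous_intros continuous_on_compose2[OF cont] cont) auto
    show "S j r = 0" if r: "r \<notin> {a / 2..b}" for j r
    proof (cases "r < a / 2")
      case True
      then show ?thesis using h[of j] ab by (simp add: S_def H0)
    next
      case False
      then have "r > b" "r > 0" using r ab by auto
      then show ?thesis using mvt[of r j] supp by (metis atLeastAtMost_iff less_le_not_le order_less_trans)
    qed
    show "\<bar>S j r\<bar> \<le> B" if "r > 0" for j r using mvt[OF that] B by metis
    show "\<bar>S' j r\<bar> \<le> K" for j r
      using lip[of "r + h j" r] h(1)[of j] by (simp add: S'_def pos_divide_le_eq)
    show "(\<lambda>j. S j r) \<longlonglongrightarrow> \<eta> r" if "r > 0" for r
    proof -
      have "((\<lambda>y. (H y - H r) / (y - r)) \<longlongrightarrow> \<eta> r) (at_right r)"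
        using has_field_derivative_at_within[OF H[OF that]] by (simp add: has_field_derivative_iff)
      from filterlim_compose[OF this step] show ?thesis by (simp add: S_def)
    qed
    show "(\<lambda>j. S' j r) \<longlonglongrightarrow> \<eta>' r" for r
    proof -
      have "((\<lambda>y. (\<eta> y - \<eta> r) / (y - r)) \<longlongrightarrow> \<eta>' r) (at_right r)"
        using right[of r] by (simp add: has_field_derivative_iff)
      from filterlim_compose[OF this step] show ?thesis by (simp add: S'_def)
    qed
  qed
qed

text \<open>The agreement includes the left endpoint, so a test function is split into pieces that
  are closed on the left and open on the right.\<close>

lemma has_field_derivative_right_if_eq:
  fixes f \<eta> :: "real \<Rightarrow> real"
  assumes "(f has_real_derivative d) (at t)" "t < p" "\<And>x. t \<le> x \<Longrightarrow> x < p \<Longrightarrow> \<eta> x = f x"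
  shows "(\<eta> has_real_derivative d) (at t within {t<..})"
proof -
  have "(\<eta> has_real_derivative d) (at t within {t..})"
  proof (rule has_field_derivative_transform_within[where d="p - t"])
    show "(f has_real_derivative d) (at t within {t..})"
      using assms(1) by (rule has_field_derivative_at_within)
  qed (use assms in \<open>auto simp: dist_real_def\<close>)
  then show ?thesis by (rule DERIV_subset) auto
qed

section \<open>The semi-stable radial profile\<close>

text \<open>Only one-dimensional consequences of the hypotheses are kept, so the dimension becomes a
  plain number. Here \<open>c\<close> stands for \<open>c_nk n k\<close>, \<open>du_le\<close> and
  \<open>u_0\<close> retain the regularity at the origin, and \<open>stable\<close> has the form
  provided by \<open>semi_stable_radial_test\<close>.\<close>

locale stable_profile =
  fixes n k :: nat and c \<Gamma> \<gamma> B :: real and g w u :: "real \<Rightarrow> real"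
  assumes n2: "n \<ge> 2" and k1: "1 \<le> k" and kn: "k \<le> n" and c_pos: "c > 0"
    and g_DERIV: "\<And>t. (g has_real_derivative deriv g t) (at t)"
    and g'_cont: "continuous_on UNIV (deriv g)"
    and g_nonneg: "\<And>t. g t \<ge> 0" and g_antimono: "antimono g"
    and w_pos: "\<And>r. r > 0 \<Longrightarrow> w r > 0"
    and w_DERIV: "\<And>r. r > 0 \<Longrightarrow> (w has_real_derivative deriv w r) (at r)"
    and W_DERIV: "\<And>r. r > 0 \<Longrightarrow> (W_fun w has_real_derivative deriv (W_fun w) r) (at r)"
    and W'_cont: "continuous_on {0<..} (deriv (W_fun w))"
    and W_antimono: "antimono_on {0<..} (W_fun w)"
    and W_0: "(W_fun w \<longlongrightarrow> \<Gamma>) (at_right 0)"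
    and W_inf: "(W_fun w \<longlongrightarrow> \<gamma>) at_top"
    and u_DERIV: "\<And>r. r > 0 \<Longrightarrow> (u has_real_derivative deriv u r) (at r)"
    and du_DERIV: "\<And>r. r > 0 \<Longrightarrow> (deriv u has_real_derivative deriv (deriv u) r) (at r)"
    and ddu_cont: "continuous_on {0<..} (deriv (deriv u))"
    and du_le: "\<exists>C. \<forall>\<^sub>F r in at_right 0. \<bar>deriv u r\<bar> \<le> C * r"
    and u_0: "(u \<longlongrightarrow> u 0) (at_right 0)"
    and du_nonneg: "\<And>r. r > 0 \<Longrightarrow> deriv u r \<ge> 0"
    and flux_DERIV: "\<And>r. r > 0 \<Longrightarrow> ((\<lambda>r. r ^ (n - k) * deriv u r ^ k) has_real_derivative
      r ^ (n - 1) * w r * g (u r) / c) (at r)"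
    and nonconst: "\<exists>r>0. u r \<noteq> u 0"
    and u_le: "\<And>r. r > 0 \<Longrightarrow> u r \<le> B"
    and stable: "\<And>a b \<phi> \<phi>'. 0 < a \<Longrightarrow> a < b \<Longrightarrow>
      (\<And>r. r > 0 \<Longrightarrow> (\<phi> has_real_derivative \<phi>' r) (at r)) \<Longrightarrow> continuous_on {0<..} \<phi>' \<Longrightarrow>
      (\<And>r. r \<notin> {a..b} \<Longrightarrow> \<phi> r = 0) \<Longrightarrow>
      integral {a..b} (\<lambda>r. real k * r ^ (n - k) * deriv u r ^ (k - 1) * (\<phi>' r)\<^sup>2
        + r ^ (n - 1) * w r * deriv g (u r) / c * (\<phi> r)\<^sup>2) \<ge> 0"
begin

abbreviation "v \<equiv> v_fun k w"
abbreviation "D \<equiv> radicand n k w"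

definition F where "F r = r ^ (n - k) * deriv u r ^ k"
definition dF where "dF r = r ^ (n - 1) * w r * g (u r) / c"
text \<open>In exponential form it is positive at every argument, and its derivative with respect to
  \<open>ln r\<close> is visibly \<open>- v\<close> times \<open>rho\<close>. This is the origin of
  \<open>v\<close>.\<close>

definition rho where "rho r = exp (- ((real k - 1) * ln r + ln (w r)) / (real k + 1))"
definition m where "m r = (rho r)\<^sup>2 * F r * deriv u r"
definition v_inf where "v_inf = (real k - 1 + \<gamma>) / (real k + 1)"
definition v_0 where "v_0 = (real k - 1 + \<Gamma>) / (real k + 1)"

lemma F_DERIV: "r > 0 \<Longrightarrow> (F has_real_derivative dF r) (at r)"
  unfolding F_def[abs_def] dF_def by (rule flux_DERIV)

lemma rho_pos: "rho r > 0" by (simp add: rho_def)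

lemma w'_eq: "r > 0 \<Longrightarrow> deriv w r = w r * W_fun w r / r"
  using w_pos[of r] by (simp add: W_fun_def)

lemma W_eq_v: "W_fun w r = (real k + 1) * v r - (real k - 1)"
proof -
  have "real k + 1 \<noteq> 0" by linarith
  then show ?thesis by (simp add: v_fun_def)
qed

lemma rho_DERIV:
  assumes r: "r > 0"
  shows "(rho has_real_derivative - v r * rho r / r) (at r)"
proof -
  have "((\<lambda>r. - ((real k - 1) * ln r + ln (w r)) / (real k + 1)) has_real_derivative
      - ((real k - 1) * (1 / r) + deriv w r / w r) / (real k + 1)) (at r)"
    using r w_pos[OF r] by (auto intro!: derivative_eq_intros DERIV_cdivide w_DERIV)
  moreover have "- ((real k - 1) * (1 / r) + deriv w r / w r) / (real k + 1) = - v r / r"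
    using w_pos[OF r] r by (simp add: w'_eq[OF r] v_fun_def divide_simps)
  ultimately have "((\<lambda>r. - ((real k - 1) * ln r + ln (w r)) / (real k + 1)) has_real_derivative - v r / r) (at r)"
    by simp
  from DERIV_fun_exp[OF this] show ?thesis by (simp add: rho_def[abs_def] mult.commute)
qed

lemma v_DERIV: "r > 0 \<Longrightarrow> (v has_real_derivative deriv v r) (at r)"
  and v'_eq: "r > 0 \<Longrightarrow> deriv v r = deriv (W_fun w) r / (real k + 1)"
proof -
  have *: "(v has_real_derivative deriv (W_fun w) r / (real k + 1)) (at r)" if "r > 0" for r
  proof -
    have "((\<lambda>r. (real k - 1 + W_fun w r) / (real k + 1)) has_real_derivative deriv (W_fun w) r / (real k + 1)) (at r)"
      using DERIV_cdivide[OF DERIV_add[OF DERIV_const W_DERIV[OF that], of "real k - 1"], of "real k + 1"] by simp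
    then show ?thesis unfolding v_fun_def[abs_def] .
  qed
  then show "r > 0 \<Longrightarrow> deriv v r = deriv (W_fun w) r / (real k + 1)" for r
    by (rule DERIV_imp_deriv)
  with * show "r > 0 \<Longrightarrow> (v has_real_derivative deriv v r) (at r)" for r
    by simp
qed

lemma v'_cont: "continuous_on {0<..} (deriv v)"
proof -
  have "continuous_on {0<..} (\<lambda>r. deriv (W_fun w) r / (real k + 1))"
    by (intro continuous_intros W'_cont) (use k1 in auto)
  then show ?thesis by (rule continuous_on_eq) (simp add: v'_eq)
qed

lemma v_antimono: "0 < r \<Longrightarrow> r \<le> s \<Longrightarrow> v s \<le> v r"
proof -
  assume "0 < r" "r \<le> s"
  then have "W_fun w s \<le> W_fun w r" using W_antimono by (auto simp: monotone_on_def)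
  then show ?thesis by (auto simp: v_fun_def intro!: divide_right_mono)
qed

lemma v'_nonpos: "r > 0 \<Longrightarrow> deriv v r \<le> 0"
proof (rule ccontr)
  assume r: "r > 0" and "\<not> deriv v r \<le> 0"
  then obtain d where d: "d > 0" "\<And>h. 0 < h \<Longrightarrow> h < d \<Longrightarrow> v r < v (r + h)"
    using DERIV_pos_inc_right[OF v_DERIV[OF r]] by auto
  then have "v r < v (r + d / 2)" by simp
  then show False using d(1) v_antimono[of r "r + d / 2"] r by simp
qed

lemma v_tendsto_inf: "(v \<longlongrightarrow> v_inf) at_top"
  unfolding v_fun_def[abs_def] v_inf_def using k1 by (intro tendsto_intros W_inf) auto

lemma v_tendsto_0: "(v \<longlongrightarrow> v_0) (at_right 0)"
  unfolding v_fun_def[abs_def] v_0_def using k1 by (intro tendsto_intros W_0) auto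

lemma v_ge_inf: "r > 0 \<Longrightarrow> v_inf \<le> v r"
proof -
  assume r: "r > 0"
  have "\<forall>\<^sub>F s in at_top. v s \<le> v r"
    using eventually_ge_at_top[of r] by eventually_elim (use r in \<open>auto intro: v_antimono\<close>)
  then show ?thesis using tendsto_upperbound[OF v_tendsto_inf] by simp
qed

lemma W_le_Gamma: "r > 0 \<Longrightarrow> W_fun w r \<le> \<Gamma>"
proof -
  assume r: "r > 0"
  have "\<forall>\<^sub>F s in at_right 0. W_fun w r \<le> W_fun w s"
    unfolding eventually_at_right_field using r W_antimono
    by (intro exI[of _ r]) (auto simp: monotone_on_def)
  then show ?thesis
    using tendsto_lowerbound[OF W_0] by (simp add: trivial_limit_at_right_real)
qed

lemma D_eq: "D r = (v r + 1) * (v r + real n / real k - 1) - r * deriv v r"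
  by (simp add: radicand_def algebra_simps power2_eq_square)

lemma continuous_facts:
  assumes "S \<subseteq> {0<..}"
  shows "continuous_on S u" "continuous_on S (deriv u)" "continuous_on S w" "continuous_on S v"
    "continuous_on S (deriv v)" "continuous_on S rho" "continuous_on S F" "continuous_on S m"
    "continuous_on S D" "continuous_on S (deriv (deriv u))" "continuous_on S (\<lambda>r. g (u r))"
    "continuous_on S (\<lambda>r. deriv g (u r))" "continuous_on S (W_fun w)"
proof -
  have dc: "continuous_on S f" if "\<And>r. r > 0 \<Longrightarrow> (f has_real_derivative f' r) (at r)" for f f'
    using assms that by (auto intro!: continuous_at_imp_continuous_on intro: DERIV_isCont)
  show 1: "continuous_on S u" "continuous_on S (deriv u)" "continuous_on S w" "continuous_on S v"
    "continuous_on S rho" "continuous_on S F" "continuous_on S (W_fun w)"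
    using dc[OF u_DERIV] dc[OF du_DERIV] dc[OF w_DERIV] dc[OF v_DERIV] dc[OF rho_DERIV]
      dc[OF F_DERIV] dc[OF W_DERIV] by blast+
  show 2: "continuous_on S (deriv v)" using v'_cont assms continuous_on_subset by blast
  show "continuous_on S (deriv (deriv u))" using ddu_cont assms continuous_on_subset by blast
  show "continuous_on S m" unfolding m_def[abs_def] by (intro continuous_intros 1)
  show "continuous_on S D" unfolding radicand_def[abs_def] by (intro continuous_intros 1 2)
  have "continuous_on UNIV g"
    using g_DERIV by (auto intro!: continuous_at_imp_continuous_on DERIV_isCont)
  then show "continuous_on S (\<lambda>r. g (u r))" by (rule continuous_on_compose2) (use 1 in auto)
  show "continuous_on S (\<lambda>r. deriv g (u r))"
    by (rule continuous_on_compose2[OF g'_cont]) (use 1 in auto)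
qed

section \<open>Jacobi substitution and the energy inequality\<close>

text \<open>The choice of \<open>rho\<close> cancels the terms containing \<open>dF\<close> in the linearised operator applied
  to \<open>rho * deriv u\<close>; the remaining potential is the radicand.\<close>

definition G where
  "G r = rho r * (dF r - real (n - k) * F r / r - real k * F r * v r / r)"

lemma dF_DERIV:
  assumes "r > 0"
  shows "(dF has_real_derivative dF r * (real n - 1 + W_fun w r) / r
    + r ^ (n - 1) * w r * (deriv g (u r) * deriv u r) / c) (at r)"
proof -
  have p: "real (n - 1) * r ^ (n - 1 - 1) = (real n - 1) * r ^ (n - 1) / r"
    using n2 assms by (cases "n - 1") (auto simp: of_nat_diff)
  have "((\<lambda>r. g (u r)) has_real_derivative deriv g (u r) * deriv u r) (at r)"
    by (rule DERIV_chain2[OF g_DERIV u_DERIV[OF assms]])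
  then have "(dF has_real_derivative ((real (n - 1) * r ^ (n - 1 - 1) * w r + r ^ (n - 1) * deriv w r) * g (u r)
      + r ^ (n - 1) * w r * (deriv g (u r) * deriv u r)) / c) (at r)"
    unfolding dF_def[abs_def] using w_DERIV[OF assms]
    by (intro DERIV_cdivide) (auto intro!: derivative_eq_intros simp: algebra_simps)
  moreover have "((real (n - 1) * r ^ (n - 1 - 1) * w r + r ^ (n - 1) * deriv w r) * g (u r)
      + r ^ (n - 1) * w r * (deriv g (u r) * deriv u r)) / c =
      dF r * (real n - 1 + W_fun w r) / r + r ^ (n - 1) * w r * (deriv g (u r) * deriv u r) / c"
    unfolding p w'_eq[OF assms] dF_def using c_pos assms by (simp add: field_simps)
  ultimately show ?thesis by simp
qed

lemma G_DERIV:
  assumes r: "r > 0"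
  shows "(G has_real_derivative rho r * (r ^ (n - 1) * w r * (deriv g (u r) * deriv u r) / c)
    + real k * rho r * F r * D r / r\<^sup>2) (at r)"
proof -
  define Z where "Z = r ^ (n - 1) * w r * (deriv g (u r) * deriv u r) / c"
  define i where "i = 1 / r"
  define P where "P r = F r / r" for r
  let ?P' = "dF r * i - F r * i\<^sup>2"
  let ?k = "real k" and ?b = "real (n - k)"
  have P: "(P has_real_derivative ?P') (at r)"
    unfolding P_def[abs_def] i_def using r F_DERIV[OF r]
    by (auto intro!: derivative_eq_intros simp: field_simps power2_eq_square)
  have dF: "(dF has_real_derivative dF r * (real n - 1 + W_fun w r) * i + Z) (at r)"
    using dF_DERIV[OF r] by (simp add: Z_def i_def)
  have G: "G = (\<lambda>r. rho r * (dF r - ?b * P r - ?k * (P r * v r)))"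
    by (rule ext) (simp add: G_def P_def)
  have rho: "(rho has_real_derivative - v r * rho r * i) (at r)"
    using rho_DERIV[OF r] by (simp add: i_def)
  have "(G has_real_derivative - v r * rho r * i * (dF r - ?b * P r - ?k * (P r * v r))
     + (dF r * (real n - 1 + W_fun w r) * i + Z - ?b * ?P' - ?k * (?P' * v r + deriv v r * P r)) * rho r) (at r)"
    unfolding G
    by (intro DERIV_mult DERIV_diff DERIV_cmult rho dF P v_DERIV r)
  moreover have "- v r * rho r * i * (dF r - ?b * P r - ?k * (P r * v r))
     + (dF r * (real n - 1 + W_fun w r) * i + Z - ?b * ?P' - ?k * (?P' * v r + deriv v r * P r)) * rho r
     = rho r * Z + ?k * rho r * F r * D r / r\<^sup>2"
  proof -
    have k: "?k > 0" and b: "?b = real n - ?k" using k1 kn by (auto simp: of_nat_diff)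
    have "?k * D r = ?k * (v r)\<^sup>2 + real n * v r + real n - ?k - ?k * r * deriv v r"
      using k by (simp add: radicand_def field_simps)
    then have "?k * rho r * F r * D r / r\<^sup>2 =
        rho r * F r * (?k * (v r)\<^sup>2 + real n * v r + real n - ?k - ?k * r * deriv v r) * i\<^sup>2"
      by (simp add: i_def power_divide)
    also have "\<dots> = rho r * F r * ((?k * (v r)\<^sup>2 + real n * v r + real n - ?k) * i\<^sup>2 - ?k * deriv v r * i)"
      using r by (simp add: i_def power2_eq_square field_simps)
    finally have D: "?k * rho r * F r * D r / r\<^sup>2 = \<dots>" .
    have P: "P r = F r * i" by (simp add: P_def i_def)
    \<comment> \<open>The cancellation itself: the coefficient of \<open>R * d * i\<close> is
      \<open>- V + (N - 1) + (K + 1) V - (K - 1) - (N - K) - K V = 0\<close>.\<close>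
    have alg: "- V * R * i * (d - (N - K) * (f * i) - K * (f * i * V))
      + (d * (N - 1 + ((K + 1) * V - (K - 1))) * i + Z - (N - K) * (d * i - f * i\<^sup>2)
          - K * ((d * i - f * i\<^sup>2) * V + V' * (f * i))) * R
      = R * Z + R * f * ((K * V\<^sup>2 + N * V + N - K) * i\<^sup>2 - K * V' * i)" for V R d N K f Z V' :: real
      by (simp add: algebra_simps power2_eq_square)
    show ?thesis unfolding D P W_eq_v b by (rule alg)
  qed
  ultimately show ?thesis by (simp add: Z_def)
qed

text \<open>\<open>G\<close> is the flux \<open>p \<psi>'\<close> of
  \<open>\<psi> = rho * deriv u\<close> in the stability form. Its definition through
  \<open>dF\<close> and \<open>F\<close> is what makes it differentiable, since
  \<open>deriv (deriv u)\<close> is merely continuous.\<close>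

lemma G_eq:
  assumes r: "r > 0"
  shows "G r = real k * r ^ (n - k) * deriv u r ^ (k - 1) *
    (- v r * rho r / r * deriv u r + rho r * deriv (deriv u) r)"
proof -
  have "(F has_real_derivative real (n - k) * r ^ (n - k - 1) * deriv u r ^ k
      + r ^ (n - k) * (real k * deriv u r ^ (k - 1) * deriv (deriv u) r)) (at r)"
    unfolding F_def[abs_def] using du_DERIV[OF r]
    by (auto intro!: derivative_eq_intros simp: algebra_simps)
  from DERIV_unique[OF F_DERIV[OF r] this]
  have "dF r = real (n - k) * r ^ (n - k - 1) * deriv u r ^ k
      + r ^ (n - k) * (real k * deriv u r ^ (k - 1) * deriv (deriv u) r)" .
  also have "real (n - k) * r ^ (n - k - 1) * deriv u r ^ k = real (n - k) * F r / r"
    using r by (cases "n - k") (auto simp: F_def)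
  finally have dF: "dF r - real (n - k) * F r / r =
    r ^ (n - k) * (real k * deriv u r ^ (k - 1) * deriv (deriv u) r)" by simp
  have F: "F r = r ^ (n - k) * (deriv u r ^ (k - 1) * deriv u r)"
    using k1 by (simp add: F_def flip: power_Suc2)
  show ?thesis unfolding G_def dF unfolding F by (simp add: algebra_simps)
qed

text \<open>With \<open>\<psi> = rho * deriv u\<close> and \<open>G = p \<psi>'\<close>, the test
  function \<open>\<eta> \<psi>\<close> satisfies \<open>p ((\<eta> \<psi>)')\<^sup>2 = p
  \<psi>\<^sup>2 \<eta>'\<^sup>2 + (G \<psi> \<eta>\<^sup>2)' - G' \<psi> \<eta>\<^sup>2\<close>.
  The part of \<open>G'\<close> with \<open>deriv g\<close> cancels the zeroth-order term,
  \<open>X = G \<psi> \<eta>\<^sup>2\<close> vanishes at both ends, and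
  \<open>p \<psi>\<^sup>2 = k m\<close>.\<close>

lemma energy_C1:
  assumes ab: "0 < a" "a < b" and \<eta>: "\<And>r. r > 0 \<Longrightarrow> (\<eta> has_real_derivative \<eta>' r) (at r)"
    and \<eta>': "continuous_on UNIV \<eta>'" and supp: "\<And>r. r \<notin> {a..b} \<Longrightarrow> \<eta> r = 0"
    and ends: "\<eta> a = 0" "\<eta> b = 0"
  shows "integral {a..b} (\<lambda>r. m r * ((\<eta>' r)\<^sup>2 - D r * (\<eta> r)\<^sup>2 / r\<^sup>2)) \<ge> 0"
proof -
  define \<psi> where "\<psi> r = rho r * deriv u r" for r
  define \<psi>' where "\<psi>' r = - v r * rho r / r * deriv u r + rho r * deriv (deriv u) r" for r
  define p where "p r = real k * r ^ (n - k) * deriv u r ^ (k - 1)" for r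
  define q where "q r = r ^ (n - 1) * w r * deriv g (u r) / c" for r
  define X where "X r = G r * \<psi> r * (\<eta> r)\<^sup>2" for r
  have \<psi>: "(\<psi> has_real_derivative \<psi>' r) (at r)" if "r > 0" for r
    unfolding \<psi>_def[abs_def] \<psi>'_def using that
    by (auto intro!: derivative_eq_intros rho_DERIV du_DERIV simp: algebra_simps)
  note cf = continuous_facts[OF order_refl]
  have cont_\<eta>: "continuous_on {0<..} \<eta>"
    using \<eta> by (auto intro!: continuous_at_imp_continuous_on DERIV_isCont)
  have cont_\<psi>': "continuous_on {0<..} \<psi>'" unfolding \<psi>'_def[abs_def]
    by (intro continuous_intros cf) auto
  have cont_\<psi>: "continuous_on {0<..} \<psi>" unfolding \<psi>_def[abs_def] by (intro continuous_intros cf)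
  have "integral {a..b} (\<lambda>r. p r * (\<eta>' r * \<psi> r + \<eta> r * \<psi>' r)\<^sup>2 + q r * (\<eta> r * \<psi> r)\<^sup>2) \<ge> 0"
    unfolding p_def q_def
  proof (rule stable[OF ab, where \<phi>="\<lambda>r. \<eta> r * \<psi> r"])
    show "((\<lambda>r. \<eta> r * \<psi> r) has_real_derivative \<eta>' r * \<psi> r + \<eta> r * \<psi>' r) (at r)" if "r > 0" for r
      using DERIV_mult[OF \<eta>[OF that] \<psi>[OF that]] by (simp add: algebra_simps)
    show "continuous_on {0<..} (\<lambda>r. \<eta>' r * \<psi> r + \<eta> r * \<psi>' r)"
      by (intro continuous_intros cont_\<eta> cont_\<psi> cont_\<psi>' continuous_on_subset[OF \<eta>']) auto
    show "\<eta> r * \<psi> r = 0" if "r \<notin> {a..b}" for r using supp[OF that] by simp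
  qed
  define X' where "X' r = G r * \<psi>' r * (\<eta> r)\<^sup>2 + 2 * G r * \<psi> r * \<eta> r * \<eta>' r
      + (rho r * (q r * deriv u r) + real k * rho r * F r * D r / r\<^sup>2) * \<psi> r * (\<eta> r)\<^sup>2" for r
  have X: "(X has_real_derivative X' r) (at r)" if "r > 0" for r
  proof -
    have "(G has_real_derivative rho r * (q r * deriv u r) + real k * rho r * F r * D r / r\<^sup>2) (at r)"
      using G_DERIV[OF that] by (simp add: q_def mult_ac)
    then show ?thesis unfolding X_def[abs_def] X'_def using \<eta>[OF that] \<psi>[OF that]
      by (auto intro!: derivative_eq_intros simp: algebra_simps power2_eq_square)
  qed
  have "(X' has_integral (X b - X a)) {a..b}"
    by (rule fundamental_theorem_of_calculus)
      (use ab X in \<open>auto simp flip: has_real_derivative_iff_has_vector_derivative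
        intro: has_field_derivative_at_within\<close>)
  then have X'int: "(X' has_integral 0) {a..b}" using ends by (simp add: X_def)
  define e where "e r = m r * ((\<eta>' r)\<^sup>2 - D r * (\<eta> r)\<^sup>2 / r\<^sup>2)" for r
  have key: "p r * (\<eta>' r * \<psi> r + \<eta> r * \<psi>' r)\<^sup>2 + q r * (\<eta> r * \<psi> r)\<^sup>2 = real k * e r + X' r"
    if r: "r \<in> {a..b}" for r
  proof -
    have r0: "r > 0" using r ab by simp
    have G: "G r = p r * \<psi>' r" using G_eq[OF r0] by (simp add: p_def \<psi>'_def)
    have F: "real k * F r = p r * deriv u r"
      using k1 by (simp add: F_def p_def mult.assoc flip: power_Suc2)
    have e: "real k * e r = p r * (\<psi> r)\<^sup>2 * ((\<eta>' r)\<^sup>2 - D r * (\<eta> r)\<^sup>2 / r\<^sup>2)"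
    proof -
      have "real k * e r = (rho r)\<^sup>2 * (real k * F r) * deriv u r * ((\<eta>' r)\<^sup>2 - D r * (\<eta> r)\<^sup>2 / r\<^sup>2)"
        by (simp add: e_def m_def)
      then show ?thesis unfolding F by (simp add: \<psi>_def power2_eq_square)
    qed
    have X': "X' r = p r * (\<psi>' r)\<^sup>2 * (\<eta> r)\<^sup>2 + 2 * p r * \<psi>' r * \<psi> r * \<eta> r * \<eta>' r
      + q r * (\<psi> r)\<^sup>2 * (\<eta> r)\<^sup>2 + p r * (\<psi> r)\<^sup>2 * (D r * (\<eta> r)\<^sup>2 / r\<^sup>2)"
    proof -
      have "X' r = p r * (\<psi>' r)\<^sup>2 * (\<eta> r)\<^sup>2 + 2 * p r * \<psi>' r * \<psi> r * \<eta> r * \<eta>' r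
        + q r * (rho r * deriv u r) * \<psi> r * (\<eta> r)\<^sup>2 + (real k * F r) * rho r * \<psi> r * (D r * (\<eta> r)\<^sup>2 / r\<^sup>2)"
        unfolding X'_def G by (simp add: algebra_simps power2_eq_square)
      then show ?thesis unfolding F by (simp add: \<psi>_def power2_eq_square)
    qed
    show ?thesis unfolding e X' by (simp add: algebra_simps power2_eq_square)
  qed
  have "continuous_on {a..b} e" unfolding e_def[abs_def]
    using ab by (intro continuous_intros continuous_facts continuous_on_subset[OF \<eta>']
      continuous_on_subset[OF cont_\<eta>]) auto
  then have "e integrable_on {a..b}" by (rule integrable_continuous_real)
  then have "((\<lambda>r. real k * e r + X' r) has_integral (real k * integral {a..b} e + 0)) {a..b}"
    by (intro has_integral_add X'int has_integral_mult_right integrable_integral)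
  then have "((\<lambda>r. p r * (\<eta>' r * \<psi> r + \<eta> r * \<psi>' r)\<^sup>2 + q r * (\<eta> r * \<psi> r)\<^sup>2) has_integral
      real k * integral {a..b} e) {a..b}"
    using key by (subst has_integral_cong) auto
  then have "real k * integral {a..b} e \<ge> 0"
    using \<open>integral {a..b} _ \<ge> 0\<close> by (simp add: integral_unique)
  then show ?thesis using k1 unfolding e_def[abs_def] by (simp add: zero_le_mult_iff)
qed

text \<open>\<open>energy_C1\<close> is applied to Steklov averages. They and their derivatives are
  uniformly bounded on a compact interval away from 0, so dominated convergence applies. The
  interval exceeds the support because averaging spreads it to the left by up to
  \<open>a / 2\<close>.\<close>

lemma energy_lipschitz:
  assumes ab: "0 < a" "a < b" and supp: "\<And>r. r \<notin> {a..b} \<Longrightarrow> \<eta> r = 0"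
    and cont: "continuous_on UNIV \<eta>"
    and right: "\<And>t. (\<eta> has_real_derivative \<eta>' t) (at t within {t<..})"
    and bound: "\<And>t. \<bar>\<eta>' t\<bar> \<le> K"
  defines "e \<equiv> \<lambda>r. m r * ((\<eta>' r)\<^sup>2 - D r * (\<eta> r)\<^sup>2 / r\<^sup>2)"
  shows "e integrable_on {a / 2..b + 1}" "integral {a / 2..b + 1} e \<ge> 0"
proof -
  have lip: "\<bar>\<eta> x - \<eta> y\<bar> \<le> (K + 1) * \<bar>x - y\<bar>" for x y
    by (rule right_derivative_imp_lipschitz[OF cont right bound])
  obtain S S' C where S: "\<And>j r. r > 0 \<Longrightarrow> (S j has_real_derivative S' j r) (at r)"
    "\<And>j. continuous_on UNIV (S' j)"
    "\<And>j r. r \<notin> {a / 2..b} \<Longrightarrow> S j r = 0"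
    "\<And>j r. r > 0 \<Longrightarrow> \<bar>S j r\<bar> \<le> C"
    "\<And>j r. \<bar>S' j r\<bar> \<le> K + 1"
    "\<And>r. r > 0 \<Longrightarrow> (\<lambda>j. S j r) \<longlonglongrightarrow> \<eta> r"
    "\<And>r. (\<lambda>j. S' j r) \<longlonglongrightarrow> \<eta>' r"
    using steklov_approximation[OF ab supp lip right] by metis
  let ?I = "{a / 2..b + 1}"
  define e' where "e' j r = m r * ((S' j r)\<^sup>2 - D r * (S j r)\<^sup>2 / r\<^sup>2)" for j r
  have I: "?I \<subseteq> {0<..}" using ab by auto
  note cf = continuous_facts[OF I]
  have contS: "continuous_on ?I (S j)" for j
    using S(1) I by (intro DERIV_continuous_on[where D="S' j"] has_field_derivative_at_within[OF S(1)]) auto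
  have "continuous_on ?I (e' j)" for j
    unfolding e'_def using ab
    by (intro continuous_intros cf contS continuous_on_subset[OF S(2)]) auto
  then have int: "e' j integrable_on ?I" for j by (rule integrable_continuous_real)
  have nn: "integral ?I (e' j) \<ge> 0" for j
  proof -
    \<comment> \<open>The averages vanish outside the closed interval \<open>{a / 2..b}\<close>; at
      \<open>a / 2\<close> itself the value 0 follows by continuity from the left.\<close>
    have S0: "S j r = 0" if "r \<notin> {a / 2<..<b + 1}" for r
    proof (cases "r = a / 2")
      case True
      have "((S j) \<longlongrightarrow> S j (a / 2)) (at_left (a / 2))"
        using DERIV_isCont[OF S(1)[of "a / 2" j]] ab
        by (auto simp: isCont_def intro: filterlim_at_split[THEN iffD1, THEN conjunct1])
      moreover have "((S j) \<longlongrightarrow> 0) (at_left (a / 2))"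
        by (rule tendsto_eventually) (auto simp: eventually_at_left_field S(3) intro!: exI[of _ "a/2 - 1"])
      ultimately show ?thesis using True tendsto_unique trivial_limit_at_left_real by blast
    qed (use that S(3) in auto)
    show ?thesis
      unfolding e'_def
      by (rule energy_C1) (use ab S(1,2) S0 in auto)
  qed
  define H where "H r = m r * ((K + 1)\<^sup>2 + \<bar>D r\<bar> * C\<^sup>2 / r\<^sup>2)" for r
  have m0: "m r \<ge> 0" if "r > 0" for r
    using that du_nonneg[OF that] by (simp add: m_def F_def)
  have "continuous_on ?I H"
    unfolding H_def using ab by (intro continuous_intros cf) auto
  then have H: "H integrable_on ?I" by (rule integrable_continuous_real)
  have le: "norm (e' j r) \<le> H r" if "r \<in> ?I" for j r
  proof -
    have r: "r > 0" using that I by auto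
    have "(S' j r)\<^sup>2 \<le> (K + 1)\<^sup>2"
      using power_mono[OF S(5)[of j r] abs_ge_zero, of 2] by simp
    moreover have "\<bar>D r * (S j r)\<^sup>2 / r\<^sup>2\<bar> \<le> \<bar>D r\<bar> * C\<^sup>2 / r\<^sup>2"
      using power_mono[OF S(4)[OF r, of j] abs_ge_zero, of 2]
      by (auto simp: abs_mult intro!: divide_right_mono mult_left_mono)
    ultimately have "\<bar>(S' j r)\<^sup>2 - D r * (S j r)\<^sup>2 / r\<^sup>2\<bar> \<le> (K + 1)\<^sup>2 + \<bar>D r\<bar> * C\<^sup>2 / r\<^sup>2"
      using zero_le_power2[of "S' j r"] unfolding abs_le_iff by linarith
    then show ?thesis using m0[OF r]
      by (auto simp: e'_def H_def abs_mult intro!: mult_left_mono)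
  qed
  have conv: "(\<lambda>j. e' j r) \<longlonglongrightarrow> e r" if "r \<in> ?I" for r
    unfolding e'_def e_def using that ab by (intro tendsto_intros S(6,7)) auto
  note dc = dominated_convergence[OF int H le conv]
  show "e integrable_on ?I" by (rule dc(1))
  show "integral ?I e \<ge> 0"
    by (rule tendsto_lowerbound[OF dc(2)]) (use nn in auto)
qed

section \<open>Sign and monotonicity of the flux and the profile\<close>

lemma F_mono: "0 < r \<Longrightarrow> r \<le> s \<Longrightarrow> F r \<le> F s"
proof (rule DERIV_nonneg_imp_nondecreasing[where f=F])
  fix x assume "0 < r" "r \<le> x"
  then have x: "x > 0" by simp
  then have "dF x \<ge> 0" using w_pos[OF x] g_nonneg c_pos by (simp add: dF_def)
  then show "\<exists>y. (F has_real_derivative y) (at x) \<and> 0 \<le> y" using F_DERIV[OF x] by blast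
qed

lemma F_nonneg: "r > 0 \<Longrightarrow> F r \<ge> 0"
  using du_nonneg by (simp add: F_def)

lemma F_le_power: "\<exists>C>0. \<forall>\<^sub>F r in at_right 0. F r \<le> C * r ^ n"
proof -
  obtain C0 where C0: "\<forall>\<^sub>F r in at_right 0. \<bar>deriv u r\<bar> \<le> C0 * r" using du_le by blast
  define C where "C = max C0 1"
  have "\<forall>\<^sub>F r in at_right 0. F r \<le> C ^ k * r ^ n"
    using C0 eventually_at_right_less[of 0]
  proof eventually_elim
    case (elim r)
    have "\<bar>deriv u r\<bar> \<le> C * r"
      using elim by (intro order_trans[OF elim(1)] mult_right_mono) (auto simp: C_def)
    then have "deriv u r \<le> C * r" by simp
    then have "F r \<le> r ^ (n - k) * (C * r) ^ k"
      unfolding F_def using elim du_nonneg[of r] by (intro mult_left_mono power_mono) auto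
    also have "\<dots> = C ^ k * (r ^ (n - k) * r ^ k)" by (simp add: power_mult_distrib mult_ac)
    also have "r ^ (n - k) * r ^ k = r ^ n" using kn by (simp flip: power_add)
    finally show ?case .
  qed
  moreover have "C ^ k > 0" by (simp add: C_def)
  ultimately show ?thesis by blast
qed

lemma F_tendsto_0: "(F \<longlongrightarrow> 0) (at_right 0)"
proof -
  obtain C where C: "C > 0" "\<forall>\<^sub>F r in at_right 0. F r \<le> C * r ^ n" using F_le_power by blast
  show ?thesis
  proof (rule Lim_null_comparison)
    show "\<forall>\<^sub>F r in at_right 0. norm (F r) \<le> C * r ^ n"
      using C(2) eventually_at_right_less[of 0] by eventually_elim (simp add: F_nonneg)
    have "((\<lambda>r. C * r ^ n) \<longlongrightarrow> C * 0 ^ n) (at_right (0::real))" by (intro tendsto_intros)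
    moreover have "C * 0 ^ n = 0" using n2 by simp
    ultimately show "((\<lambda>r. C * r ^ n) \<longlongrightarrow> 0) (at_right (0::real))" by (simp only:)
  qed
qed

lemma u_mono: "0 < r \<Longrightarrow> r \<le> s \<Longrightarrow> u r \<le> u s"
proof (rule DERIV_nonneg_imp_nondecreasing[where f=u])
  fix x assume "0 < r" "r \<le> x"
  then have "x > 0" by simp
  then show "\<exists>y. (u has_real_derivative y) (at x) \<and> 0 \<le> y" using u_DERIV du_nonneg by blast
qed

lemma u_ge_0: "r > 0 \<Longrightarrow> u 0 \<le> u r"
proof -
  assume "r > 0"
  then have "\<forall>\<^sub>F s in at_right 0. u s \<le> u r"
    unfolding eventually_at_right_field by (intro exI[of _ r]) (auto intro: u_mono)
  then show ?thesis
    using tendsto_upperbound[OF u_0] by (simp add: trivial_limit_at_right_real)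
qed

text \<open>If \<open>g\<close> vanished at \<open>u 0\<close>, monotonicity would make it vanish along the whole profile.\<close>

lemma g_u0_pos: "g (u 0) > 0"
proof (rule ccontr)
  assume "\<not> g (u 0) > 0"
  then have "g (u 0) = 0" using g_nonneg[of "u 0"] by simp
  then have g0: "g (u r) = 0" if "r > 0" for r
    using u_ge_0[OF that] g_antimono g_nonneg[of "u r"] by (metis antimonoD order_antisym)
  have F0: "F r = 0" if r: "r > 0" for r
  proof -
    have "F s = F r" if "s > 0" "s < r" for s
    proof (rule DERIV_isconst2[of s r F, symmetric])
      show "continuous_on {s..r} F" using that by (intro continuous_facts) auto
      fix x assume "s < x" "x < r"
      then have "x > 0" using that by simp
      then show "(F has_real_derivative 0) (at x)" using F_DERIV[of x] g0[of x] by (simp add: dF_def)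
    qed (use that in auto)
    then have "\<forall>\<^sub>F s in at_right 0. F s = F r"
      unfolding eventually_at_right_field using r by blast
    then have "((\<lambda>s. F r) \<longlongrightarrow> 0) (at_right (0::real))"
      by (rule Lim_transform_eventually[OF F_tendsto_0])
    then show ?thesis by (simp add: tendsto_const_iff trivial_limit_at_right_real)
  qed
  have du0: "deriv u r = 0" if "r > 0" for r using F0[OF that] that by (simp add: F_def)
  obtain R where R: "R > 0" "u R \<noteq> u 0" using nonconst by blast
  have "u s = u R" if "s > 0" "s < R" for s
  proof (rule DERIV_isconst2[of s R u, symmetric])
    show "continuous_on {s..R} u" using that by (intro continuous_facts) auto
    fix x assume "s < x" "x < R"
    then have "x > 0" using that by simp
    then show "(u has_real_derivative 0) (at x)" using u_DERIV[of x] du0[of x] by simp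
  qed (use that in auto)
  then have "\<forall>\<^sub>F s in at_right 0. u s = u R"
    unfolding eventually_at_right_field using R by blast
  then have "((\<lambda>s. u R) \<longlongrightarrow> u 0) (at_right (0::real))"
    by (rule Lim_transform_eventually[OF u_0])
  then show False using R by (simp add: tendsto_const_iff trivial_limit_at_right_real)
qed

lemma g_u_near_0: "\<forall>\<^sub>F r in at_right 0. g (u r) \<ge> g (u 0) / 2"
proof -
  have "isCont g (u 0)" using g_DERIV by (rule DERIV_isCont)
  then have "((\<lambda>r. g (u r)) \<longlongrightarrow> g (u 0)) (at_right 0)" by (rule isCont_tendsto_compose[OF _ u_0])
  then have "\<forall>\<^sub>F r in at_right 0. g (u r) > g (u 0) / 2"
    by (rule order_tendstoD) (use g_u0_pos in simp)
  then show ?thesis by eventually_elim simp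
qed

text \<open>The flux increases strictly near the origin, where \<open>g (u r)\<close> is close to
  \<open>g (u 0) > 0\<close>, and never decreases afterwards.\<close>

lemma F_pos: "r > 0 \<Longrightarrow> F r > 0"
proof -
  assume r: "r > 0"
  obtain b where b: "b > 0" "\<And>s. 0 < s \<Longrightarrow> s < b \<Longrightarrow> g (u s) \<ge> g (u 0) / 2"
    using g_u_near_0 by (auto simp: eventually_at_right_field)
  define s where "s = min (r / 2) (b / 2)"
  have s: "0 < s" "s < r" "s < b" using r b by (auto simp: s_def)
  have "F (s / 2) < F s"
  proof (rule DERIV_pos_imp_increasing[where f=F])
    fix x assume "s / 2 \<le> x" "x \<le> s"
    then have x: "0 < x" "x < b" using s by auto
    then have "dF x > 0" using b(2)[OF x] g_u0_pos w_pos[OF x(1)] c_pos by (simp add: dF_def)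
    then show "\<exists>y. (F has_real_derivative y) (at x) \<and> 0 < y" using F_DERIV[OF x(1)] by blast
  qed (use s in simp)
  also have "F s \<le> F r" using s by (intro F_mono) auto
  finally show ?thesis using F_nonneg[of "s / 2"] s by simp
qed

lemma du_pos: "r > 0 \<Longrightarrow> deriv u r > 0"
  using F_pos[of r] du_nonneg[of r] k1
  by (cases "deriv u r = 0") (auto simp: F_def power_0_left)

lemma m_pos: "r > 0 \<Longrightarrow> m r > 0"
  using F_pos du_pos rho_pos unfolding m_def by (intro mult_pos_pos zero_less_power) auto

definition u_inf where "u_inf = (SUP r\<in>{0<..}. u r)"

lemma u_tendsto: "(u \<longlongrightarrow> u_inf) at_top"
proof -
  have bdd: "bdd_above (u ` {0<..})" using u_le by (auto simp: bdd_above_def)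
  show ?thesis
  proof (rule increasing_tendsto)
    show "\<forall>\<^sub>F r in at_top. u r \<le> u_inf"
      using eventually_gt_at_top[of 0] unfolding u_inf_def
      by eventually_elim (auto intro!: cSUP_upper bdd)
    fix x assume "x < u_inf"
    then obtain r where r: "r > 0" "x < u r"
      unfolding u_inf_def using less_cSUP_iff[OF _ bdd] by auto
    show "\<forall>\<^sub>F s in at_top. x < u s"
      using eventually_ge_at_top[of r] by eventually_elim (use r u_mono in \<open>force\<close>)
  qed
qed

lemma u_le_inf: "r > 0 \<Longrightarrow> u r \<le> u_inf"
  unfolding u_inf_def using u_le by (intro cSUP_upper bdd_aboveI2[of _ _ B]) auto

lemma u_less: "0 < r \<Longrightarrow> r < s \<Longrightarrow> u r < u s"
proof (rule DERIV_pos_imp_increasing[where f=u])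
  fix x assume "0 < r" "r \<le> x"
  then have "x > 0" by simp
  then show "\<exists>y. (u has_real_derivative y) (at x) \<and> 0 < y" using u_DERIV du_pos by blast
qed

lemma u_less_inf: "r > 0 \<Longrightarrow> u r < u_inf"
  using u_less[of r "r + 1"] u_le_inf[of "r + 1"] by simp

section \<open>Behaviour at the origin\<close>

text \<open>\<open>W_fun w\<close> stays below its limit \<Gamma> at 0, so
  \<open>ln w - \<Gamma> * ln\<close> has nonpositive derivative. Towards the origin
  \<open>w\<close> is thus at least a multiple of \<open>r powr \<Gamma>\<close>.\<close>

lemma w_powr_antimono:
  assumes "0 < r" "r \<le> s"
  shows "w s / s powr \<Gamma> \<le> w r / r powr \<Gamma>"
proof -
  have "ln (w s) - \<Gamma> * ln s \<le> ln (w r) - \<Gamma> * ln r"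
  proof (rule DERIV_nonpos_imp_nonincreasing[where f="\<lambda>x. ln (w x) - \<Gamma> * ln x"])
    fix x assume "r \<le> x" "x \<le> s"
    then have x: "x > 0" using assms by simp
    have "((\<lambda>x. ln (w x) - \<Gamma> * ln x) has_real_derivative deriv w x / w x - \<Gamma> * (1 / x)) (at x)"
      using x w_pos[OF x] w_DERIV[OF x] by (auto intro!: derivative_eq_intros)
    moreover have "deriv w x / w x - \<Gamma> * (1 / x) = (W_fun w x - \<Gamma>) / x"
      using w_pos[OF x] by (simp add: w'_eq[OF x] diff_divide_distrib)
    moreover have "(W_fun w x - \<Gamma>) / x \<le> 0"
      using W_le_Gamma[OF x] x by (simp add: divide_le_0_iff)
    ultimately show "\<exists>y. ((\<lambda>x. ln (w x) - \<Gamma> * ln x) has_real_derivative y) (at x) \<and> y \<le> 0" by auto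
  qed (use assms in simp)
  then have "exp (ln (w s) - \<Gamma> * ln s) \<le> exp (ln (w r) - \<Gamma> * ln r)" by simp
  then show ?thesis using assms w_pos by (simp add: exp_diff powr_def)
qed

text \<open>Otherwise \<open>w\<close> would be so singular at the origin that \<open>F\<close> is not \<open>O(r ^ n)\<close>.\<close>

lemma Gamma_nonneg: "\<Gamma> \<ge> 0"
proof (rule ccontr)
  assume "\<not> \<Gamma> \<ge> 0"
  then have neg: "\<Gamma> < 0" by simp
  obtain C where C: "C > 0" "\<forall>\<^sub>F r in at_right 0. F r \<le> C * r ^ n" using F_le_power by blast
  \<comment> \<open>From the mean value theorem on \<open>{r / 2..r}\<close>: the factor
    \<open>2 ^ n\<close> collects \<open>r / 2\<close> and \<open>(r / 2) ^ (n - 1)\<close>, and for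
    negative \<Gamma> the smallest value of \<open>z powr \<Gamma>\<close> there is
    \<open>r powr \<Gamma>\<close>.\<close>
  define \<kappa> where "\<kappa> = w 1 * (g (u 0) / 2) / c / 2 ^ n"
  have \<kappa>: "\<kappa> > 0" using w_pos[of 1] g_u0_pos c_pos by (simp add: \<kappa>_def)
  obtain b where b: "b > 0" "\<And>s. 0 < s \<Longrightarrow> s < b \<Longrightarrow> g (u s) \<ge> g (u 0) / 2"
    using g_u_near_0 by (auto simp: eventually_at_right_field)
  have low: "\<kappa> * r powr \<Gamma> * r ^ n \<le> F r" if r: "0 < r" "r < b" "r < 1" for r
  proof -
    have "\<exists>z. r / 2 < z \<and> z < r \<and> F r - F (r / 2) = (r - r / 2) * dF z"
      by (rule MVT2) (use r in \<open>auto intro!: F_DERIV\<close>)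
    then obtain z where z: "r / 2 < z" "z < r" "F r - F (r / 2) = r / 2 * dF z" by auto
    then have z0: "z > 0" using r by simp
    have "w 1 * r powr \<Gamma> \<le> w 1 * z powr \<Gamma>"
      using z z0 neg w_pos[of 1] by (intro mult_left_mono powr_mono2') auto
    also have "\<dots> \<le> w z"
      using w_powr_antimono[of z 1] z0 z r by (simp add: pos_le_divide_eq)
    finally have wz: "w 1 * r powr \<Gamma> \<le> w z" .
    have "(r / 2) ^ (n - 1) * (w 1 * r powr \<Gamma>) * (g (u 0) / 2) / c \<le> dF z"
      unfolding dF_def using z z0 r wz b(2)[of z] g_u0_pos c_pos w_pos[of 1] w_pos[of z]
      by (intro divide_right_mono mult_mono power_mono) auto
    then have "r / 2 * ((r / 2) ^ (n - 1) * (w 1 * r powr \<Gamma>) * (g (u 0) / 2) / c) \<le> r / 2 * dF z"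
      using r by (intro mult_left_mono) auto
    also have "r / 2 * ((r / 2) ^ (n - 1) * (w 1 * r powr \<Gamma>) * (g (u 0) / 2) / c)
        = (r / 2) ^ n * (w 1 * r powr \<Gamma>) * (g (u 0) / 2) / c"
      using n2 by (cases n) auto
    also have "\<dots> = \<kappa> * r powr \<Gamma> * r ^ n" by (simp add: \<kappa>_def power_divide mult_ac)
    also have "r / 2 * dF z \<le> F r" using z F_nonneg[of "r / 2"] r by simp
    finally show ?thesis .
  qed
  have "\<forall>\<^sub>F r in at_right 0. \<kappa> / C \<le> r powr (- \<Gamma>)"
  proof -
    have "\<forall>\<^sub>F r in at_right 0. 0 < r \<and> r < b \<and> r < (1::real)"
      unfolding eventually_at_right_field using b(1) by (intro exI[of _ "min b 1"]) auto
    then show ?thesis using C(2)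
    proof eventually_elim
      case (elim r)
      then have "(\<kappa> * r powr \<Gamma>) * r ^ n \<le> C * r ^ n" using low[of r] by linarith
      then have "\<kappa> * r powr \<Gamma> \<le> C" using elim by (simp add: mult_le_cancel_right)
      then show ?case using elim C(1) by (simp add: powr_minus_divide field_simps)
    qed
  qed
  moreover have "((\<lambda>r. r powr (- \<Gamma>)) \<longlongrightarrow> 0) (at_right (0::real))"
    using neg by (intro tendsto_zero_powrI[where b="- \<Gamma>"] tendsto_intros)
      (auto simp: eventually_at_right_field intro!: exI[of _ 1])
  ultimately have "\<kappa> / C \<le> 0"
    by (intro tendsto_lowerbound) (auto simp: trivial_limit_at_right_real)
  then show False using \<kappa> C(1) by (simp add: divide_le_0_iff)
qed

text \<open>Since \<Gamma> \<ge> 0, near the origin \<open>n + W_fun w r > 1\<close>, so the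
  derivative of \<open>r ^ n * w r\<close> dominates \<open>r ^ (n - 1) * w r\<close>, while
  \<open>g (u r) \<le> g (u 0)\<close>. Thus \<open>H\<close> is nondecreasing there. No limit of
  \<open>r ^ n * w r\<close> at 0 is available, but \<open>H \<ge> - F\<close> and \<open>F\<close>
  tends to 0.\<close>

lemma F_le_power_w: "\<exists>C>0. \<forall>\<^sub>F r in at_right 0. F r \<le> C * (r ^ n * w r)"
proof (intro exI conjI)
  let ?C = "g (u 0) / c"
  show "?C > 0" using g_u0_pos c_pos by simp
  have "\<forall>\<^sub>F r in at_right 0. W_fun w r > - 1"
    using W_0 Gamma_nonneg by (intro order_tendstoD) auto
  then obtain b where b: "b > 0" "\<And>r. 0 < r \<Longrightarrow> r < b \<Longrightarrow> W_fun w r > - 1"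
    by (auto simp: eventually_at_right_field)
  define H where "H r = ?C * (r ^ n * w r) - F r" for r
  have H: "(H has_real_derivative r ^ (n - 1) * w r * (?C * (real n + W_fun w r) - g (u r) / c)) (at r)"
    if r: "r > 0" for r
  proof -
    have p: "real n * r ^ (n - 1) * w r + r ^ n * (w r * W_fun w r / r) = r ^ (n - 1) * w r * (real n + W_fun w r)"
      using n2 r by (cases n) (auto simp: field_simps)
    have "((\<lambda>r. r ^ n * w r) has_real_derivative real n * r ^ (n - 1) * w r + r ^ n * (w r * W_fun w r / r)) (at r)"
      using w_DERIV[OF r] by (auto intro!: derivative_eq_intros simp: w'_eq[OF r])
    then have "(H has_real_derivative ?C * (r ^ (n - 1) * w r * (real n + W_fun w r)) - dF r) (at r)"
      unfolding p H_def[abs_def] by (intro DERIV_diff DERIV_cmult F_DERIV r)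
    then show ?thesis by (simp add: dF_def algebra_simps)
  qed
  have H0: "0 \<le> H r" if r: "0 < r" "r < b" for r
  proof -
    have "- F s \<le> H r" if s: "0 < s" "s < r" for s
    proof -
      have "H s \<le> H r"
      proof (rule DERIV_nonneg_imp_nondecreasing[where f=H])
        fix x assume "s \<le> x" "x \<le> r"
        then have x: "0 < x" "x < b" using s r by auto
        have "g (u x) \<le> g (u 0) * 1"
          using u_ge_0[OF x(1)] g_antimono by (simp add: antimonoD)
        also have "\<dots> \<le> g (u 0) * (real n + W_fun w x)"
          using b(2)[OF x] n2 g_u0_pos by (intro mult_left_mono) auto
        finally have "g (u x) / c \<le> ?C * (real n + W_fun w x)"
          using c_pos by (simp add: divide_right_mono)
        then show "\<exists>y. (H has_real_derivative y) (at x) \<and> 0 \<le> y"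
          using H[OF x(1)] x w_pos[OF x(1)] by (intro exI conjI) auto
      qed (use s in simp)
      moreover have "H s \<ge> - F s" using s w_pos[of s] g_u0_pos c_pos by (simp add: H_def)
      ultimately show ?thesis by simp
    qed
    then have "\<forall>\<^sub>F s in at_right 0. - F s \<le> H r"
      unfolding eventually_at_right_field using r by blast
    moreover have "((\<lambda>s. - F s) \<longlongrightarrow> - 0) (at_right 0)" by (intro tendsto_intros F_tendsto_0)
    ultimately show ?thesis using tendsto_upperbound[of "\<lambda>s. - F s" "- 0" "at_right 0" "H r"]
      by (simp add: trivial_limit_at_right_real)
  qed
  show "\<forall>\<^sub>F r in at_right 0. F r \<le> ?C * (r ^ n * w r)"
    unfolding eventually_at_right_field using b(1) H0 by (intro exI[of _ b]) (auto simp: H_def)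
qed

lemma rho_power: "r > 0 \<Longrightarrow> rho r ^ (k + 1) * (r ^ (k - 1) * w r) = 1"
proof -
  assume r: "r > 0"
  have "rho r ^ (k + 1) = exp (real (k + 1) * (- ((real k - 1) * ln r + ln (w r)) / (real k + 1)))"
    unfolding rho_def by (simp only: exp_of_nat_mult)
  also have "real (k + 1) * (- ((real k - 1) * ln r + ln (w r)) / (real k + 1)) =
      - (real (k - 1) * ln r + ln (w r))"
    using k1 by (simp add: of_nat_diff add.commute)
  also have "exp \<dots> = 1 / (exp (real (k - 1) * ln r) * exp (ln (w r)))"
    by (simp only: exp_minus exp_add inverse_eq_divide)
  also have "exp (real (k - 1) * ln r) = r ^ (k - 1)" using r by (simp only: exp_of_nat_mult exp_ln)
  finally show ?thesis using r w_pos[OF r] by simp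
qed

text \<open>Interpolate between \<open>F \<le> C r ^ n\<close> and \<open>F \<le> C r ^ n w\<close> so that \<open>w\<close> cancels.\<close>

lemma rho_F_tendsto_0: "((\<lambda>r. (rho r)\<^sup>2 * F r) \<longlongrightarrow> 0) (at_right 0)"
proof -
  obtain C where C: "C > 0" "\<forall>\<^sub>F r in at_right 0. F r \<le> C * r ^ n" using F_le_power by blast
  obtain C' where C': "C' > 0" "\<forall>\<^sub>F r in at_right 0. F r \<le> C' * (r ^ n * w r)" using F_le_power_w by blast
  \<comment> \<open>\<open>rho ^ (2 * (k + 1))\<close> carries \<open>w\<close> to the power -2, so
    the bound containing \<open>w\<close> is spent on exactly two of the \<open>k + 1\<close>
    factors \<open>F\<close>. As \<open>n \<ge> 2\<close>, at least \<open>r ^ 4\<close> is left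
    over.\<close>
  define M where "M = C'\<^sup>2 * C ^ (k - 1)"
  have M: "M > 0" using C C' by (simp add: M_def)
  have ev: "\<forall>\<^sub>F r in at_right 0. ((rho r)\<^sup>2 * F r) ^ (k + 1) \<le> M * r ^ 4"
    using C(2) C'(2) eventually_at_right_less[of 0] eventually_at_right_real[of 0 1, OF zero_less_one]
  proof eventually_elim
    case (elim r)
    then have r: "0 < r" "r \<le> 1" by auto
    have k: "k + 1 = 2 + (k - 1)" using k1 by simp
    have "F r ^ (k + 1) = (F r)\<^sup>2 * F r ^ (k - 1)" unfolding k power_add by simp
    also have "\<dots> \<le> (C' * (r ^ n * w r))\<^sup>2 * (C * r ^ n) ^ (k - 1)"
      using elim F_nonneg[OF r(1)] w_pos[OF r(1)] C' by (intro mult_mono power_mono) auto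
    also have "\<dots> = M * (w r)\<^sup>2 * (r ^ n) ^ (k + 1)"
      unfolding k power_add by (simp add: M_def power_mult_distrib)
    finally have F: "F r ^ (k + 1) \<le> M * (w r)\<^sup>2 * (r ^ n) ^ (k + 1)" .
    have "n * (k + 1) \<ge> 2 * (k - 1) + 4"
    proof -
      have "2 * (k + 1) \<le> n * (k + 1)" using n2 by (rule mult_le_mono1)
      then show ?thesis using k1 by simp
    qed
    then have "(r ^ n) ^ (k + 1) \<le> r ^ (2 * (k - 1) + 4)"
      using r by (simp only: flip: power_mult) (rule power_decreasing, auto)
    also have "\<dots> = (r ^ (k - 1))\<^sup>2 * r ^ 4"
      by (simp only: power_add power_even_eq)
    finally have p: "(r ^ n) ^ (k + 1) \<le> (r ^ (k - 1))\<^sup>2 * r ^ 4" .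
    have "((rho r)\<^sup>2 * F r) ^ (k + 1) = (rho r ^ (k + 1))\<^sup>2 * F r ^ (k + 1)"
      by (simp only: power_mult_distrib flip: power_mult) (simp add: mult.commute)
    also have "\<dots> \<le> (rho r ^ (k + 1))\<^sup>2 * (M * (w r)\<^sup>2 * ((r ^ (k - 1))\<^sup>2 * r ^ 4))"
      using F p M by (intro mult_left_mono order_trans[OF F]) auto
    also have "\<dots> = M * (rho r ^ (k + 1) * (r ^ (k - 1) * w r))\<^sup>2 * r ^ 4"
      by (simp only: power_mult_distrib mult_ac)
    also have "\<dots> = M * r ^ 4" unfolding rho_power[OF r(1)] by simp
    finally show ?case .
  qed
  have "((\<lambda>r. M * r ^ 4) \<longlongrightarrow> M * 0 ^ 4) (at_right (0::real))" by (intro tendsto_intros)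
  moreover have "M * 0 ^ 4 = 0" by simp
  ultimately have M0: "((\<lambda>r. M * r ^ 4) \<longlongrightarrow> 0) (at_right (0::real))" by (simp only:)
  have lim: "((\<lambda>r. ((rho r)\<^sup>2 * F r) ^ (k + 1)) \<longlongrightarrow> 0) (at_right 0)"
  proof (rule Lim_null_comparison[OF _ M0])
    show "\<forall>\<^sub>F r in at_right 0. norm (((rho r)\<^sup>2 * F r) ^ (k + 1)) \<le> M * r ^ 4"
      using ev eventually_at_right_less[of 0]
    proof eventually_elim
      case (elim r)
      have "((rho r)\<^sup>2 * F r) ^ (k + 1) \<ge> 0" using F_nonneg[OF elim(2)] by (intro zero_le_power) simp
      then show ?case using elim(1) by (simp only: real_norm_def abs_of_nonneg)
    qed
  qed
  show ?thesis
  proof (rule order_tendstoI)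
    fix e :: real assume e: "e < 0"
    show "\<forall>\<^sub>F r in at_right 0. e < (rho r)\<^sup>2 * F r"
      using eventually_at_right_less[of 0]
    proof eventually_elim
      case (elim r)
      then have "(rho r)\<^sup>2 * F r \<ge> 0" using F_nonneg by simp
      then show ?case using e by linarith
    qed
  next
    fix e :: real assume e: "e > 0"
    then have "\<forall>\<^sub>F r in at_right 0. ((rho r)\<^sup>2 * F r) ^ (k + 1) < e ^ (k + 1)"
      by (intro order_tendstoD(2)[OF lim]) simp
    then show "\<forall>\<^sub>F r in at_right 0. (rho r)\<^sup>2 * F r < e"
      by (rule eventually_mono) (erule power_less_imp_less_base, use e in simp)
  qed
qed

lemma m_over_r_tendsto_0: "((\<lambda>r. m r / r) \<longlongrightarrow> 0) (at_right 0)"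
proof -
  obtain C where C: "\<forall>\<^sub>F r in at_right 0. \<bar>deriv u r\<bar> \<le> C * r" using du_le by blast
  show ?thesis
  proof (rule Lim_null_comparison)
    show "\<forall>\<^sub>F r in at_right 0. norm (m r / r) \<le> (rho r)\<^sup>2 * F r * C"
      using C eventually_at_right_less[of 0]
    proof eventually_elim
      case (elim r)
      then have "deriv u r / r \<le> C" by (simp add: pos_divide_le_eq)
      then have "(rho r)\<^sup>2 * F r * (deriv u r / r) \<le> (rho r)\<^sup>2 * F r * C"
        using F_nonneg[of r] elim by (intro mult_left_mono) auto
      then show ?case using m_pos[of r] elim by (simp add: m_def)
    qed
    have "((\<lambda>r. (rho r)\<^sup>2 * F r * C) \<longlongrightarrow> 0 * C) (at_right 0)"
      by (intro tendsto_intros rho_F_tendsto_0)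
    then show "((\<lambda>r. (rho r)\<^sup>2 * F r * C) \<longlongrightarrow> 0) (at_right 0)" by simp
  qed
qed

lemma D_ge: "r > 0 \<Longrightarrow> D r \<ge> (v r + 1) * (v r + real n / real k - 1)"
  using v'_nonpos[of r] by (simp add: D_eq mult_nonneg_nonpos)

text \<open>Both factors of the limit \<open>(v_0 + 1) * (v_0 + n / k - 1)\<close> are positive. For
  \<open>k = 1\<close> this is due to \<open>n \<ge> 2\<close>; for \<open>k > 1\<close> already
  \<open>v_0 > 0\<close>, which also covers \<open>k = n\<close>.\<close>

lemma D_pos_near_0: "\<forall>\<^sub>F r in at_right 0. D r > 0"
proof -
  have nk: "real n / real k \<ge> 1" using k1 kn by simp
  have v0: "v_0 \<ge> 0" using Gamma_nonneg k1 by (simp add: v_0_def)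
  have "v_0 + real n / real k - 1 > 0"
  proof (cases "k = 1")
    case True
    then show ?thesis using v0 n2 by simp
  next
    case False
    then have "v_0 > 0" using k1 Gamma_nonneg by (simp add: v_0_def)
    then show ?thesis using nk by simp
  qed
  then have "0 < (v_0 + 1) * (v_0 + real n / real k - 1)" using v0 by simp
  moreover have "((\<lambda>r. (v r + 1) * (v r + real n / real k - 1)) \<longlongrightarrow>
      (v_0 + 1) * (v_0 + real n / real k - 1)) (at_right 0)"
    by (intro tendsto_intros v_tendsto_0)
  ultimately have "\<forall>\<^sub>F r in at_right 0. (v r + 1) * (v r + real n / real k - 1) > 0"
    by (intro order_tendstoD)
  then show ?thesis using eventually_at_right_less[of 0]
    by eventually_elim (use D_ge in \<open>force\<close>)
qed

section \<open>Growth of the profile\<close>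

text \<open>\<open>F 1 \<le> F r\<close> solved for \<open>deriv u\<close>. The comparison function
  has constant flux, that is, it is the derivative of the fundamental solution.\<close>

lemma du_ge:
  obtains a where "a > 0" "\<And>r. r \<ge> 1 \<Longrightarrow> a * r powr (1 - real n / real k) \<le> deriv u r"
proof
  let ?a = "F 1 powr (1 / real k)"
  show "?a > 0" using F_pos[of 1] by simp
  fix r :: real assume r: "r \<ge> 1"
  have F1: "F 1 \<le> F r" using r by (intro F_mono) auto
  have "(?a * r powr (1 - real n / real k)) ^ k = ?a ^ k * (r powr (1 - real n / real k)) ^ k"
    by (rule power_mult_distrib)
  also have "?a ^ k = F 1" using F_pos[of 1] k1 by (simp add: powr_power)
  also have "(r powr (1 - real n / real k)) ^ k = r powr (real k - real n)"
  proof -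
    have "(r powr (1 - real n / real k)) ^ k = r powr ((1 - real n / real k) * real k)"
      using r by (simp add: powr_power mult.commute)
    also have "(1 - real n / real k) * real k = real k - real n" using k1 by (simp add: left_diff_distrib)
    finally show ?thesis .
  qed
  also have "r powr (real k - real n) = 1 / r ^ (n - k)"
    using r kn by (simp add: powr_diff powr_realpow power_diff)
  also have "F 1 * (1 / r ^ (n - k)) \<le> deriv u r ^ k"
    using F1 r by (simp add: F_def pos_divide_le_eq mult.commute)
  finally show "?a * r powr (1 - real n / real k) \<le> deriv u r"
    using k1 du_nonneg[of r] r by (simp add: power_mono_iff)
qed

text \<open>Otherwise \<open>du_ge\<close> would give \<open>deriv u r \<ge> a / r\<close>, and
  \<open>u\<close> would grow at least logarithmically. The radius \<open>R\<close> is where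
  \<open>u 1 + a * ln R\<close> passes the bound \<open>B\<close>.\<close>

lemma n_gt_2k: "n > 2 * k"
proof (rule ccontr)
  assume "\<not> n > 2 * k"
  then have "real n / real k \<le> 2" using k1 by (simp add: pos_divide_le_eq)
  then have e: "- 1 \<le> 1 - real n / real k" by simp
  obtain a where a: "a > 0" "\<And>r. r \<ge> 1 \<Longrightarrow> a * r powr (1 - real n / real k) \<le> deriv u r"
    using du_ge by blast
  define R where "R = exp ((B - u 1) / a + 1)"
  have "(B - u 1) / a \<ge> 0" using u_le[of 1] a by simp
  then have R: "R \<ge> 1" by (simp add: R_def)
  have "u 1 - a * ln 1 \<le> u R - a * ln R"
  proof (rule DERIV_nonneg_imp_nondecreasing[where f="\<lambda>x. u x - a * ln x"])
    fix x :: real assume x: "1 \<le> x" "x \<le> R"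
    have "a * (1 / x) = a * x powr (- 1)" using x by (simp add: powr_minus_divide)
    also have "\<dots> \<le> a * x powr (1 - real n / real k)"
      using a x e by (intro mult_left_mono powr_mono) auto
    also have "\<dots> \<le> deriv u x" using a x by simp
    finally have "0 \<le> deriv u x - a * (1 / x)" by simp
    moreover have "((\<lambda>x. u x - a * ln x) has_real_derivative deriv u x - a * (1 / x)) (at x)"
      using x by (auto intro!: derivative_eq_intros u_DERIV)
    ultimately show "\<exists>y. ((\<lambda>x. u x - a * ln x) has_real_derivative y) (at x) \<and> 0 \<le> y" by blast
  qed (use R in simp)
  also have "a * ln R = B - u 1 + a" using a by (simp add: R_def field_simps)
  also have "u R \<le> B" using R by (intro u_le) simp
  finally show False using a by simp
qed

lemma u_gap_ge:
  obtains a where "a > 0" "\<And>r. r \<ge> 1 \<Longrightarrow> a * r powr (2 - real n / real k) \<le> u_inf - u r"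
proof -
  obtain a where a: "a > 0" "\<And>r. r \<ge> 1 \<Longrightarrow> a * r powr (1 - real n / real k) \<le> deriv u r"
    using du_ge by blast
  define e where "e = real n / real k - 2"
  have e: "e > 0" using n_gt_2k k1 by (simp add: e_def pos_less_divide_eq)
  define h where "h x = u x + a / e * x powr (- e)" for x
  have hm: "h r \<le> h s" if "1 \<le> r" "r \<le> s" for r s
  proof (rule DERIV_nonneg_imp_nondecreasing[where f=h])
    fix x assume "r \<le> x" "x \<le> s"
    then have x: "x \<ge> 1" using that by simp
    have "(h has_real_derivative deriv u x - a * x powr (- e - 1)) (at x)"
      unfolding h_def[abs_def] using x e by (auto intro!: derivative_eq_intros u_DERIV)
    moreover have "0 \<le> deriv u x - a * x powr (- e - 1)"
      using a(2)[OF x] by (simp add: e_def)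
    ultimately show "\<exists>y. (h has_real_derivative y) (at x) \<and> 0 \<le> y" by blast
  qed (use that in simp)
  have "(h \<longlongrightarrow> u_inf + a / e * 0) at_top"
    unfolding h_def[abs_def] using e
    by (intro tendsto_intros u_tendsto tendsto_neg_powr filterlim_ident) auto
  then have lim: "(h \<longlongrightarrow> u_inf) at_top" by simp
  show ?thesis
  proof (rule that[of "a / e"])
    show "a / e > 0" using a e by simp
    fix r :: real assume r: "r \<ge> 1"
    have "\<forall>\<^sub>F s in at_top. h r \<le> h s"
      using eventually_ge_at_top[of r] by eventually_elim (use hm r in auto)
    then have "h r \<le> u_inf" by (intro tendsto_lowerbound[OF lim]) auto
    then show "a / e * r powr (2 - real n / real k) \<le> u_inf - u r"
      by (simp add: h_def e_def)
  qed
qed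

text \<open>A derivative is bounded by a difference of values further out: some \<open>z\<close>
  between \<open>2 * R\<close> and \<open>3 * R\<close> realises the mean slope there, and
  \<open>F s \<le> F z\<close> carries the bound back to \<open>s\<close>. The powers of 3 come from
  \<open>z \<le> 3 * s\<close>.\<close>

lemma du_le_gap:
  assumes R: "R > 0" and s: "s \<in> {R..2 * R}"
  shows "deriv u s \<le> 3 ^ n * ((u_inf - u R) / R)"
proof -
  have "\<exists>z. 2 * R < z \<and> z < 3 * R \<and> u (3 * R) - u (2 * R) = (3 * R - 2 * R) * deriv u z"
    by (rule MVT2) (use R in \<open>auto intro!: u_DERIV\<close>)
  then obtain z where z: "2 * R < z" "z < 3 * R" "u (3 * R) - u (2 * R) = R * deriv u z" by auto
  have s0: "s > 0" and z0: "z > 0" using s R z by auto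
  have "s ^ (n - k) * deriv u s ^ k \<le> z ^ (n - k) * deriv u z ^ k"
    using F_mono[of s z] s0 s z by (simp add: F_def)
  also have "\<dots> \<le> (3 * s) ^ (n - k) * deriv u z ^ k"
    using z s s0 z0 R du_nonneg[OF z0] by (intro mult_right_mono power_mono) auto
  also have "\<dots> = s ^ (n - k) * (3 ^ (n - k) * deriv u z ^ k)" by (simp add: power_mult_distrib)
  finally have "deriv u s ^ k \<le> 3 ^ (n - k) * deriv u z ^ k"
    using s0 by (simp add: mult_le_cancel_left_pos)
  also have "\<dots> \<le> (3 ^ n) ^ k * deriv u z ^ k"
  proof (rule mult_right_mono)
    have "n - k \<le> n * k" using k1 by (metis diff_le_self le_trans mult_le_mono2 mult.right_neutral One_nat_def)
    then have "(3::real) ^ (n - k) \<le> 3 ^ (n * k)" by (intro power_increasing) auto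
    then show "(3::real) ^ (n - k) \<le> (3 ^ n) ^ k" by (simp add: power_mult)
  qed (use du_nonneg[OF z0] in simp)
  also have "\<dots> = (3 ^ n * deriv u z) ^ k" by (simp add: power_mult_distrib)
  finally have "deriv u s \<le> 3 ^ n * deriv u z"
    using k1 du_nonneg[OF s0] du_nonneg[OF z0] by (simp add: power_mono_iff)
  also have "deriv u z = (u (3 * R) - u (2 * R)) / R" using z R by simp
  also have "\<dots> \<le> (u_inf - u R) / R"
    using u_le_inf[of "3 * R"] u_mono[of R "2 * R"] R by (intro divide_right_mono) auto
  finally show ?thesis by simp
qed

lemma rho_powr_antimono:
  assumes "0 < r" "r \<le> s"
  shows "rho s * s powr v_inf \<le> rho r * r powr v_inf"
proof (rule DERIV_nonpos_imp_nonincreasing[where f="\<lambda>x. rho x * x powr v_inf"])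
  fix x assume "r \<le> x" "x \<le> s"
  then have x: "x > 0" using assms by simp
  have "((\<lambda>x. rho x * x powr v_inf) has_real_derivative
      - v x * rho x / x * x powr v_inf + rho x * (v_inf * x powr (v_inf - 1))) (at x)"
    using x by (auto intro!: derivative_eq_intros rho_DERIV)
  moreover have "- v x * rho x / x * x powr v_inf + rho x * (v_inf * x powr (v_inf - 1)) =
      rho x * x powr v_inf / x * (v_inf - v x)"
    using x by (simp add: powr_diff field_simps)
  moreover have "\<dots> \<le> 0" using v_ge_inf[OF x] rho_pos[of x] x by (intro mult_nonneg_nonpos) auto
  ultimately show "\<exists>y. ((\<lambda>x. rho x * x powr v_inf) has_real_derivative y) (at x) \<and> y \<le> 0" by auto
qed (use assms in simp)

text \<open>\<open>rho s * s powr v_inf\<close> is nonincreasing; the absolute value in the constant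
  covers both signs of \<open>v_inf\<close>.\<close>

lemma rho_doubling:
  assumes "0 < R" "R \<le> s" "s \<le> 2 * R"
  shows "rho s \<le> 2 powr \<bar>v_inf\<bar> * rho R"
proof -
  have s: "s > 0" using assms by simp
  have "rho s \<le> rho R * (R powr v_inf / s powr v_inf)"
    using rho_powr_antimono[OF assms(1,2)] s by (simp add: field_simps)
  also have "R powr v_inf / s powr v_inf = (s / R) powr (- v_inf)"
    using s assms by (simp add: powr_divide powr_minus_divide)
  also have "\<dots> \<le> (s / R) powr \<bar>v_inf\<bar>" using assms by (intro powr_mono) auto
  also have "\<dots> \<le> 2 powr \<bar>v_inf\<bar>" using assms by (intro powr_mono2) (auto simp: pos_divide_le_eq)
  finally show ?thesis using rho_pos[of R] by (simp add: mult.commute mult_left_mono)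
qed

lemma m_le_gap:
  assumes R: "R > 0" and s: "s \<in> {R..2 * R}"
  shows "m s \<le> (2 powr \<bar>v_inf\<bar> * rho R)\<^sup>2 * ((2 * R) ^ (n - k) * (3 ^ n * ((u_inf - u R) / R)) ^ (k + 1))"
proof -
  have s0: "s > 0" using s R by simp
  have "m s = (rho s)\<^sup>2 * (s ^ (n - k) * deriv u s ^ (k + 1))"
    by (simp add: m_def F_def)
  also have "\<dots> \<le> (2 powr \<bar>v_inf\<bar> * rho R)\<^sup>2 * ((2 * R) ^ (n - k) * (3 ^ n * ((u_inf - u R) / R)) ^ (k + 1))"
    using rho_doubling[OF R, of s] du_le_gap[OF R s] s s0 R rho_pos[of s] du_nonneg[OF s0]
    by (intro mult_mono power_mono) auto
  finally show ?thesis .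
qed

text \<open>These constants make a cut-off that rises linearly on \<open>[t / 2, t]\<close> and equals \<open>1\<close> on \<open>[t, 1]\<close> have
  energy at most \<open>A * (t / 2) - E * e < 0\<close> on \<open>(0, 1]\<close>.\<close>

lemma negative_head:
  assumes D_nonneg: "\<And>r. r > 0 \<Longrightarrow> D r \<ge> 0"
  obtains t e A E where "0 < t" "t \<le> e" "2 * e < 1" "A \<ge> 0" "E > 0"
    "\<And>r. r \<in> {t / 2..t} \<Longrightarrow> m r * (2 / t)\<^sup>2 \<le> A" "\<And>r. r \<in> {e..2 * e} \<Longrightarrow> E \<le> m r * D r / r\<^sup>2"
    "A * (t / 2) < E * e"
proof -
  obtain b where b: "b > 0" "\<And>r. 0 < r \<Longrightarrow> r < b \<Longrightarrow> D r > 0"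
    using D_pos_near_0 by (auto simp: eventually_at_right_field)
  define e where "e = min (1 / 4) (b / 4)"
  have e: "0 < e" "2 * e < 1" "2 * e < b" using b by (auto simp: e_def)
  have cont: "continuous_on {e..2 * e} (\<lambda>r. m r * D r / r\<^sup>2)"
    using e by (intro continuous_intros continuous_facts) auto
  have "\<exists>x\<in>{e..2 * e}. \<forall>y\<in>{e..2 * e}. m x * D x / x\<^sup>2 \<le> m y * D y / y\<^sup>2"
    by (rule continuous_attains_inf[OF _ _ cont]) (use e in auto)
  then obtain x where x: "x \<in> {e..2 * e}" "\<And>y. y \<in> {e..2 * e} \<Longrightarrow> m x * D x / x\<^sup>2 \<le> m y * D y / y\<^sup>2"
    by blast
  define E where "E = m x * D x / x\<^sup>2"
  have E: "E > 0" using x(1) e m_pos[of x] b(2)[of x] by (simp add: E_def)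
  \<comment> \<open>The squared slope \<open>(2 / t)\<^sup>2\<close> contributes a factor 4. With
    the 4 here the ramp on \<open>{t / 2..t}\<close> costs at most \<open>E * e / 2\<close>, half of
    the gain \<open>E * e\<close> on \<open>{e..2 * e}\<close>.\<close>
  have "\<forall>\<^sub>F r in at_right 0. m r / r < E * e / 4"
    by (rule order_tendstoD(2)[OF m_over_r_tendsto_0]) (use E e in simp)
  then obtain d where d: "d > 0" "\<And>r. 0 < r \<Longrightarrow> r < d \<Longrightarrow> m r / r < E * e / 4"
    by (auto simp: eventually_at_right_field)
  define t where "t = min e (d / 2)"
  have t: "0 < t" "t \<le> e" "t < d" using d e by (auto simp: t_def)
  show ?thesis
  proof (rule that[of t e "E * e / t" E])
    show "m r * (2 / t)\<^sup>2 \<le> E * e / t" if r: "r \<in> {t / 2..t}" for r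
    proof -
      have r0: "r > 0" "r < d" using r t by auto
      then have "m r \<le> E * e / 4 * r" using d(2)[OF r0] by (simp add: pos_divide_less_eq)
      also have "\<dots> \<le> E * e / 4 * t" using r E e by (intro mult_left_mono) auto
      finally have "m r * (2 / t)\<^sup>2 \<le> E * e / 4 * t * (2 / t)\<^sup>2" by (rule mult_right_mono) simp
      also have "\<dots> = E * e / t" using t by (simp add: power2_eq_square)
      finally show ?thesis .
    qed
    show "E \<le> m r * D r / r\<^sup>2" if "r \<in> {e..2 * e}" for r using x(2)[OF that] by (simp add: E_def)
  qed (use t e E in auto)
qed

section \<open>Decay forced by stability\<close>

text \<open>The constant \<kappa> depends neither on \<open>R\<close> nor on \<open>L\<close> and
  \<open>q\<close>, because it comes from the head on (0, 1], common to all tests. Hence one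
  inequality serves both conclusions, with different rates \<open>q\<close>.\<close>

lemma decay:
  assumes D_nonneg: "\<And>r. r > 0 \<Longrightarrow> D r \<ge> 0"
  obtains \<kappa> where "\<kappa> > 0"
    "\<And>L q R. (\<And>r. r \<ge> 1 \<Longrightarrow> (L has_real_derivative q r / r) (at r)) \<Longrightarrow> continuous_on {1..} q \<Longrightarrow>
      L 1 = 0 \<Longrightarrow> (\<And>r. r \<ge> 1 \<Longrightarrow> (q r)\<^sup>2 \<le> D r) \<Longrightarrow> R \<ge> 1 \<Longrightarrow>
      \<kappa> * (exp (2 * L R) * R powr (2 * real k + 2 - real n) / (rho R)\<^sup>2) \<le> (u_inf - u R) ^ (k + 1)"
proof -
  obtain t e A E where te: "0 < t" "t \<le> e" "2 * e < 1" and A: "A \<ge> 0" and E: "E > 0"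
    and Am: "\<And>r. r \<in> {t / 2..t} \<Longrightarrow> m r * (2 / t)\<^sup>2 \<le> A"
    and Em: "\<And>r. r \<in> {e..2 * e} \<Longrightarrow> E \<le> m r * D r / r\<^sup>2"
    and AE: "A * (t / 2) < E * e"
    using negative_head[OF D_nonneg] by metis
  define \<kappa>0 where "\<kappa>0 = E * e - A * (t / 2)"
  have \<kappa>0: "\<kappa>0 > 0" using AE by (simp add: \<kappa>0_def)
  have test: "\<kappa>0 * R * exp (2 * L R) \<le> M"
    if L: "\<And>r. r \<ge> 1 \<Longrightarrow> (L has_real_derivative q r / r) (at r)" and q: "continuous_on {1..} q"
      and L1: "L 1 = 0" and qD: "\<And>r. r \<ge> 1 \<Longrightarrow> (q r)\<^sup>2 \<le> D r" and R: "R \<ge> 1"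
      and M: "\<And>s. s \<in> {R..2 * R} \<Longrightarrow> m s \<le> M"
    for L q R M
  proof -
    \<comment> \<open>A product of three clamped factors: a ramp from 0 at \<open>t / 2\<close> to 1
      at \<open>t\<close>, the exponential frozen outside \<open>{1..R}\<close>, and a ramp from 1
      at \<open>R\<close> to 0 at \<open>2 * R\<close>. Clamping makes continuity immediate;
      \<open>p0\<close> to \<open>p5\<close> recover the pieces.\<close>
    define \<eta> where "\<eta> r = max 0 (min 1 (2 / t * r - 1)) * exp (- L (max 1 (min r R))) * max 0 (min 1 (2 - r / R))" for r
    define \<eta>' where "\<eta>' r = (if r < t / 2 then 0 else if r < t then 2 / t else if r < 1 then 0
      else if r < R then exp (- L r) * (- (q r / r)) else if r < 2 * R then exp (- L R) * (- (1 / R)) else 0)" for r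
    have p0: "\<eta> r = 0" if "r < t / 2" for r
      using that te by (simp add: \<eta>_def max_def min_def field_simps)
    have p1: "\<eta> r = 2 / t * r - 1" if "t / 2 \<le> r" "r < t" for r
    proof -
      have "2 / t * r - 1 \<ge> 0" "2 / t * r - 1 \<le> 1" "r / R \<le> 1" "r \<le> R" "r \<le> 1"
        using that te R by (auto simp: field_simps)
      then show ?thesis by (simp add: \<eta>_def L1)
    qed
    have p2: "\<eta> r = 1" if "t \<le> r" "r < 1" for r
    proof -
      have "2 / t * r - 1 \<ge> 1" "r / R \<le> 1" "r \<le> R" "r \<le> 1"
        using that te R by (auto simp: field_simps)
      then show ?thesis by (simp add: \<eta>_def L1)
    qed
    have p3: "\<eta> r = exp (- L r)" if "1 \<le> r" "r < R" for r
    proof -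
      have "2 / t * r - 1 \<ge> 1" "r / R \<le> 1" "r \<le> R" "r \<ge> 1"
        using that te R by (auto simp: field_simps)
      then show ?thesis by (simp add: \<eta>_def)
    qed
    have p4: "\<eta> r = exp (- L R) * (2 - r / R)" if "R \<le> r" "r < 2 * R" for r
    proof -
      have "2 / t * r - 1 \<ge> 1" "r / R \<ge> 1" "r / R \<le> 2"
        using that te R by (auto simp: field_simps)
      then show ?thesis using that R by (simp add: \<eta>_def)
    qed
    have p5: "\<eta> r = 0" if "2 * R \<le> r" for r
    proof -
      have "r / R \<ge> 2" using that R by (simp add: pos_le_divide_eq)
      then show ?thesis by (simp add: \<eta>_def)
    qed
    have contL: "continuous_on {1..R} L"
      by (rule DERIV_continuous_on[where D="\<lambda>r. q r / r"])
        (use L in \<open>auto intro: has_field_derivative_at_within\<close>)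
    have cont: "continuous_on UNIV \<eta>"
    proof -
      have "continuous_on UNIV (\<lambda>r. L (max 1 (min r R)))"
        by (rule continuous_on_compose2[OF contL]) (use R in \<open>auto intro!: continuous_intros\<close>)
      then show ?thesis unfolding \<eta>_def[abs_def] using te R by (intro continuous_intros) auto
    qed
    have right: "(\<eta> has_real_derivative \<eta>' r) (at r within {r<..})" for r
    proof -
      consider "r < t / 2" | "t / 2 \<le> r" "r < t" | "t \<le> r" "r < 1" | "1 \<le> r" "r < R" | "R \<le> r" "r < 2 * R"
        | "2 * R \<le> r" by linarith
      then show ?thesis
      proof cases
        case 1
        have "((\<lambda>_. 0) has_real_derivative 0) (at r)" by simp
        then have "(\<eta> has_real_derivative 0) (at r within {r<..})"
          by (rule has_field_derivative_right_if_eq[OF _ 1]) (use p0 in simp)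
        then show ?thesis using 1 by (simp add: \<eta>'_def)
      next
        case 2
        have "((\<lambda>r. 2 / t * r - 1) has_real_derivative 2 / t) (at r)"
          using te by (auto intro!: derivative_eq_intros)
        then have "(\<eta> has_real_derivative 2 / t) (at r within {r<..})"
          by (rule has_field_derivative_right_if_eq[OF _ 2(2)]) (use p1 2 in simp)
        then show ?thesis using 2 by (simp add: \<eta>'_def)
      next
        case 3
        have "((\<lambda>_. 1) has_real_derivative 0) (at r)" by simp
        then have "(\<eta> has_real_derivative 0) (at r within {r<..})"
          by (rule has_field_derivative_right_if_eq[OF _ 3(2)]) (use p2 3 in simp)
        then show ?thesis using 3 te by (simp add: \<eta>'_def)
      next
        case 4
        have "((\<lambda>r. exp (- L r)) has_real_derivative exp (- L r) * (- (q r / r))) (at r)"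
          by (rule DERIV_fun_exp[OF DERIV_minus[OF L[OF 4(1)]]])
        then have "(\<eta> has_real_derivative exp (- L r) * (- (q r / r))) (at r within {r<..})"
          by (rule has_field_derivative_right_if_eq[OF _ 4(2)]) (use p3 4 in simp)
        then show ?thesis using 4 te by (simp add: \<eta>'_def)
      next
        case 5
        have "((\<lambda>r. exp (- L R) * (2 - r / R)) has_real_derivative exp (- L R) * (- (1 / R))) (at r)"
          using R by (auto intro!: derivative_eq_intros)
        then have "(\<eta> has_real_derivative exp (- L R) * (- (1 / R))) (at r within {r<..})"
          by (rule has_field_derivative_right_if_eq[OF _ 5(2)]) (use p4 5 in simp)
        then show ?thesis using 5 te R by (simp add: \<eta>'_def)
      next
        case 6
        have "((\<lambda>_. 0) has_real_derivative 0) (at r)" by simp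
        then have "(\<eta> has_real_derivative 0) (at r within {r<..})"
          by (rule has_field_derivative_right_if_eq[of _ _ _ "r + 1"]) (use p5 6 in simp_all)
        then show ?thesis using 6 te R by (simp add: \<eta>'_def)
      qed
    qed
    have "continuous_on {1..R} (\<lambda>r. exp (- L r) * (- (q r / r)))"
      by (intro continuous_intros contL continuous_on_subset[OF q]) auto
    then have "bounded ((\<lambda>r. exp (- L r) * (- (q r / r))) ` {1..R})"
      by (intro compact_imp_bounded compact_continuous_image) auto
    then obtain K where "\<forall>x\<in>(\<lambda>r. exp (- L r) * (- (q r / r))) ` {1..R}. norm x \<le> K"
      unfolding bounded_iff by blast
    then have K: "\<bar>exp (- L r) * (- (q r / r))\<bar> \<le> K" if "r \<in> {1..R}" for r
      using that by force
    have K0: "K \<ge> 0" using K[of 1] R by (intro order_trans[OF abs_ge_zero]) auto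
    have bound: "\<bar>\<eta>' r\<bar> \<le> 2 / t + K + exp (- L R) * (1 / R)" for r
    proof -
      have nn: "2 / t \<ge> 0" "exp (- L R) * (1 / R) \<ge> 0" using te R by auto
      have "\<eta>' r = 0 \<or> \<eta>' r = 2 / t \<or> r \<in> {1..R} \<and> \<eta>' r = exp (- L r) * (- (q r / r))
          \<or> \<eta>' r = - (exp (- L R) * (1 / R))"
        unfolding \<eta>'_def by auto
      then show ?thesis
      proof (elim disjE conjE)
        assume "r \<in> {1..R}" "\<eta>' r = exp (- L r) * (- (q r / r))"
        then have "\<bar>\<eta>' r\<bar> \<le> K" using K by simp
        then show ?thesis using nn by linarith
      qed (use nn K0 in linarith)+
    qed
    define en where "en r = m r * ((\<eta>' r)\<^sup>2 - D r * (\<eta> r)\<^sup>2 / r\<^sup>2)" for r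
    let ?I = "{t / 2 / 2..2 * R + 1}"
    have supp: "\<eta> r = 0" if "r \<notin> {t / 2..2 * R}" for r
      using that p0[of r] p5[of r] by (cases "r < t / 2") auto
    have t2: "0 < t / 2" "t / 2 < 2 * R" using te R by auto
    have en: "en integrable_on ?I" "integral ?I en \<ge> 0"
      using energy_lipschitz[OF t2 supp cont right bound] by (simp_all add: en_def[abs_def])
    define C where "C = M * (exp (- L R) * (1 / R))\<^sup>2"
    have M0: "M \<ge> 0" using M[of R] m_pos[of R] R by simp
    have C0: "C \<ge> 0" using M0 by (simp add: C_def)
    \<comment> \<open>Step functions dominating the energy density: cost \<open>A\<close> on the
      first ramp, gain \<open>E\<close> on \<open>{e..2 * e}\<close>, cost \<open>C\<close> on the
      last ramp. Everywhere else the density is nonpositive.\<close>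
    define st where "st p z c = (\<lambda>r::real. if r \<in> {p..z} then c else (0::real))" for p z c
    have st: "(st p z c has_integral c * (z - p)) ?I" if "{p..z} \<subseteq> ?I" "p \<le> z" for p z c
    proof -
      have "((\<lambda>r. c) has_integral c * (z - p)) {p..z}"
        using has_integral_const_real[of c p z] that(2) by (simp add: mult.commute)
      then show ?thesis unfolding st_def by (subst has_integral_restrict[OF that(1)])
    qed
    have le: "en r \<le> st (t / 2) t A r - st e (2 * e) E r + st R (2 * R) C r" if r: "r \<in> ?I" for r
    proof -
      have r0: "r > 0" using r te by auto
      note m0 = m_pos[OF r0] and D0 = D_nonneg[OF r0]
      have DE: "m r * (D r * X\<^sup>2 / r\<^sup>2) \<ge> 0" for X using m0 D0 by simp
      have sA: "st (t / 2) t A r \<ge> 0" and sC: "st R (2 * R) C r \<ge> 0" using A C0 by (auto simp: st_def)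
      consider "r < t / 2" | "t / 2 \<le> r" "r < t" | "t \<le> r" "r < 1" | "1 \<le> r" "r < R" | "R \<le> r" "r < 2 * R"
        | "2 * R \<le> r" by linarith
      then show ?thesis
      proof cases
        case 1
        then show ?thesis using te sA sC p0[OF 1] by (simp add: en_def \<eta>'_def st_def)
      next
        case 2
        then have "en r = m r * (2 / t)\<^sup>2 - m r * (D r * (\<eta> r)\<^sup>2 / r\<^sup>2)"
          by (simp add: en_def \<eta>'_def right_diff_distrib)
        also have "\<dots> \<le> A" using Am[of r] DE[of "\<eta> r"] 2 by simp
        finally show ?thesis using 2 te sC by (simp add: st_def)
      next
        case 3
        then have "en r = - (m r * D r / r\<^sup>2)"
          using te by (simp add: en_def \<eta>'_def p2)
        moreover have "- (m r * D r / r\<^sup>2) \<le> - st e (2 * e) E r"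
          using Em[of r] DE[of 1] by (simp add: st_def)
        ultimately show ?thesis using sA sC by linarith
      next
        case 4
        have "(\<eta>' r)\<^sup>2 = (q r)\<^sup>2 * (exp (- L r))\<^sup>2 / r\<^sup>2"
          using 4 te by (simp add: \<eta>'_def power_mult_distrib power_divide mult.commute)
        also have "\<dots> \<le> D r * (exp (- L r))\<^sup>2 / r\<^sup>2"
          using qD[OF 4(1)] by (intro divide_right_mono mult_right_mono) auto
        finally have "(\<eta>' r)\<^sup>2 - D r * (\<eta> r)\<^sup>2 / r\<^sup>2 \<le> 0" using p3[OF 4] by simp
        then have "en r \<le> 0" using m0 by (simp add: en_def mult_nonneg_nonpos)
        then show ?thesis using 4 te sA sC by (simp add: st_def)
      next
        case 5
        then have "en r = m r * (exp (- L R) * (- (1 / R)))\<^sup>2 - m r * (D r * (\<eta> r)\<^sup>2 / r\<^sup>2)"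
          using te R by (simp add: en_def \<eta>'_def right_diff_distrib)
        also have "\<dots> \<le> m r * (exp (- L R) * (1 / R))\<^sup>2" using DE[of "\<eta> r"] by (simp add: power_mult_distrib)
        also have "\<dots> \<le> C" unfolding C_def using M[of r] 5 by (intro mult_right_mono) auto
        finally show ?thesis using 5 te R sA by (simp add: st_def)
      next
        case 6
        then show ?thesis using te R sA sC p5[OF 6] by (simp add: en_def \<eta>'_def st_def)
      qed
    qed
    have "((\<lambda>r. st (t / 2) t A r - st e (2 * e) E r + st R (2 * R) C r) has_integral
        A * (t - t / 2) - E * (2 * e - e) + C * (2 * R - R)) ?I"
      by (intro has_integral_add has_integral_diff st) (use te R in auto)
    from has_integral_le[OF integrable_integral[OF en(1)] this le] en(2)
    have "\<kappa>0 \<le> C * R" by (simp add: \<kappa>0_def)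
    also have "C * R = M * (exp (- L R))\<^sup>2 / R"
      using R by (simp add: C_def power_mult_distrib power_divide power2_eq_square)
    also have "(exp (- L R))\<^sup>2 = 1 / exp (2 * L R)"
      by (simp add: exp_minus inverse_eq_divide power_divide flip: exp_double)
    finally show ?thesis using R by (simp add: field_simps)
  qed
  define K where "K = (2 powr \<bar>v_inf\<bar>)\<^sup>2 * 2 ^ (n - k) * (3 ^ n) ^ (k + 1)"
  have K: "K > 0" by (simp add: K_def)
  show ?thesis
  proof (rule that[of "\<kappa>0 / K"])
    show "\<kappa>0 / K > 0" using K \<kappa>0 by simp
    fix L q R
    assume L: "\<And>r. r \<ge> 1 \<Longrightarrow> (L has_real_derivative q r / r) (at r)" and q: "continuous_on {1..} q"
      and L1: "L 1 = 0" and qD: "\<And>r. r \<ge> 1 \<Longrightarrow> (q r)\<^sup>2 \<le> D r" and R: "(R::real) \<ge> 1"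
    let ?y = "(u_inf - u R) ^ (k + 1)"
    have R0: "R > 0" using R by simp
    have "\<kappa>0 * R * exp (2 * L R) \<le>
        (2 powr \<bar>v_inf\<bar> * rho R)\<^sup>2 * ((2 * R) ^ (n - k) * (3 ^ n * ((u_inf - u R) / R)) ^ (k + 1))"
      by (rule test[OF L q L1 qD R m_le_gap[OF R0]])
    also have "\<dots> = K * ((rho R)\<^sup>2 * (R ^ (n - k) / R ^ (k + 1)) * ?y)"
      by (simp add: K_def power_mult_distrib power_divide)
    finally have main: "\<kappa>0 * (R * exp (2 * L R)) \<le> K * ((rho R)\<^sup>2 * (R ^ (n - k) / R ^ (k + 1)) * ?y)" by simp
    have p: "R powr (2 * real k + 2 - real n) = R * R ^ (k + 1) / R ^ (n - k)"
    proof -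
      have "R * R ^ (k + 1) / R ^ (n - k) = R powr (real (k + 2)) / R powr (real (n - k))"
        unfolding powr_realpow[OF R0] by simp
      also have "\<dots> = R powr (real (k + 2) - real (n - k))" by (simp add: powr_diff)
      also have "real (k + 2) - real (n - k) = 2 * real k + 2 - real n" using kn by (simp add: of_nat_diff)
      finally show ?thesis by simp
    qed
    have pos: "0 < R ^ (k + 1) / R ^ (n - k) / (rho R)\<^sup>2" using R0 rho_pos[of R] by simp
    have "\<kappa>0 / K * (exp (2 * L R) * R powr (2 * real k + 2 - real n) / (rho R)\<^sup>2)
        = \<kappa>0 * (R * exp (2 * L R)) * (R ^ (k + 1) / R ^ (n - k) / (rho R)\<^sup>2) / K"
      unfolding p by (simp add: mult_ac)
    also have "\<dots> \<le> K * ((rho R)\<^sup>2 * (R ^ (n - k) / R ^ (k + 1)) * ?y) * (R ^ (k + 1) / R ^ (n - k) / (rho R)\<^sup>2) / K"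
      using main pos K by (intro divide_right_mono mult_right_mono) auto
    also have "\<dots> = ?y"
    proof -
      have c: "(K * (a * (b / d) * y)) * (d / b / a) / K = y" if "K > 0" "a > 0" "b > 0" "d > 0" for K a b d y :: real
        using that by (simp add: field_simps)
      show ?thesis by (rule c) (use K R0 rho_pos[of R] in auto)
    qed
    finally show "\<kappa>0 / K * (exp (2 * L R) * R powr (2 * real k + 2 - real n) / (rho R)\<^sup>2) \<le> ?y" .
  qed
qed

section \<open>The two conclusions\<close>

text \<open>Starting the integral at \<open>1 / 2\<close> makes 1 an interior point, so the
  derivative there is two-sided. As \<open>sqrt\<close> is odd and continuous, \<open>Phi\<close> is
  differentiable even where the radicand is negative.\<close>

definition Phi where
  "Phi r = integral {1 / 2..r} (\<lambda>s. sqrt (D s) / s) - integral {1 / 2..1} (\<lambda>s. sqrt (D s) / s)"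

lemma Phi_1: "Phi 1 = 0"
  by (simp add: Phi_def)

lemma Phi_DERIV:
  assumes "r > 1 / 2"
  shows "(Phi has_real_derivative sqrt (D r) / r) (at r)"
proof -
  have "continuous_on {1 / 2..r + 1} (\<lambda>s. sqrt (D s) / s)"
    by (intro continuous_intros continuous_facts) auto
  then have "((\<lambda>r. integral {1 / 2..r} (\<lambda>s. sqrt (D s) / s)) has_real_derivative sqrt (D r) / r)
      (at r within {1 / 2..r + 1})"
    by (rule integral_has_real_derivative) (use assms in simp)
  then have "((\<lambda>r. integral {1 / 2..r} (\<lambda>s. sqrt (D s) / s)) has_real_derivative sqrt (D r) / r) (at r)"
    using assms by (simp add: at_within_Icc_at)
  from DERIV_diff[OF this DERIV_const] show ?thesis unfolding Phi_def[abs_def] by simp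
qed

text \<open>The term \<open>v s / s\<close> integrates to \<open>- ln (rho r) + ln (rho 1)\<close>,
  so \<open>alpha * ln r\<close> is explicit. The power \<open>k + 1\<close> clears the denominator
  of \<open>delta\<close> and produces the left-hand side of \<open>decay\<close> up to
  constants.\<close>

lemma powr_delta:
  assumes r: "r \<ge> 1"
  shows "(r powr delta n k w r) ^ (k + 1) =
    r powr (2 * real k + 2 - real n) * exp (2 * (Phi r - ln (rho r) + ln (rho 1)))"
\<comment> \<open>At \<open>r = 1\<close> both sides are 1, whatever value \<open>alpha\<close>
  takes there.\<close>
proof (cases "r = 1")
  case True
  then show ?thesis by (simp add: Phi_1)
next
  case False
  then have r1: "r > 1" and lr: "ln r > 0" using r by auto
  have "((\<lambda>s. (v s + sqrt (D s)) / s) has_integral (Phi r - ln (rho r)) - (Phi 1 - ln (rho 1))) {1..r}"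
  proof (rule fundamental_theorem_of_calculus[OF r])
    fix s assume "s \<in> {1..r}"
    then have s: "s > 1 / 2" "s > 0" by auto
    have "((\<lambda>s. Phi s - ln (rho s)) has_real_derivative sqrt (D s) / s - (1 / rho s) * (- v s * rho s / s)) (at s)"
      using rho_pos[of s] by (intro DERIV_diff Phi_DERIV s DERIV_chain2[OF DERIV_ln_divide rho_DERIV])
    moreover have "sqrt (D s) / s - (1 / rho s) * (- v s * rho s / s) = (v s + sqrt (D s)) / s"
      using rho_pos[of s] by (simp add: add_divide_distrib)
    ultimately have "((\<lambda>s. Phi s - ln (rho s)) has_real_derivative (v s + sqrt (D s)) / s) (at s)" by simp
    then show "((\<lambda>s. Phi s - ln (rho s)) has_vector_derivative (v s + sqrt (D s)) / s) (at s within {1..r})"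
      by (simp add: has_field_derivative_at_within flip: has_real_derivative_iff_has_vector_derivative)
  qed
  then have int: "integral {1..r} (\<lambda>s. (v s + sqrt (D s)) / s) = Phi r - ln (rho r) + ln (rho 1)"
    by (simp add: integral_unique Phi_1)
  have al: "alpha n k w r * ln r = Phi r - ln (rho r) + ln (rho 1)"
    using r1 lr by (simp add: alpha_def alpha_quotient_def int)
  have "(r powr delta n k w r) ^ (k + 1) = exp (real (k + 1) * (delta n k w r * ln r))"
    unfolding exp_of_nat_mult using r by (simp add: powr_def)
  also have "real (k + 1) * (delta n k w r * ln r) = (2 * real k + 2 - real n) * ln r + 2 * (alpha n k w r * ln r)"
  proof -
    have "real (k + 1) * delta n k w r = - real n + 2 * alpha n k w r + 2 * real k + 2"
      by (simp add: delta_def add.commute)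
    then have "real (k + 1) * delta n k w r * ln r = (- real n + 2 * alpha n k w r + 2 * real k + 2) * ln r"
      by (rule arg_cong)
    then show ?thesis by (simp add: algebra_simps)
  qed
  also have "exp \<dots> = r powr (2 * real k + 2 - real n) * exp (2 * (Phi r - ln (rho r) + ln (rho 1)))"
  proof -
    have "r powr (2 * real k + 2 - real n) = exp ((2 * real k + 2 - real n) * ln r)"
    proof -
      have "r \<noteq> 0" using r by simp
      then show ?thesis by (simp only: powr_def if_False)
    qed
    then show ?thesis unfolding al exp_add by (simp only:)
  qed
  finally show ?thesis .
qed

lemma exp_ln_rho: "exp (2 * (x - ln (rho r) + ln (rho 1))) = (rho 1)\<^sup>2 * (exp (2 * x) / (rho r)\<^sup>2)"
proof -
  have "exp (2 * (x - ln (rho r) + ln (rho 1))) = exp (2 * x - 2 * ln (rho r) + 2 * ln (rho 1))"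
    by (simp add: algebra_simps)
  also have "\<dots> = exp (2 * x) / exp (2 * ln (rho r)) * exp (2 * ln (rho 1))"
    by (simp only: exp_add exp_diff)
  also have "exp (2 * ln (rho r)) = (rho r)\<^sup>2"
    using rho_pos[of r] by (simp add: exp_double)
  also have "exp (2 * ln (rho 1)) = (rho 1)\<^sup>2"
    using rho_pos[of 1] by (simp add: exp_double)
  finally show ?thesis by (simp only: times_divide_eq_left times_divide_eq_right mult.commute)
qed

section \<open>The dimension bound\<close>

lemma n_div_k_gt: "real n / real k - 2 > 0"
  using n_gt_2k k1 by (simp add: pos_less_divide_eq)

text \<open>If \<open>v_inf \<le> -1\<close>, then \<open>\<gamma> / k \<le> -2\<close> and the
  claim is weaker than \<open>n > 2 k\<close>. Otherwise the radicand has the positive constant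
  lower bound \<open>d\<close>, and \<open>decay\<close> is used with the constant rate
  \<open>sqrt d\<close>.\<close>

lemma dimension_bound: "real n > 2 * (real k + 2 * \<gamma> / real k + 4)"
proof (cases "v_inf \<le> - 1")
  case True
  then have "real k - 1 + \<gamma> \<le> - 1 * (real k + 1)"
    unfolding v_inf_def by (subst (asm) pos_divide_le_eq) auto
  then have "\<gamma> / real k \<le> - 2" using k1 by (simp add: pos_divide_le_eq)
  then have "2 * \<gamma> / real k \<le> - 4" by simp
  then show ?thesis using n_gt_2k by simp
next
  case False
  define x where "x = v_inf + 1"
  define N where "N = real n - 2 * real k"
  define d where "d = x * (x + N / real k)"
  have k0: "real k > 0" using k1 by simp
  have x: "x > 0" using False by (simp add: x_def)
  have N: "N > 0" using n_gt_2k by (simp add: N_def)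
  have d: "d > 0" using x N k0 by (simp add: d_def add_pos_pos)
  have Dd: "d \<le> D r" if "r > 0" for r
  proof -
    have "N / real k = real n / real k - 2" using k0 by (simp add: N_def diff_divide_distrib)
    then have "d \<le> (v r + 1) * (v r + real n / real k - 1)"
      unfolding d_def using v_ge_inf[OF that] x n_div_k_gt
      by (intro mult_mono) (auto simp: x_def)
    then show ?thesis using D_ge[OF that] by linarith
  qed
  then have D0: "D r \<ge> 0" if "r > 0" for r using d that by force
  obtain \<kappa> where \<kappa>: "\<kappa> > 0" and dec: "\<And>L q R. (\<And>r. r \<ge> 1 \<Longrightarrow> (L has_real_derivative q r / r) (at r)) \<Longrightarrow>
      continuous_on {1..} q \<Longrightarrow> L 1 = 0 \<Longrightarrow> (\<And>r. r \<ge> 1 \<Longrightarrow> (q r)\<^sup>2 \<le> D r) \<Longrightarrow> R \<ge> 1 \<Longrightarrow>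
      \<kappa> * (exp (2 * L R) * R powr (2 * real k + 2 - real n) / (rho R)\<^sup>2) \<le> (u_inf - u R) ^ (k + 1)"
    using decay[OF D0] by metis
  define s where "s = sqrt d"
  have s: "s > 0" "s\<^sup>2 = d" using d by (auto simp: s_def)
  \<comment> \<open>The growth exponent of a lower bound for the power \<open>k + 1\<close> of the
    gap: \<open>2 * s\<close> from the test function, \<open>2 * v_inf\<close> from
    \<open>1 / (rho R)\<^sup>2\<close>, the rest from \<open>decay\<close>. It must be negative
    because the gap tends to 0.\<close>
  define p where "p = 2 * s + 2 * v_inf + (2 * real k + 2 - real n)"
  have low: "\<kappa> / (rho 1)\<^sup>2 * R powr p \<le> (u_inf - u R) ^ (k + 1)" if R: "R \<ge> 1" for R
  proof -
    have R0: "R > 0" using R by simp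
    have "rho R * R powr v_inf \<le> rho 1" using rho_powr_antimono[of 1 R] R by simp
    then have "(rho R)\<^sup>2 * R powr (2 * v_inf) \<le> (rho 1)\<^sup>2"
      using rho_pos[of R] power_mono[of "rho R * R powr v_inf" "rho 1" 2] R0
      by (simp add: power_mult_distrib powr_power mult.commute)
    then have rr: "R powr (2 * v_inf) / (rho 1)\<^sup>2 \<le> 1 / (rho R)\<^sup>2"
      using rho_pos[of R] rho_pos[of 1] by (simp add: field_simps)
    have "\<kappa> / (rho 1)\<^sup>2 * R powr p =
        \<kappa> * (R powr (2 * s) * R powr (2 * real k + 2 - real n) * (R powr (2 * v_inf) / (rho 1)\<^sup>2))"
      by (simp add: p_def powr_add)
    also have "\<dots> \<le> \<kappa> * (R powr (2 * s) * R powr (2 * real k + 2 - real n) * (1 / (rho R)\<^sup>2))"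
      using rr \<kappa> by (intro mult_left_mono) auto
    also have "\<dots> = \<kappa> * (exp (2 * (s * ln R)) * R powr (2 * real k + 2 - real n) / (rho R)\<^sup>2)"
      using R0 by (simp add: powr_def)
    also have "\<dots> \<le> (u_inf - u R) ^ (k + 1)"
    proof (rule dec[where L="\<lambda>r. s * ln r" and q="\<lambda>_. s"])
      show "((\<lambda>r. s * ln r) has_real_derivative s / r) (at r)" if "r \<ge> 1" for r :: real
        using that by (auto intro!: derivative_eq_intros)
      show "s\<^sup>2 \<le> D r" if "r \<ge> 1" for r using Dd[of r] that s by simp
    qed (use R in \<open>auto intro: continuous_intros\<close>)
    finally show ?thesis .
  qed
  have "p < 0"
  proof (rule ccontr)
    assume "\<not> p < 0"
    then have "\<kappa> / (rho 1)\<^sup>2 \<le> (u_inf - u R) ^ (k + 1)" if "R \<ge> 1" for R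
    proof -
      have "\<kappa> / (rho 1)\<^sup>2 * 1 \<le> \<kappa> / (rho 1)\<^sup>2 * R powr p"
        using \<open>\<not> p < 0\<close> that \<kappa> by (intro mult_left_mono ge_one_powr_ge_zero) auto
      then show ?thesis using low[OF that] by simp
    qed
    then have "\<forall>\<^sub>F R in at_top. \<kappa> / (rho 1)\<^sup>2 \<le> (u_inf - u R) ^ (k + 1)"
      by (rule eventually_mono[OF eventually_ge_at_top[of 1]])
    moreover have "((\<lambda>R. (u_inf - u R) ^ (k + 1)) \<longlongrightarrow> (u_inf - u_inf) ^ (k + 1)) at_top"
      by (intro tendsto_intros u_tendsto)
    ultimately have "\<kappa> / (rho 1)\<^sup>2 \<le> (u_inf - u_inf) ^ (k + 1)"
      by (intro tendsto_lowerbound) auto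
    moreover have "\<kappa> / (rho 1)\<^sup>2 > 0" using \<kappa> rho_pos[of 1] by simp
    ultimately show False by simp
  qed
  then have "2 * s < N - 2 * x" by (simp add: p_def N_def x_def)
  then have "(2 * s)\<^sup>2 < (N - 2 * x)\<^sup>2" using s by (intro power_strict_mono) auto
  moreover have "(2 * s)\<^sup>2 = 4 * (x * x) + N * (4 * x / real k)"
  proof -
    have "(2 * s)\<^sup>2 = 4 * d" using s by (simp add: power_mult_distrib)
    then show ?thesis by (simp add: d_def algebra_simps)
  qed
  moreover have "(N - 2 * x)\<^sup>2 = N * (N - 4 * x) + 4 * (x * x)"
    by (simp add: power2_eq_square algebra_simps)
  ultimately have "N * (4 * x / real k) < N * (N - 4 * x)" by linarith
  then have lt: "4 * x / real k < N - 4 * x" using N by (simp only: mult_less_cancel_left_pos)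
  have "x * (real k + 1) = 2 * real k + \<gamma>"
  proof -
    have "v_inf * (real k + 1) = real k - 1 + \<gamma>" using k0 by (simp add: v_inf_def)
    then show ?thesis by (simp add: x_def algebra_simps)
  qed
  then have "4 * x / real k + 4 * x = 4 * (2 * real k + \<gamma>) / real k"
    using k0 by (simp add: field_simps)
  also have "\<dots> = 8 + 4 * \<gamma> / real k" using k0 by (simp add: field_simps)
  finally have "8 + 4 * \<gamma> / real k < N" using lt by linarith
  then show ?thesis by (simp add: N_def)
qed

section \<open>The lower bound for the gap to the limit\<close>

lemma gap_bound_from_power:
  assumes "C > 0" and "\<And>r. r \<in> S \<Longrightarrow> r \<ge> 1 \<Longrightarrow> C * (r powr delta n k w r) ^ (k + 1) \<le> (u_inf - u r) ^ (k + 1)"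
  shows "\<exists>M>0. \<forall>r\<ge>1. r \<in> S \<longrightarrow> M * r powr delta n k w r \<le> u_inf - u r"
proof (intro exI conjI allI impI)
  let ?M = "C powr (1 / real (k + 1))"
  show "?M > 0" using assms(1) by simp
  fix r :: real assume r: "r \<ge> 1" "r \<in> S"
  have "?M ^ (k + 1) = C powr (1 / real (k + 1) * real (k + 1))"
    using assms(1) by (subst powr_power) (auto simp: mult.commute)
  then have "?M ^ (k + 1) = C" using assms(1) by simp
  then have "(?M * r powr delta n k w r) ^ (k + 1) \<le> (u_inf - u r) ^ (k + 1)"
    using assms(2)[OF r(2,1)] by (simp only: power_mult_distrib)
  then show "?M * r powr delta n k w r \<le> u_inf - u r"
    using u_le_inf[of r] r power_le_imp_le_base[of "?M * r powr delta n k w r" k "u_inf - u r"] by simp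
qed

text \<open>Here \<open>v \<ge> -1\<close> throughout, so the radicand is nonnegative and
  \<open>q = sqrt D\<close>, the largest rate allowed in \<open>decay\<close>, is available. By
  \<open>powr_delta\<close> it gives exactly the exponent \<open>delta\<close>.\<close>

lemma gap_bound_regular:
  assumes "v_inf \<ge> - 1"
  shows "\<exists>M>0. \<forall>r\<ge>1. M * r powr delta n k w r \<le> u_inf - u r"
proof -
  have D0: "D r \<ge> 0" if r: "r > 0" for r
  proof -
    have "0 \<le> (v r + 1) * (v r + real n / real k - 1)"
      using v_ge_inf[OF r] assms n_div_k_gt by (intro mult_nonneg_nonneg) auto
    then show ?thesis using D_ge[OF r] by linarith
  qed
  obtain \<kappa> where \<kappa>: "\<kappa> > 0" and dec: "\<And>L q R. (\<And>r. r \<ge> 1 \<Longrightarrow> (L has_real_derivative q r / r) (at r)) \<Longrightarrow>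
      continuous_on {1..} q \<Longrightarrow> L 1 = 0 \<Longrightarrow> (\<And>r. r \<ge> 1 \<Longrightarrow> (q r)\<^sup>2 \<le> D r) \<Longrightarrow> R \<ge> 1 \<Longrightarrow>
      \<kappa> * (exp (2 * L R) * R powr (2 * real k + 2 - real n) / (rho R)\<^sup>2) \<le> (u_inf - u R) ^ (k + 1)"
    using decay[OF D0] by metis
  have "\<exists>M>0. \<forall>r\<ge>1. r \<in> UNIV \<longrightarrow> M * r powr delta n k w r \<le> u_inf - u r"
  proof (rule gap_bound_from_power)
    show "\<kappa> / (rho 1)\<^sup>2 > 0" using \<kappa> rho_pos[of 1] by simp
    fix r :: real assume r: "r \<ge> 1"
    have "\<kappa> / (rho 1)\<^sup>2 * (r powr delta n k w r) ^ (k + 1)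
        = \<kappa> * (exp (2 * Phi r) * r powr (2 * real k + 2 - real n) / (rho r)\<^sup>2)"
      unfolding powr_delta[OF r] exp_ln_rho using rho_pos[of 1] by simp
    also have "\<dots> \<le> (u_inf - u r) ^ (k + 1)"
    proof (rule dec[where q="\<lambda>r. sqrt (D r)"])
      show "(Phi has_real_derivative sqrt (D r) / r) (at r)" if "r \<ge> 1" for r
        using that by (intro Phi_DERIV) simp
      show "continuous_on {1..} (\<lambda>r. sqrt (D r))"
        by (intro continuous_intros continuous_facts) auto
    qed (use r D0 Phi_1 in auto)
    finally show "\<kappa> / (rho 1)\<^sup>2 * (r powr delta n k w r) ^ (k + 1) \<le> (u_inf - u r) ^ (k + 1)" .
  qed
  then show ?thesis by simp
qed

text \<open>On a bounded interval no decay is at stake: the right-hand side of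
  \<open>powr_delta\<close> is continuous, hence bounded, and the gap is at least its positive value
  at the right end. The sign of the radicand does not matter.\<close>

lemma gap_bound_compact:
  "\<exists>M>0. \<forall>r\<ge>1. r \<in> {1..b} \<longrightarrow> M * r powr delta n k w r \<le> u_inf - u r"
proof -
  let ?P = "\<lambda>r. r powr (2 * real k + 2 - real n) * exp (2 * (Phi r - ln (rho r) + ln (rho 1)))"
  have contPhi: "continuous_on {1..b} Phi"
    by (rule DERIV_continuous_on[where D="\<lambda>r. sqrt (D r) / r"])
      (auto intro!: has_field_derivative_at_within Phi_DERIV)
  have rne: "rho r \<noteq> 0" for r using rho_pos[of r] by simp
  have "continuous_on {1..b} ?P"
    by (intro continuous_intros contPhi continuous_facts) (auto simp: rne)
  then have "bounded (?P ` {1..b})" by (intro compact_imp_bounded compact_continuous_image) auto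
  then obtain K where "\<forall>x\<in>?P ` {1..b}. norm x \<le> K" unfolding bounded_iff by blast
  then have K: "?P r \<le> K" if "r \<in> {1..b}" for r using that by force
  define K' where "K' = max K 1"
  define y where "y = (u_inf - u (max 1 b)) ^ (k + 1)"
  have y: "y > 0" unfolding y_def using u_less_inf[of "max 1 b"] by (intro zero_less_power) simp
  show ?thesis
  proof (rule gap_bound_from_power)
    show "y / K' > 0" using y by (simp add: K'_def)
    fix r assume r: "r \<in> {1..b}" "r \<ge> 1"
    have "y / K' * (r powr delta n k w r) ^ (k + 1) \<le> y / K' * K'"
      unfolding powr_delta[OF r(2)] using K[OF r(1)] y by (intro mult_left_mono) (auto simp: K'_def)
    also have "\<dots> = y" by (simp add: K'_def)
    also have "y \<le> (u_inf - u r) ^ (k + 1)"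
      unfolding y_def using u_mono[of r "max 1 b"] u_le_inf[of "max 1 b"] r by (intro power_mono) auto
    finally show "y / K' * (r powr delta n k w r) ^ (k + 1) \<le> (u_inf - u r) ^ (k + 1)" .
  qed
qed

text \<open>Below \<open>v_inf = -1\<close> the exponent is so small that the decay of the fundamental solution
  \<open>r powr (2 - n / k)\<close>, which needs no stability, is already enough.\<close>

lemma gap_bound_degenerate:
  assumes vi: "v_inf < - 1" and D0: "\<And>r. r \<ge> 1 \<Longrightarrow> D r \<ge> 0"
  shows "\<exists>M>0. \<forall>r\<ge>1. M * r powr delta n k w r \<le> u_inf - u r"
proof -
  define b where "b = real n / real k - 2"
  define a where "a r = - (v r + 1)" for r
  define ai where "ai = - (v_inf + 1)"
  have b: "b > 0" using n_div_k_gt by (simp add: b_def)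
  have ai: "ai > 0" using vi by (simp add: ai_def)
  have Da: "D r = a r * (a r - b) - r * deriv v r" for r
    by (simp add: D_eq a_def b_def algebra_simps)
  have a_le: "a r \<le> ai" if "r > 0" for r using v_ge_inf[OF that] by (simp add: a_def ai_def)
  have a_lim: "(a \<longlongrightarrow> ai) at_top"
    unfolding a_def[abs_def] ai_def by (intro tendsto_intros v_tendsto_inf)
  \<comment> \<open>If \<open>ai < b\<close>, then eventually
    \<open>a * (a - b) \<le> - \<kappa>\<close>, and a nonnegative radicand forces
    \<open>r * deriv v r \<le> - \<kappa>\<close>. So \<open>v\<close> would fall at least like
    \<open>- \<kappa> * ln r\<close>, against \<open>v \<ge> v_inf\<close>.\<close>
  have "ai \<ge> b"
  proof (rule ccontr)
    assume "\<not> ai \<ge> b"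
    define \<kappa> where "\<kappa> = ai / 2 * (b - ai)"
    have \<kappa>: "\<kappa> > 0" using ai \<open>\<not> ai \<ge> b\<close> by (simp add: \<kappa>_def)
    have "\<forall>\<^sub>F r in at_top. a r > ai / 2" by (rule order_tendstoD(1)[OF a_lim]) (use ai in simp)
    then obtain R where R: "R \<ge> 1" "\<And>r. r \<ge> R \<Longrightarrow> a r > ai / 2"
      unfolding eventually_at_top_linorder by (metis linorder_le_cases order_trans)
    have dv: "r * deriv v r \<le> - \<kappa>" if "r \<ge> R" for r
    proof -
      have "ai / 2 * (b - ai) \<le> a r * (b - a r)"
        using R(2)[OF that] a_le[of r] R(1) that \<open>\<not> ai \<ge> b\<close> ai by (intro mult_mono) auto
      then show ?thesis using D0[of r] R(1) that by (simp add: Da \<kappa>_def algebra_simps)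
    qed
    have vl: "v r + \<kappa> * ln r \<le> v R + \<kappa> * ln R" if "r \<ge> R" for r
    proof (rule DERIV_nonpos_imp_nonincreasing[where f="\<lambda>r. v r + \<kappa> * ln r"])
      fix x assume x: "R \<le> x" "x \<le> r"
      then have x0: "x > 0" using R by simp
      have "((\<lambda>r. v r + \<kappa> * ln r) has_real_derivative deriv v x + \<kappa> * (1 / x)) (at x)"
        using x0 by (auto intro!: derivative_eq_intros v_DERIV)
      moreover have "deriv v x + \<kappa> * (1 / x) \<le> 0" using dv[OF x(1)] x0 by (simp add: field_simps)
      ultimately show "\<exists>y. ((\<lambda>r. v r + \<kappa> * ln r) has_real_derivative y) (at x) \<and> y \<le> 0" by blast
    qed (use that in simp)
    define T where "T = max R (exp ((v R + \<kappa> * ln R - v_inf) / \<kappa> + 1))"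
    have T: "T \<ge> R" "T > 0" using R by (auto simp: T_def)
    have "(v R + \<kappa> * ln R - v_inf) / \<kappa> + 1 \<le> ln T"
      using T by (subst ln_ge_iff) (auto simp: T_def)
    then have "\<kappa> * ((v R + \<kappa> * ln R - v_inf) / \<kappa> + 1) \<le> \<kappa> * ln T" using \<kappa> by (intro mult_left_mono) auto
    then have "v R + \<kappa> * ln R - v_inf + \<kappa> \<le> \<kappa> * ln T" using \<kappa> by (simp add: distrib_left)
    then show False using vl[OF T(1)] v_ge_inf[OF T(2)] \<kappa> by linarith
  qed
  then have "\<forall>\<^sub>F r in at_top. a r > 3 * b / 4" by (intro order_tendstoD(1)[OF a_lim]) (use b in simp)
  then obtain R where R: "R \<ge> 1" "\<And>r. r \<ge> R \<Longrightarrow> a r > 3 * b / 4"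
    unfolding eventually_at_top_linorder by (metis linorder_le_cases order_trans)
  \<comment> \<open>Completing the square,
    \<open>a * (a - b) = (a - b / 2)\<^sup>2 - (b / 2)\<^sup>2\<close>. The threshold
    \<open>3 * b / 4\<close> keeps \<open>a - b / 2\<close> above \<open>b / 4\<close>, so the term
    \<open>- r * deriv v r\<close> can be taken out of the root at the price of the factor
    \<open>2 / b\<close>.\<close>
  have sq: "sqrt (D r) \<le> a r - b / 2 - 2 / b * (r * deriv v r)" if r: "r \<ge> R" for r
  proof (rule real_le_lsqrt)
    have r0: "r > 0" using r R by simp
    define Y where "Y = - (r * deriv v r)"
    have Y: "Y \<ge> 0" using v'_nonpos[OF r0] r0 by (simp add: Y_def mult_nonneg_nonpos)
    have ab: "a r - b / 2 > b / 4" using R(2)[OF r] b by simp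
    have "0 \<le> a r - b / 2 + 2 / b * Y" using ab b Y by simp
    then show "0 \<le> a r - b / 2 - 2 / b * (r * deriv v r)" by (simp add: Y_def)
    have "Y = 2 * (b / 4) * (2 / b * Y)" using b by simp
    also have "\<dots> \<le> 2 * (a r - b / 2) * (2 / b * Y)"
      using ab b Y by (intro mult_right_mono) auto
    finally have Y1: "Y \<le> 2 * (a r - b / 2) * (2 / b * Y)" .
    have "D r = (a r - b / 2)\<^sup>2 - (b / 2)\<^sup>2 + Y"
      by (simp add: Da Y_def power2_eq_square algebra_simps)
    also have "\<dots> \<le> (a r - b / 2)\<^sup>2 + 2 * (a r - b / 2) * (2 / b * Y) + (2 / b * Y)\<^sup>2"
      using Y1 zero_le_power2[of "b / 2"] zero_le_power2[of "2 / b * Y"] by linarith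
    also have "\<dots> = (a r - b / 2 + 2 / b * Y)\<^sup>2" by (rule power2_sum[symmetric, THEN trans[rotated]]) simp
    finally show "D r \<le> (a r - b / 2 - 2 / b * (r * deriv v r))\<^sup>2" by (simp add: Y_def)
  qed
  \<comment> \<open>The integrated form of \<open>sq\<close>: in \<open>v + sqrt D\<close> the two
    occurrences of \<open>v\<close> cancel, leaving \<open>- (1 + b / 2)\<close>, and the term with
    \<open>deriv v\<close> integrates to \<open>2 / b * v\<close>, which is bounded below by
    \<open>2 / b * v_inf\<close>.\<close>
  define \<Psi> where "\<Psi> r = Phi r - ln (rho r) + (1 + b / 2) * ln r + 2 / b * v r" for r
  have \<Psi>_mono: "\<Psi> r \<le> \<Psi> R" if r: "r \<ge> R" for r
  proof (rule DERIV_nonpos_imp_nonincreasing[where f=\<Psi>])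
    fix x assume x: "R \<le> x" "x \<le> r"
    then have x0: "x > 0" "x > 1 / 2" using R by auto
    have "(\<Psi> has_real_derivative sqrt (D x) / x - (1 / rho x) * (- v x * rho x / x) + (1 + b / 2) * (1 / x)
        + 2 / b * deriv v x) (at x)"
      unfolding \<Psi>_def[abs_def] using rho_pos[of x] x0
      by (intro DERIV_add DERIV_diff DERIV_cmult Phi_DERIV v_DERIV DERIV_ln_divide
          DERIV_chain2[OF DERIV_ln_divide rho_DERIV]) auto
    moreover have "sqrt (D x) / x - (1 / rho x) * (- v x * rho x / x) + (1 + b / 2) * (1 / x) + 2 / b * deriv v x
        = (sqrt (D x) - (a x - b / 2 - 2 / b * (x * deriv v x))) / x"
      using rho_pos[of x] x0 by (simp add: a_def add_divide_distrib diff_divide_distrib)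
    moreover have "\<dots> \<le> 0" using sq[OF x(1)] x0 by (intro divide_nonpos_pos) auto
    ultimately show "\<exists>y. (\<Psi> has_real_derivative y) (at x) \<and> y \<le> 0" by auto
  qed (use r in simp)
  obtain a0 where a0: "a0 > 0" "\<And>r. r \<ge> 1 \<Longrightarrow> a0 * r powr (2 - real n / real k) \<le> u_inf - u r"
    using u_gap_ge by blast
  define P where "P = \<Psi> R - 2 / b * v_inf"
  define K where "K = exp (2 * (P + ln (rho 1)))"
  have "\<exists>M>0. \<forall>r\<ge>1. r \<in> {R..} \<longrightarrow> M * r powr delta n k w r \<le> u_inf - u r"
  proof (rule gap_bound_from_power)
    show "a0 ^ (k + 1) / K > 0" using a0 by (simp add: K_def)
    fix r assume r: "r \<in> {R..}" "r \<ge> 1"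
    have r0: "r > 0" using r by simp
    have "Phi r - ln (rho r) \<le> P - (1 + b / 2) * ln r"
      using \<Psi>_mono[of r] r v_ge_inf[OF r0] b mult_left_mono[of v_inf "v r" "2 / b"]
      by (simp add: \<Psi>_def P_def)
    then have "2 * (Phi r - ln (rho r) + ln (rho 1)) \<le> 2 * (P + ln (rho 1)) + (- 2 - b) * ln r"
      by (simp add: algebra_simps)
    then have "exp (2 * (Phi r - ln (rho r) + ln (rho 1))) \<le> K * r powr (- 2 - b)"
      using r0 unfolding K_def powr_def by (simp flip: exp_add)
    then have "(r powr delta n k w r) ^ (k + 1) \<le> r powr (2 * real k + 2 - real n) * (K * r powr (- 2 - b))"
      unfolding powr_delta[OF r(2)] by (intro mult_left_mono) auto
    also have "\<dots> = K * r powr (2 * real k + 2 - real n + (- 2 - b))"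
      by (simp only: powr_add[of r "2 * real k + 2 - real n"] mult.left_commute)
    \<comment> \<open>The resulting exponent is exactly that of the fundamental solution, raised to
      the power \<open>k + 1\<close>, so \<open>u_gap_ge\<close> applies without loss.\<close>
    also have "2 * real k + 2 - real n + (- 2 - b) = (2 - real n / real k) * real (k + 1)"
    proof -
      define q where "q = real n / real k"
      have "2 * real k + 2 - q * real k + (- 2 - (q - 2)) = (2 - q) * real (k + 1)"
        by (simp add: algebra_simps)
      moreover have "q * real k = real n" using k1 by (simp add: q_def)
      ultimately show ?thesis by (simp only: b_def q_def)
    qed
    also have "r powr ((2 - real n / real k) * real (k + 1)) = (r powr (2 - real n / real k)) ^ (k + 1)"
      using r0 by (subst powr_power) (simp_all only: mult.commute simp_thms less_imp_neq[THEN not_sym])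
    finally have "a0 ^ (k + 1) / K * (r powr delta n k w r) ^ (k + 1) \<le>
        a0 ^ (k + 1) / K * (K * (r powr (2 - real n / real k)) ^ (k + 1))"
      using a0 by (intro mult_left_mono) (auto simp: K_def)
    also have "\<dots> = (a0 * r powr (2 - real n / real k)) ^ (k + 1)"
      unfolding power_mult_distrib by (simp add: K_def)
    also have "\<dots> \<le> (u_inf - u r) ^ (k + 1)"
      using a0 r by (intro power_mono) auto
    finally show "a0 ^ (k + 1) / K * (r powr delta n k w r) ^ (k + 1) \<le> (u_inf - u r) ^ (k + 1)" .
  qed
  then obtain M1 where M1: "M1 > 0" "\<And>r. r \<ge> 1 \<Longrightarrow> r \<ge> R \<Longrightarrow> M1 * r powr delta n k w r \<le> u_inf - u r"
    by auto
  obtain M2 where M2: "M2 > 0" "\<And>r. r \<ge> 1 \<Longrightarrow> r \<le> R \<Longrightarrow> M2 * r powr delta n k w r \<le> u_inf - u r"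
    using gap_bound_compact[of R] by auto
  show ?thesis
  proof (intro exI[of _ "min M1 M2"] conjI allI impI)
    fix r :: real assume r: "r \<ge> 1"
    have "min M1 M2 * r powr delta n k w r \<le> M1 * r powr delta n k w r"
      "min M1 M2 * r powr delta n k w r \<le> M2 * r powr delta n k w r"
      by (intro mult_right_mono; simp)+
    then show "min M1 M2 * r powr delta n k w r \<le> u_inf - u r"
      using M1(2)[OF r] M2(2)[OF r] by (cases "r \<ge> R") auto
  qed (use M1 M2 in simp)
qed

text \<open>If the radicand is negative at some \<open>b \<ge> 1\<close>, then
  \<open>alpha_defined\<close> fails from \<open>b\<close> on and only a bounded range of radii
  remains.\<close>

lemma gap_bound:
  "\<exists>M>0. \<forall>r\<ge>1. alpha_defined n k w r \<longrightarrow> M * r powr delta n k w r \<le> u_inf - u r"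
proof (cases "v_inf \<ge> - 1")
  case True
  then show ?thesis using gap_bound_regular by blast
next
  case False
  show ?thesis
  proof (cases "\<forall>r\<ge>1. D r \<ge> 0")
    case True
    then show ?thesis using gap_bound_degenerate False by force
  next
    case D: False
    then obtain b where b: "b \<ge> 1" "D b < 0" by force
    have "r \<in> {1..b}" if "r \<ge> 1" "alpha_defined n k w r" for r
      using that b by (force simp: alpha_defined_def)
    then show ?thesis using gap_bound_compact[of b] by blast
  qed
qed

end

text \<open>\<open>w_nonzero\<close> makes explicit what the quotient \<open>W\<close> presupposes,
  since division by 0 has the value 0. The condition \<open>alpha_defined\<close> restricts the
  decay estimate to radii at which the square root in the exponent is real.\<close>

theorem theorem1p4:
  fixes k :: nat and g w u :: "real \<Rightarrow> real" and \<Gamma> \<gamma> :: real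
  assumes n: "CARD('n::finite) \<ge> 2"
    and k: "k \<in> {1..CARD('n)}"
    and g_C1: "g C1_differentiable_on UNIV"
    and g_nonneg: "\<forall>t. g t \<ge> 0"
    and g_antimono: "antimono g"
    and w_nonneg: "\<forall>r>0. w r \<ge> 0"
    and w_nonzero: "\<forall>r>0. w r \<noteq> 0"
    and w_C1: "C1_on (- {0}) (radial w :: real ^ 'n \<Rightarrow> real)"
    and W_C1: "C1_on (- {0}) (radial (W_fun w) :: real ^ 'n \<Rightarrow> real)"
    and W_noninc: "antimono_on {0<..} (W_fun w)"
    and W_0: "(W_fun w \<longlongrightarrow> \<Gamma>) (at_right 0)"
    and W_inf: "(W_fun w \<longlongrightarrow> \<gamma>) at_top"
    and solution: "radial_solution k w g (radial u :: real ^ 'n \<Rightarrow> real)"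
    and stable: "semi_stable k w g (radial u :: real ^ 'n \<Rightarrow> real)"
    and nonconstant: "\<not> (radial u :: real ^ 'n \<Rightarrow> real) constant_on UNIV"
    and bounded: "bounded (range (radial u :: real ^ 'n \<Rightarrow> real))"
  shows "real CARD('n) > 2 * (real k + 2 * \<gamma> / real k + 4) \<and>
    (\<exists>u_inf. (u \<longlongrightarrow> u_inf) at_top \<and>
       (\<exists>M>0. \<forall>r\<ge>1. alpha_defined CARD('n) k w r \<longrightarrow>
          \<bar>u r - u_inf\<bar> \<ge> M * r powr delta CARD('n) k w r))"
proof -
  let ?n = "CARD('n)"
  have C2: "C2 (radial u :: real ^ 'n \<Rightarrow> real)"
    using solution by (simp add: radial_solution_def k_admissible_def)
  note uC2 = radial_C2_profile[OF C2]
  note wC1 = C1_on_radial_imp_DERIV[OF w_C1 order_refl]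
  note WC1 = C1_on_radial_imp_DERIV[OF W_C1 order_refl]
  note prof = radial_solution_profile[OF n k solution]
  obtain g' where g': "\<And>t. (g has_real_derivative g' t) (at t)" "continuous_on UNIV g'"
    using g_C1 by (auto simp: C1_differentiable_on_def has_real_derivative_iff_has_vector_derivative)
  have g'_eq: "deriv g = g'" using g'(1) DERIV_imp_deriv by blast
  have w_pos: "w r > 0" if "r > 0" for r using that w_nonneg w_nonzero by (simp add: order_less_le)
  have w_cont: "continuous_on {0<..} w"
    using wC1(1) by (auto intro!: continuous_at_imp_continuous_on intro: DERIV_isCont)
  have du_cont: "continuous_on {0<..} (deriv u)"
    using uC2(2) by (auto intro!: continuous_at_imp_continuous_on intro: DERIV_isCont)
  fix i :: 'n
  have val: "u r = radial u (r *\<^sub>R axis i 1 :: real ^ 'n)" if "r > 0" for r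
    using that by simp
  obtain B where B: "\<And>x :: real ^ 'n. \<bar>radial u x\<bar> \<le> B"
    using bounded by (auto simp: bounded_iff)
  have nonconst: "\<exists>r>0. u r \<noteq> u 0"
  proof (rule ccontr)
    assume "\<not> (\<exists>r>0. u r \<noteq> u 0)"
    then have "radial u x = u 0" for x :: "real ^ 'n"
      by (cases "x = 0") (auto simp: radial_def)
    then show False using nonconstant by (auto simp: constant_on_def)
  qed
  interpret stable_profile ?n k "c_nk ?n k" \<Gamma> \<gamma> B g w u
  proof
    show "c_nk ?n k > 0" using k by (simp add: c_nk_def)
    show "u r \<le> B" if "r > 0" for r using val[OF that] B[of "r *\<^sub>R axis i 1"] by simp
    show "0 \<le> integral {a..b} (\<lambda>r. real k * r ^ (?n - k) * deriv u r ^ (k - 1) * (\<phi>' r)\<^sup>2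
        + r ^ (?n - 1) * w r * deriv g (u r) / c_nk ?n k * (\<phi> r)\<^sup>2)"
      if "0 < a" "a < b" "\<And>r. r > 0 \<Longrightarrow> (\<phi> has_real_derivative \<phi>' r) (at r)" "continuous_on {0<..} \<phi>'"
        "\<And>r. r \<notin> {a..b} \<Longrightarrow> \<phi> r = 0" for a b \<phi> \<phi>'
      by (rule semi_stable_radial_test[OF n k stable uC2(1) du_cont prof(1) w_cont])
        (use that g'(2) in \<open>auto simp: g'_eq\<close>)
  qed (use n k g' g_nonneg g_antimono w_pos wC1 WC1 W_noninc W_0 W_inf uC2 prof nonconst in \<open>auto simp: g'_eq\<close>)
  obtain M where M: "M > 0" "\<And>r. r \<ge> 1 \<Longrightarrow> alpha_defined ?n k w r \<Longrightarrow> M * r powr delta ?n k w r \<le> u_inf - u r"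
    using gap_bound by blast
  have "\<bar>u r - u_inf\<bar> \<ge> M * r powr delta ?n k w r" if "r \<ge> 1" "alpha_defined ?n k w r" for r
    using M(2)[OF that] by linarith
  then show ?thesis using dimension_bound u_tendsto M(1) by blast
qed

end
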